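(* Let $n\in\{2,3\}$ and let $X=(g_1,\dots,g_n)$ be an $n$-tuple of isometries of a simplicial tree $T$. If $X$ is minimal, then either some $g_i$ is elliptic, or $X$ satisfies the hypotheses of the Ping Pong Lemma.
   Context: Let $T$ be a simplicial tree with vertex set $V(T)$ and standard path metric $d$ (each edge has length $1$); $T$ is identified with its geometric realization. Every isometry considered is assumed to act on $T$ without inversions (this can be arranged by subdividing edges). The translation length of an isometry $g$ is $l(g)=\min_{x\in V(T)}d(x,gx)$. If $l(g)=0$, $g$ is elliptic (it fixes a vertex). If $l(g)>0$, $g$ is hyperbolic, and its axis is the bi-infinite path in $T$ on which $g$ acts by translations of length $l(g)$. For an $n$-tuple $X=(g_1,\dots,g_n)$ of isometries of $T$ define $$L(X)=\sum_{1\le i\le n} l(g_i)+\sum_{1\le i<j\le n}\bigl(l(g_ig_j)+l(g_ig_j^{-1})\bigr).$$ For $j\in\{1,\dots,n\}$ and subsets $S_1,S_2\subseteq\{1,\dots,n\}\setminus\{j\}$, let $X^{j}_{S_1,S_2}$ be the $n$-tuple obtained from $X$ by leaving $g_j$ unchanged and, for $i\ne j$, replacing $g_i$ by: $g_jg_i$ if $i\in S_1\setminus S_2$; $g_ig_j^{-1}$ if $i\in S_2\setminus S_1$; $g_jg_ig_j^{-1}$ if $i\in S_1\cap S_2$; $g_i$ otherwise. The tuple $X$ is minimal if $L(X)\le L(X^{j}_{S_1,S_2})$ for every $j\in\{1,\dots,n\}$ and all $S_1,S_2\subseteq\{1,\dots,n\}\setminus\{j\}$. For hyperbolic $g_i,g_j$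 with axes $\gamma_i,\gamma_j$, the projection of $\gamma_j$ onto $\gamma_i$ is $\mathrm{Proj}_{\gamma_i}(\gamma_j)=\{x\in\gamma_i: d(x,\gamma_j)=d(\gamma_i,\gamma_j)\}$; it is the unique vertex of $\gamma_i$ closest to $\gamma_j$ if $\gamma_i\cap\gamma_j=\varnothing$, and equals $\gamma_i\cap\gamma_j$ otherwise. An $n$-tuple $X=(g_1,\dots,g_n)$ satisfies the hypotheses of the Ping Pong Lemma if all $g_i$ are hyperbolic, with axes $\gamma_1,\dots,\gamma_n$, and for each $1\le i\le n$ there is an open segment $P_i\subseteq\gamma_i$ of length $l(g_i)$ (endpoints not required to be vertices) such that $\bigcup_{j\neq i}\mathrm{Proj}_{\gamma_i}(\gamma_j)\subseteq P_i$. *)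

theory Defs
  imports Complex_Main "HOL-Algebra.Bij" "HOL-Algebra.Generated_Groups"
begin

text \<open>
  A simplicial tree is given by the adjacency relation on its vertices; the vertex set
  \<open>V(T)\<close> is the whole type \<^typ>\<open>'v\<close>, which may be infinite, and no local finiteness is assumed.
\<close>

unbundle no m_inv_syntax

definition graph_cycle :: "('v \<Rightarrow> 'v \<Rightarrow> bool) \<Rightarrow> 'v list \<Rightarrow> bool" where
  "graph_cycle adj p \<longleftrightarrow>
     3 \<le> length p \<and> distinct p \<and> successively adj p \<and> adj (last p) (hd p)"

definition simplicial_tree :: "('v \<Rightarrow> 'v \<Rightarrow> bool) \<Rightarrow> bool" where
  "simplicial_tree adj \<longleftrightarrow>
     (\<forall>u v. adj u v \<longrightarrow> adj v u) \<and> (\<forall>u. \<not> adj u u) \<and>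
     (\<forall>u v. adj\<^sup>*\<^sup>* u v) \<and> (\<nexists>p. graph_cycle adj p)"

definition vdist :: "('v \<Rightarrow> 'v \<Rightarrow> bool) \<Rightarrow> 'v \<Rightarrow> 'v \<Rightarrow> nat" where
  "vdist adj u v = (LEAST k. (adj ^^ k) u v)"


subsection \<open>Isometries\<close>

text \<open>Isometries are simplicial, so they are represented by their action on the vertices.\<close>

definition tree_isometry :: "('v \<Rightarrow> 'v \<Rightarrow> bool) \<Rightarrow> ('v \<Rightarrow> 'v) \<Rightarrow> bool" where
  "tree_isometry adj g \<longleftrightarrow> bij g \<and> (\<forall>u v. vdist adj (g u) (g v) = vdist adj u v)"

definition without_inversions :: "('v \<Rightarrow> 'v \<Rightarrow> bool) \<Rightarrow> ('v \<Rightarrow> 'v) \<Rightarrow> bool" where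
  "without_inversions adj g \<longleftrightarrow> \<not> (\<exists>u v. adj u v \<and> g u = v \<and> g v = u)"

text \<open>The group generated by the entries of the tuple \<open>X 1, \<dots>, X n\<close>.\<close>

definition tuple_group :: "nat \<Rightarrow> (nat \<Rightarrow> 'v \<Rightarrow> 'v) \<Rightarrow> ('v \<Rightarrow> 'v) set" where
  "tuple_group n X = generate (BijGroup UNIV) (X ` {1..n})"

definition transl_len :: "('v \<Rightarrow> 'v \<Rightarrow> bool) \<Rightarrow> ('v \<Rightarrow> 'v) \<Rightarrow> nat" where
  "transl_len adj g = (LEAST k. \<exists>x. vdist adj x (g x) = k)"

definition elliptic :: "('v \<Rightarrow> 'v \<Rightarrow> bool) \<Rightarrow> ('v \<Rightarrow> 'v) \<Rightarrow> bool" where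
  "elliptic adj g \<longleftrightarrow> transl_len adj g = 0"

definition hyperbolic :: "('v \<Rightarrow> 'v \<Rightarrow> bool) \<Rightarrow> ('v \<Rightarrow> 'v) \<Rightarrow> bool" where
  "hyperbolic adj g \<longleftrightarrow> 0 < transl_len adj g"


subsection \<open>Minimal tuples\<close>

definition total_len :: "('v \<Rightarrow> 'v \<Rightarrow> bool) \<Rightarrow> nat \<Rightarrow> (nat \<Rightarrow> 'v \<Rightarrow> 'v) \<Rightarrow> nat" where
  "total_len adj n X =
     (\<Sum>i\<in>{1..n}. transl_len adj (X i)) +
     (\<Sum>i\<in>{1..n}. \<Sum>j\<in>{i<..n}.
        transl_len adj (X i \<circ> X j) + transl_len adj (X i \<circ> inv (X j)))"

definition tuple_move ::
    "nat \<Rightarrow> nat set \<Rightarrow> nat set \<Rightarrow> (nat \<Rightarrow> 'v \<Rightarrow> 'v) \<Rightarrow> nat \<Rightarrow> 'v \<Rightarrow> 'v" where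
  "tuple_move j S1 S2 X =
     (\<lambda>i. if i \<in> S1 - S2 then X j \<circ> X i
          else if i \<in> S2 - S1 then X i \<circ> inv (X j)
          else if i \<in> S1 \<inter> S2 then X j \<circ> X i \<circ> inv (X j)
          else X i)"

definition minimal_tuple :: "('v \<Rightarrow> 'v \<Rightarrow> bool) \<Rightarrow> nat \<Rightarrow> (nat \<Rightarrow> 'v \<Rightarrow> 'v) \<Rightarrow> bool" where
  "minimal_tuple adj n X \<longleftrightarrow>
     (\<forall>j\<in>{1..n}. \<forall>S1 S2. S1 \<subseteq> {1..n} - {j} \<longrightarrow> S2 \<subseteq> {1..n} - {j} \<longrightarrow>
        total_len adj n X \<le> total_len adj n (tuple_move j S1 S2 X))"


subsection \<open>The geometric realization\<close>

text \<open>
  Points of the geometric realization are given by barycentric coordinates: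
  \<open>edge_point u v t\<close> is the point at distance \<open>t\<close> from \<open>u\<close> on the edge from \<open>u\<close> to \<open>v\<close>,
  and \<open>edge_point u u t\<close> is the vertex \<open>u\<close>.
\<close>

definition edge_point :: "'v \<Rightarrow> 'v \<Rightarrow> real \<Rightarrow> 'v \<Rightarrow> real" where
  "edge_point u v t = (\<lambda>w. (1 - t) * of_bool (w = u) + t * of_bool (w = v))"

definition realization :: "('v \<Rightarrow> 'v \<Rightarrow> bool) \<Rightarrow> ('v \<Rightarrow> real) set" where
  "realization adj = {edge_point u v t | u v t. (u = v \<or> adj u v) \<and> 0 \<le> t \<and> t \<le> 1}"

definition supp :: "('v \<Rightarrow> real) \<Rightarrow> 'v set" where
  "supp x = {v. x v \<noteq> 0}"

text \<open>
  The path metric. Two points of a common closed edge are joined inside it, at distance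
  half the l1-distance of their coordinates. Otherwise the path from \<open>x\<close> to \<open>y\<close>
  leaves the edge of \<open>x\<close> through one of its endpoints \<open>u\<close>, at distance \<open>1 - x u\<close> from \<open>x\<close>,
  and enters the edge of \<open>y\<close> through one of its endpoints \<open>v\<close>. If \<open>x\<close> or \<open>y\<close> is a
  vertex, it is its own only endpoint.
\<close>

definition gdist :: "('v \<Rightarrow> 'v \<Rightarrow> bool) \<Rightarrow> ('v \<Rightarrow> real) \<Rightarrow> ('v \<Rightarrow> real) \<Rightarrow> real" where
  "gdist adj x y =
     (if \<exists>u v. (u = v \<or> adj u v) \<and> supp x \<union> supp y \<subseteq> {u, v}
      then (\<Sum>w\<in>supp x \<union> supp y. \<bar>x w - y w\<bar>) / 2
      else Min {(1 - x u) + real (vdist adj u v) + (1 - y v) | u v. u \<in> supp x \<and> v \<in> supp y})"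

definition gsetdist :: "('v \<Rightarrow> 'v \<Rightarrow> bool) \<Rightarrow> ('v \<Rightarrow> real) set \<Rightarrow> ('v \<Rightarrow> real) set \<Rightarrow> real" where
  "gsetdist adj A B = (INF (x, y)\<in>A \<times> B. gdist adj x y)"


subsection \<open>Axes, projections and the Ping Pong hypotheses\<close>

text \<open>
  \<open>\<gamma>\<close> is the set of points of a bi-infinite path \<open>\<dots>, p (-1), p 0, p 1, \<dots>\<close> without repeated
  vertices that \<open>g\<close> translates by \<open>l(g)\<close>. Translation of the vertices determines the action of
  \<open>g\<close> on the whole of \<open>\<gamma>\<close>.
\<close>

definition is_axis :: "('v \<Rightarrow> 'v \<Rightarrow> bool) \<Rightarrow> ('v \<Rightarrow> 'v) \<Rightarrow> ('v \<Rightarrow> real) set \<Rightarrow> bool" where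
  "is_axis adj g \<gamma> \<longleftrightarrow>
     (\<exists>p :: int \<Rightarrow> 'v. inj p \<and> (\<forall>k. adj (p k) (p (k + 1))) \<and>
        (\<forall>k. g (p k) = p (k + int (transl_len adj g))) \<and>
        \<gamma> = {edge_point (p k) (p (k + 1)) t | k t. 0 \<le> t \<and> t \<le> 1})"

definition axis_proj ::
    "('v \<Rightarrow> 'v \<Rightarrow> bool) \<Rightarrow> ('v \<Rightarrow> real) set \<Rightarrow> ('v \<Rightarrow> real) set \<Rightarrow> ('v \<Rightarrow> real) set" where
  "axis_proj adj A B = {x \<in> A. gsetdist adj {x} B = gsetdist adj A B}"

text \<open>An open segment of length \<open>r\<close> is an isometric copy of the real interval \<open>(0, r)\<close>.\<close>

definition is_open_segment ::
    "('v \<Rightarrow> 'v \<Rightarrow> bool) \<Rightarrow> real \<Rightarrow> ('v \<Rightarrow> real) set \<Rightarrow> bool" where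
  "is_open_segment adj r P \<longleftrightarrow>
     (\<exists>c :: real \<Rightarrow> 'v \<Rightarrow> real. c ` {0<..<r} = P \<and> P \<subseteq> realization adj \<and>
        (\<forall>s\<in>{0<..<r}. \<forall>t\<in>{0<..<r}. gdist adj (c s) (c t) = \<bar>s - t\<bar>))"

definition ping_pong_hyps :: "('v \<Rightarrow> 'v \<Rightarrow> bool) \<Rightarrow> nat \<Rightarrow> (nat \<Rightarrow> 'v \<Rightarrow> 'v) \<Rightarrow> bool" where
  "ping_pong_hyps adj n X \<longleftrightarrow>
     (\<forall>i\<in>{1..n}. hyperbolic adj (X i)) \<and>
     (\<exists>\<gamma>. (\<forall>i\<in>{1..n}. is_axis adj (X i) (\<gamma> i)) \<and>
        (\<forall>i\<in>{1..n}. \<exists>P. is_open_segment adj (real (transl_len adj (X i))) P \<and> P \<subseteq> \<gamma> i \<and>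
           (\<Union>j\<in>{1..n} - {i}. axis_proj adj (\<gamma> i) (\<gamma> j)) \<subseteq> P))"

end

theory Submission
  imports Defs
begin

text \<open>
  The translation lengths of \<open>g h\<close> and \<open>g h\<^sup>-\<^sup>1\<close> are determined by the distance of the axes of \<open>g\<close> and \<open>h\<close>
  if these are disjoint, and by the length and orientation of their overlap otherwise, so a
  configuration of axes that violates the Ping Pong hypotheses can be shortened.

  An overlap of length at least \<open>min (l g) (l h)\<close> is shortened by dividing the longer isometry \<open>h\<close>
  by \<open>g\<close> on one side; which side, and what to do with the third isometry, depends on where the
  third axis meets that of \<open>h\<close>. Now let all overlaps be short, and let the projections of two axes to
  the axis of \<open>g\<close> spread over at least \<open>l g\<close>. If they are disjoint, then conjugating one isometry by
  \<open>g\<close> brings the two axes closer together. If they share a segment, then dividing both isometries by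
  \<open>g\<close> decreases the total length. If they share a single vertex, then the three axes form a tripod;
  the isometry whose two legs exceed its translation length most is used to divide its neighbour on
  the longer leg.
\<close>

section \<open>Trees as metric spaces\<close>

text \<open>A move that shortens one pair may lengthen another: replacing \<open>h\<close> by
  \<open>h - g\<close> also changes \<open>F h k\<close>. Exact lengths are computed for the given
  tuple; for the moved tuple upper bounds from closed paths suffice, so that, with one exception,
  its axes need not be located. The effect on \<open>k\<close> is controlled by one observation. If
  \<open>g\<close> translates the segment \<open>[s, s + l g]\<close> of the axis of
  \<open>h\<close>, then \<open>h - g\<close> carries the vertex at \<open>s + l g\<close> to the
  one at \<open>s + l h\<close>, and \<open>- g + h\<close> carries the vertex at
  \<open>s + l g - l h\<close> to the one at \<open>s\<close>. Dividing on the right or on the left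
  thus retains the part of a period of \<open>h\<close> that lies to the right or to the left of the
  segment of \<open>g\<close>, and the side to choose is the one whose retained part runs along the
  axis of \<open>k\<close>. In a symmetric position neither side wins alone, but the unknown
  position cancels in the sum of both inequalities. All of this uses integer parameters on the axes.
  A set of integer parameters of spread less than \<open>l g\<close> leaves half a unit of room at
  each end, which is what an open segment of length \<open>l g\<close> requires.\<close>

locale stree =
  fixes adj :: "'v \<Rightarrow> 'v \<Rightarrow> bool"
  assumes tree: "simplicial_tree adj"
begin

lemma adj_sym: "adj u v \<Longrightarrow> adj v u"
  and adj_irrefl: "\<not> adj u u"
  and connected: "adj\<^sup>*\<^sup>* u v"
  and acyclic: "\<not> graph_cycle adj p"
  using tree unfolding simplicial_tree_def by auto

definition d :: "'v \<Rightarrow> 'v \<Rightarrow> int" where "d u v = int (vdist adj u v)"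

section \<open>Reduced walks, geodesics and medians\<close>

definition walk :: "(nat \<Rightarrow> 'v) \<Rightarrow> nat \<Rightarrow> bool" where
  "walk f n \<longleftrightarrow> (\<forall>i<n. adj (f i) (f (Suc i)))"

definition reduced :: "(nat \<Rightarrow> 'v) \<Rightarrow> nat \<Rightarrow> bool" where
  "reduced f n \<longleftrightarrow> walk f n \<and> (\<forall>i. Suc (Suc i) \<le> n \<longrightarrow> f i \<noteq> f (Suc (Suc i)))"

lemma ex_walk: "\<exists>f. f 0 = u \<and> f (vdist adj u v) = v \<and> walk f (vdist adj u v)"
proof -
  obtain k where "(adj ^^ k) u v"
    using connected[of u v] rtranclp_imp_relpowp by metis
  then have "(adj ^^ (vdist adj u v)) u v" unfolding vdist_def by (rule LeastI)
  then show ?thesis unfolding walk_def by (auto simp: relpowp_fun_conv)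
qed

lemma walk_vdist_le: "walk f n \<Longrightarrow> vdist adj (f 0) (f n) \<le> n"
  unfolding vdist_def walk_def by (intro Least_le) (auto simp: relpowp_fun_conv)

lemma d_nonneg [simp]: "0 \<le> d u v"
  by (simp add: d_def)

lemma d_self [simp]: "d u u = 0"
  using walk_vdist_le[of "\<lambda>_. u" 0] by (simp add: d_def walk_def)

lemma d_0_iff [simp]: "d u v = 0 \<longleftrightarrow> u = v"
proof
  assume "d u v = 0"
  then show "u = v" using ex_walk[of u v] by (auto simp: d_def)
qed simp

lemma walk_rev:
  assumes "walk f n" shows "walk (\<lambda>i. f (n - i)) n"
  unfolding walk_def
proof (intro allI impI)
  fix i assume "i < n"
  then have "n - i = Suc (n - Suc i)" "n - Suc i < n" by auto
  then show "adj (f (n - i)) (f (n - Suc i))"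
    using assms adj_sym unfolding walk_def by metis
qed

lemma d_sym: "d u v = d v u"
proof -
  have "vdist adj v u \<le> vdist adj u v" for u v
  proof -
    obtain f where "f 0 = u" "f (vdist adj u v) = v" "walk f (vdist adj u v)" using ex_walk by blast
    then show ?thesis using walk_vdist_le[OF walk_rev] by fastforce
  qed
  then show ?thesis by (simp add: d_def le_antisym)
qed

lemma walk_append:
  assumes "walk f n" "walk h m" "f n = h 0"
  shows "walk (\<lambda>i. if i \<le> n then f i else h (i - n)) (n + m)"
  unfolding walk_def
proof (intro allI impI)
  fix i assume "i < n + m"
  consider "i < n" | "i = n" | "n < i" by linarith
  then show "adj (if i \<le> n then f i else h (i - n)) (if Suc i \<le> n then f (Suc i) else h (Suc i - n))"
  proof cases
    case 3
    then have "Suc i - n = Suc (i - n)" "i - n < m" using \<open>i < n + m\<close> by auto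
    then show ?thesis using assms 3 by (auto simp: walk_def)
  qed (use assms \<open>i < n + m\<close> in \<open>auto simp: walk_def\<close>)
qed

lemma d_triangle: "d u w \<le> d u v + d v w"
proof -
  obtain f where f: "f 0 = u" "f (vdist adj u v) = v" "walk f (vdist adj u v)" using ex_walk
    by blast
  obtain h where h: "h 0 = v" "h (vdist adj v w) = w" "walk h (vdist adj v w)" using ex_walk
    by blast
  have "vdist adj u w \<le> vdist adj u v + vdist adj v w"
    using walk_vdist_le[OF walk_append[OF f(3) h(3)]] f h by (auto split: if_splits)
  then show ?thesis by (simp add: d_def)
qed

lemma d_adj_iff: "adj u v \<longleftrightarrow> d u v = 1"
proof
  assume a: "adj u v"
  have "vdist adj u v \<le> 1"
    using walk_vdist_le[of "\<lambda>i. if i = 0 then u else v" 1] a by (simp add: walk_def)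
  moreover have "d u v \<noteq> 0" using a adj_irrefl by auto
  ultimately show "d u v = 1" by (simp add: d_def)
next
  assume "d u v = 1"
  then show "adj u v" using ex_walk[of u v] by (auto simp: d_def walk_def)
qed

text \<open>A shortest closed subwalk visits its vertices only once. Length 1 is excluded by
  irreflexivity and length 2 by reducedness, so it is a graph cycle.\<close>

lemma no_closed_reduced:
  assumes c: "reduced c N" and N: "0 < N"
  shows "c 0 \<noteq> c N"
proof
  assume "c 0 = c N"
  define Q where "Q k \<longleftrightarrow> (\<exists>i. 0 < k \<and> i + k \<le> N \<and> c i = c (i + k))" for k
  have "Q N" unfolding Q_def using N \<open>c 0 = c N\<close> by auto
  define k where "k = (LEAST k. Q k)"
  have Qk: "Q k" unfolding k_def using \<open>Q N\<close> by (rule LeastI)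
  have least: "\<not> Q j" if "j < k" for j using that not_less_Least unfolding k_def by blast
  obtain i where i: "0 < k" "i + k \<le> N" "c i = c (i + k)" using Qk Q_def by blast
  have adjc: "adj (c j) (c (Suc j))" if "j < N" for j using c that
    by (auto simp: reduced_def walk_def)
  have "k \<noteq> 1" using adjc[of i] i adj_irrefl by auto
  moreover have "k \<noteq> 2" using c i unfolding reduced_def by (auto simp: numeral_2_eq_2)
  ultimately have k3: "3 \<le> k" using i by linarith
  have inj: "inj_on c {i..<i + k}"
  proof (rule linorder_inj_onI')
    fix x y assume xy: "x \<in> {i..<i + k}" "y \<in> {i..<i + k}" "x < y"
    show "c x \<noteq> c y"
    proof
      assume "c x = c y"
      then have "Q (y - x)" unfolding Q_def using xy i by (intro exI[of _ x]) auto
      moreover have "y - x < k" using xy by auto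
      ultimately show False using least by blast
    qed
  qed
  have "successively adj (map c [i..<i + k])"
    unfolding successively_conv_nth using adjc i by auto
  moreover have "last (map c [i..<i + k]) = c (i + k - 1)" "hd (map c [i..<i + k]) = c i"
    using i by (auto simp: last_map hd_map)
  moreover have "adj (c (i + k - 1)) (c i)" using adjc[of "i + k - 1"] i by auto
  ultimately have "graph_cycle adj (map c [i..<i + k])"
    unfolding graph_cycle_def using k3 inj by (auto simp: distinct_map)
  then show False using acyclic by blast
qed

lemma reduced_less: "reduced f n \<Longrightarrow> m \<le> n \<Longrightarrow> reduced f m"
  unfolding reduced_def walk_def by auto

lemma reduced_append:
  assumes f: "reduced f n" and h: "reduced h m" and eq: "f n = h 0"
    and turn: "0 < n \<Longrightarrow> 0 < m \<Longrightarrow> f (n - 1) \<noteq> h 1"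
  shows "reduced (\<lambda>i. if i \<le> n then f i else h (i - n)) (n + m)"
  unfolding reduced_def
proof (intro conjI allI impI)
  show "walk (\<lambda>i. if i \<le> n then f i else h (i - n)) (n + m)"
    using walk_append f h eq by (auto simp: reduced_def)
next
  fix i assume i: "Suc (Suc i) \<le> n + m"
  consider "Suc (Suc i) \<le> n" | "Suc i = n" | "i = n" | "n < i" by linarith
  then show "(if i \<le> n then f i else h (i - n)) \<noteq>
      (if Suc (Suc i) \<le> n then f (Suc (Suc i)) else h (Suc (Suc i) - n))"
  proof cases
    case 1 then show ?thesis using f by (auto simp: reduced_def)
  next
    case 2 then show ?thesis using turn i by auto
  next
    case 3
    then have "h 0 \<noteq> h (Suc (Suc 0))" using h i unfolding reduced_def by auto
    then show ?thesis using 3 eq by (simp add: Suc_diff_le)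
  next
    case 4
    then have "Suc (Suc i) - n = Suc (Suc (i - n))" "Suc (Suc (i - n)) \<le> m" using i by auto
    then show ?thesis using 4 h by (auto simp: reduced_def)
  qed
qed

lemma reduced_rev:
  assumes "reduced f n" shows "reduced (\<lambda>i. f (n - i)) n"
  unfolding reduced_def
proof (intro conjI allI impI)
  show "walk (\<lambda>i. f (n - i)) n" using assms walk_rev by (auto simp: reduced_def)
next
  fix i assume "Suc (Suc i) \<le> n"
  then have "n - i = Suc (Suc (n - Suc (Suc i)))" by auto
  then show "f (n - i) \<noteq> f (n - Suc (Suc i))"
    using assms unfolding reduced_def by (metis diff_le_self)
qed

text \<open>If the last steps differ, going along one walk and back along the other is a closed
  reduced walk, which is impossible; a common last step is removed by induction. It follows that
  every reduced walk is a geodesic (\<open>d_reduced\<close>).\<close>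

lemma reduced_unique_length:
  assumes "reduced f n" "reduced h m" "f 0 = h 0" "f n = h m"
  shows "n = m"
  using assms
proof (induction n arbitrary: m)
  case 0
  then show ?case using no_closed_reduced[of h m] by fastforce
next
  case (Suc n)
  show ?case
  proof (cases m)
    case 0
    then show ?thesis using Suc.prems no_closed_reduced[of f "Suc n"] by auto
  next
    case (Suc m')
    show ?thesis
    proof (cases "f n = h m'")
      case True
      then have "n = m'"
        using Suc.IH[of m'] Suc.prems Suc reduced_less by (metis le_SucI order_refl)
      then show ?thesis using Suc by simp
    next
      case False
      have "reduced (\<lambda>i. if i \<le> Suc n then f i else h (m - (i - Suc n))) (Suc n + m)"
        using reduced_append[OF Suc.prems(1) reduced_rev[OF Suc.prems(2)]] Suc.prems Suc False
        by auto
      from no_closed_reduced[OF this] show ?thesis using Suc.prems Suc by auto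
    qed
  qed
qed

lemma geodesic_reduced:
  assumes "walk f (vdist adj (f 0) (f n))" "n = vdist adj (f 0) (f n)"
  shows "reduced f n"
  unfolding reduced_def
proof (intro conjI allI impI)
  show "walk f n" using assms by simp
next
  fix i assume i: "Suc (Suc i) \<le> n"
  show "f i \<noteq> f (Suc (Suc i))"
  proof
    assume eq: "f i = f (Suc (Suc i))"
    have w: "walk f n" using assms by simp
    have "walk f i" using w i by (auto simp: walk_def)
    moreover have "walk (\<lambda>j. f (j + Suc (Suc i))) (n - Suc (Suc i))" using w
      by (auto simp: walk_def)
    ultimately have "walk (\<lambda>j. if j \<le> i then f j else f (j - i + Suc (Suc i))) (i + (n - Suc (Suc i)))"
      by (rule walk_append) (use eq in simp)
    note * = walk_vdist_le[OF this]
    have "vdist adj (f 0) (f n) \<le> i + (n - Suc (Suc i))"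
    proof -
      have "(if i + (n - Suc (Suc i)) \<le> i then f (i + (n - Suc (Suc i)))
          else f (i + (n - Suc (Suc i)) - i + Suc (Suc i))) = f n"
        using i eq le_add_diff_inverse2[OF i] by (cases "n = Suc (Suc i)") auto
      with * show ?thesis by simp
    qed
    then show False using assms(2) i by linarith
  qed
qed

lemma d_reduced:
  assumes "reduced f n" shows "d (f 0) (f n) = int n"
proof -
  obtain h where h: "h 0 = f 0" "h (vdist adj (f 0) (f n)) = f n" "walk h (vdist adj (f 0) (f n))"
    using ex_walk by blast
  then have "reduced h (vdist adj (f 0) (f n))" using geodesic_reduced[of h] by auto
  from reduced_unique_length[OF assms this] show ?thesis using h by (simp add: d_def)
qed

lemma ex_reduced:
  obtains f n where "reduced f n" "f 0 = u" "f n = v" "int n = d u v"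
proof -
  obtain f where f: "f 0 = u" "f (vdist adj u v) = v" "walk f (vdist adj u v)" using ex_walk
    by blast
  then have "reduced f (vdist adj u v)" using geodesic_reduced[of f] by auto
  then show ?thesis using that f d_def by auto
qed

lemma ex_point_between:
  assumes "0 \<le> k" "k \<le> d u v"
  obtains w where "d u w = k" "d w v = d u v - k"
proof -
  obtain f n where f: "reduced f n" "f 0 = u" "f n = v" "int n = d u v" by (rule ex_reduced)
  have kn: "nat k \<le> n" using assms f by linarith
  have "d u (f (nat k)) = k" using d_reduced[OF reduced_less[OF f(1) kn]] f assms by simp
  moreover have "reduced (\<lambda>i. f (nat k + i)) (n - nat k)" using f(1) kn
    unfolding reduced_def walk_def by auto
  from d_reduced[OF this] have "d (f (nat k)) v = d u v - k" using f kn assms by auto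
  ultimately show ?thesis using that by blast
qed

text \<open>Here \<open>v'\<close> is the vertex before \<open>z\<close> on the geodesic from
  \<open>x\<close>, and \<open>turn\<close> says that the geodesic from \<open>z\<close> to
  \<open>w\<close> does not start by returning to it.\<close>

lemma concat_at:
  assumes v': "d v' z = 1" "d x v' + 1 = d x z"
    and turn: "\<And>v. d z v = 1 \<Longrightarrow> 1 + d v w = d z w \<Longrightarrow> v \<noteq> v'"
  shows "d x w = d x z + d z w"
proof -
  obtain f n where f: "reduced f n" "f 0 = x" "f n = v'" "int n = d x v'" by (rule ex_reduced)
  obtain h m where h: "reduced h m" "h 0 = z" "h m = w" "int m = d z w" by (rule ex_reduced)
  let ?e = "\<lambda>i. if i = (0::nat) then v' else z"
  have e: "reduced ?e 1" using v' d_adj_iff by (auto simp: reduced_def walk_def)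
  have f1: "reduced (\<lambda>i. if i \<le> n then f i else ?e (i - n)) (n + 1)"
  proof (rule reduced_append[OF f(1) e])
    assume n: "0 < n"
    have "reduced f (n - 1)" using reduced_less[OF f(1)] by auto
    from d_reduced[OF this] have "d x (f (n - 1)) = int n - 1" using f n by auto
    then show "f (n - 1) \<noteq> ?e 1" using v' f by auto
  qed (use f in auto)
  have "reduced (\<lambda>i. if i \<le> n + 1 then (\<lambda>i. if i \<le> n then f i else ?e (i - n)) i else h (i - (n + 1))) (n + 1 + m)"
  proof (rule reduced_append[OF f1 h(1)])
    assume m: "0 < m"
    have "reduced (\<lambda>i. h (1 + i)) (m - 1)" using h(1) m unfolding reduced_def walk_def
      by auto
    from d_reduced[OF this] have "1 + d (h 1) w = d z w" using h m by auto
    moreover have "d z (h 1) = 1" using h m d_adj_iff by (auto simp: reduced_def walk_def)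
    ultimately have "h 1 \<noteq> v'" using turn by blast
    then show "(\<lambda>i. if i \<le> n then f i else ?e (i - n)) (n + 1 - 1) \<noteq> h 1" using f
      by auto
  qed (use h in auto)
  from d_reduced[OF this] show ?thesis using f h v' by (auto split: if_splits)
qed

text \<open>The geodesic from \<open>y\<close> to \<open>w\<close> already passes \<open>z\<close>
  without turning back, and the edge before \<open>z\<close> is the same for \<open>x\<close> and
  for \<open>y\<close>. This local-to-global principle, which needs the common part to be
  nondegenerate, is the source of the exact lengths below.\<close>

lemma concat:
  assumes xyz: "d x z = d x y + d y z" and yzw: "d y w = d y z + d z w" and "y \<noteq> z"
  shows "d x w = d x y + d y z + d z w"
proof -
  have pos: "0 < d y z" using \<open>y \<noteq> z\<close> d_nonneg[of y z] d_0_iff[of y z]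
    by linarith
  obtain v' where v': "d y v' = d y z - 1" "d v' z = d y z - (d y z - 1)"
    using ex_point_between[of "d y z - 1" y z] pos by auto
  have "d x v' + 1 = d x z"
    using d_triangle[of x v' y] d_triangle[of x z v'] xyz v' by linarith
  moreover have "v \<noteq> v'" if "d z v = 1" "1 + d v w = d z w" for v
  proof
    assume "v = v'"
    then show False using d_triangle[of y w v'] v' that yzw by simp
  qed
  ultimately have "d x w = d x z + d z w" using concat_at[of v' z x w] v' by auto
  then show ?thesis using xyz by simp
qed

text \<open>The median is the last common vertex of the geodesics from \<open>x\<close> to
  \<open>y\<close> and to \<open>z\<close>; beyond it the two separate, so \<open>concat_at\<close>
  joins them. Medians take the place of explicit geodesics in most later arguments.\<close>

lemma ex_median:
  obtains m where "d x y = d x m + d m y" "d x z = d x m + d m z" "d y z = d y m + d m z"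
proof -
  define Q where "Q k \<longleftrightarrow> (\<exists>m. d x m = int k \<and> d x y = d x m + d m y \<and> d x z = d x m + d m z)" for k
  have Q0: "Q 0" unfolding Q_def by (intro exI[of _ x]) auto
  have bnd: "k \<le> nat (d x y)" if "Q k" for k
  proof -
    obtain m where "d x m = int k" "d x y = d x m + d m y" using \<open>Q k\<close> Q_def by blast
    then show ?thesis using d_nonneg[of m y] by linarith
  qed
  define k where "k = (GREATEST k. Q k)"
  have "Q k" unfolding k_def using GreatestI_nat[of Q 0 "nat (d x y)"] Q0 bnd by blast
  then obtain m where m: "d x m = int k" "d x y = d x m + d m y" "d x z = d x m + d m z"
    unfolding Q_def by blast
  have nQ: "\<not> Q (Suc k)" using Greatest_le_nat[of Q "Suc k" "nat (d x y)"] bnd unfolding k_def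
    by auto
  have no: "\<not> (d m v = 1 \<and> 1 + d v z = d m z \<and> 1 + d v y = d m y)" for v
  proof
    assume v: "d m v = 1 \<and> 1 + d v z = d m z \<and> 1 + d v y = d m y"
    have "d x v = d x m + 1" using v d_triangle[of x v m] d_triangle[of x y v] m by linarith
    then have "Q (Suc k)" unfolding Q_def using v m by (intro exI[of _ v]) auto
    then show False using nQ by blast
  qed
  have "d y z = d y m + d m z"
  proof (cases "y = m")
    case False
    then have "0 < d y m" using d_nonneg[of y m] d_0_iff[of y m] by linarith
    then obtain v' where v': "d y v' = d y m - 1" "d v' m = 1"
      using ex_point_between[of "d y m - 1" y m] by auto
    show ?thesis
    proof (rule concat_at[of v'])
      fix v assume "d m v = 1" "1 + d v z = d m z"
      then show "v \<noteq> v'" using no[of v] v' d_sym by (metis add.commute diff_add_cancel)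
    qed (use v' in auto)
  qed simp
  then show ?thesis using that m by blast
qed

lemma between_unique:
  assumes "d x y = d x z + d z y" "d x y = d x z' + d z' y" "d x z = d x z'"
  shows "z = z'"
proof (rule ccontr)
  assume "z \<noteq> z'"
  obtain n where n: "d x z = d x n + d n z" "d x z' = d x n + d n z'" "d z z' = d z n + d n z'"
    by (rule ex_median[of x z z'])
  have "n \<noteq> z" using n assms(3) \<open>z \<noteq> z'\<close> by auto
  have "d n y = d n z + d z y"
    using d_triangle[of n y z] d_triangle[of x y n] assms n by linarith
  moreover have "d z' z = d z' n + d n z" using n d_sym by smt
  ultimately have "d z' y = d z' n + d n z + d z y"
    using concat[of z' z n y] \<open>n \<noteq> z\<close> by simp
  then show False using n assms \<open>n \<noteq> z\<close> d_sym d_nonneg[of n z] d_0_iff[of n z]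
    by smt
qed

end

section \<open>Isometries and translation lengths\<close>

text \<open>Composition is written additively, since \<^class>\<open>group_add\<close> is the class of noncommutative groups.\<close>

typedef 'a bijection = "{f :: 'a \<Rightarrow> 'a. bij f}"
  morphisms act Bijection
  by (rule exI[of _ id]) auto

setup_lifting type_definition_bijection

instantiation bijection :: (type) group_add
begin
lift_definition zero_bijection :: "'a bijection" is id by simp
lift_definition plus_bijection :: "'a bijection \<Rightarrow> 'a bijection \<Rightarrow> 'a bijection" is "(\<circ>)"
  by (rule bij_comp)
lift_definition uminus_bijection :: "'a bijection \<Rightarrow> 'a bijection" is inv
  by (rule bij_imp_bij_inv)
definition minus_bijection :: "'a bijection \<Rightarrow> 'a bijection \<Rightarrow> 'a bijection" where
  "minus_bijection g h = g + - h"
instance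
  by standard (transfer; auto simp: fun_eq_iff bij_is_inj minus_bijection_def)+
end

notation act (infixr "$" 80)

lemma bij_act: "bij (act g)"
  using act by auto

lemma act_plus [simp]: "(g + h) $ x = g $ h $ x"
  by transfer simp

lemma act_zero [simp]: "0 $ x = x"
  by transfer simp

lemma act_minus [simp]: "(g - h) $ x = g $ (- h) $ x"
  by (simp only: minus_bijection_def act_plus)

lemma act_uminus_cancel [simp]: "(- g) $ g $ x = x" "g $ (- g) $ x = x"
  by (simp_all only: act_plus[symmetric] left_minus right_minus act_zero)

lemma act_inject [simp]: "g $ x = g $ y \<longleftrightarrow> x = y"
  using bij_act[of g] by (auto dest: bij_is_inj injD)

context stree
begin

section \<open>Displacement of vertices\<close>

definition iso :: "'v bijection \<Rightarrow> bool" where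
  "iso g \<longleftrightarrow> (\<forall>x y. d (g $ x) (g $ y) = d x y)"

definition l :: "'v bijection \<Rightarrow> int" where
  "l g = int (transl_len adj (act g))"

text \<open>The set of minimal displacement: the fixed vertices if \<open>l g = 0\<close>, the
  vertices of the axis if there is one (\<open>axis_range\<close>).\<close>

definition C :: "'v bijection \<Rightarrow> 'v set" where
  "C g = {x. d x (g $ x) = l g}"

lemma iso_d [simp]: "iso g \<Longrightarrow> d (g $ x) (g $ y) = d x y"
  by (simp add: iso_def)

lemma iso_plus [simp]: "iso g \<Longrightarrow> iso h \<Longrightarrow> iso (g + h)"
  by (simp add: iso_def)

lemma iso_uminus [simp]: "iso g \<Longrightarrow> iso (- g)"
  unfolding iso_def by (metis act_uminus_cancel(2))

lemma iso_minus [simp]: "iso g \<Longrightarrow> iso h \<Longrightarrow> iso (g - h)"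
  by (simp only: minus_bijection_def iso_plus iso_uminus)

lemma d_uminus: "iso g \<Longrightarrow> d x ((- g) $ y) = d (g $ x) y"
  by (metis act_uminus_cancel(2) iso_d)

lemma d_uminus': "iso g \<Longrightarrow> d ((- g) $ x) y = d x (g $ y)"
  by (metis act_uminus_cancel(2) iso_d)

lemma l_le: "l g \<le> d x (g $ x)"
  unfolding l_def transl_len_def d_def by (auto intro: Least_le)

lemma C_nonempty: "\<exists>x. x \<in> C g"
proof -
  have "\<exists>x. vdist adj x (g $ x) = transl_len adj (act g)"
    unfolding transl_len_def by (rule LeastI_ex) blast
  then show ?thesis unfolding C_def l_def d_def by auto
qed

lemma C_iff: "x \<in> C g \<longleftrightarrow> d x (g $ x) \<le> l g"
  using l_le[of g x] by (auto simp: C_def)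

lemma C_D: "x \<in> C g \<Longrightarrow> d x (g $ x) = l g"
  by (simp add: C_def)

lemma l_nonneg [simp]: "0 \<le> l g"
  by (simp add: l_def)

lemma l_uminus [simp]:
  assumes "iso g" shows "l (- g) = l g"
proof -
  have "l (- g) \<le> l g" if "iso g" for g
    using C_nonempty[of g] l_le[of "- g"] that by (metis C_D d_sym d_uminus)
  from this[of g] this[of "- g"] assms show ?thesis by auto
qed

lemma C_uminus [simp]: "iso g \<Longrightarrow> C (- g) = C g"
  by (auto simp: C_def d_uminus d_sym)

lemma l_commute:
  assumes "iso g" "iso h" shows "l (g + h) = l (h + g)"
proof -
  have "l (h + g) \<le> l (g + h)" if "iso g" "iso h" for g h
  proof -
    obtain x where "d x ((g + h) $ x) = l (g + h)" using C_nonempty[of "g + h"] C_D by blast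
    moreover have "d (h $ x) ((h + g) $ h $ x) = d x ((g + h) $ x)" using that by simp
    ultimately show ?thesis using l_le[of "h + g" "h $ x"] by simp
  qed
  from this[of g h] this[of h g] assms show ?thesis by auto
qed

lemma l_minus_commute: "iso g \<Longrightarrow> iso h \<Longrightarrow> l (g - h) = l (h - g)"
  by (metis iso_minus l_uminus minus_diff_eq)

lemma l_conj: "iso g \<Longrightarrow> iso h \<Longrightarrow> l (g + h - g) = l h"
  using l_commute[of "g + h" "- g"] by (simp add: add.assoc[symmetric])

lemma ex_nearest:
  assumes "A \<noteq> {}" shows "\<exists>y\<in>A. \<forall>z\<in>A. d x y \<le> d x z"
proof -
  obtain a where a: "a \<in> A" using assms by blast
  obtain y where "y \<in> A" "\<forall>z. z \<in> A \<longrightarrow> nat (d x y) \<le> nat (d x z)"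
    using ex_has_least_nat[of "\<lambda>y. y \<in> A" a "\<lambda>y. nat (d x y)"] a by auto
  then show ?thesis by (auto simp: nat_le_eq_zle)
qed

lemma C_between:
  assumes "iso u" "y \<in> C u" "d y (u $ y) = d y z + d z (u $ y)"
  shows "z \<in> C u"
  using d_triangle[of z "u $ z" "u $ y"] assms by (simp add: C_iff)

text \<open>The path from \<open>x\<close> to \<open>y\<close>, on to \<open>u $ y\<close> and from
  there to \<open>u $ x\<close> has no backtracking: a branch point on the middle part would give a
  vertex of \<open>C u\<close> closer to \<open>x\<close> than \<open>y\<close>.\<close>

lemma displacement:
  assumes u: "iso u" and y: "y \<in> C u" and near: "\<And>z. z \<in> C u \<Longrightarrow> d x y \<le> d x z"
  shows "d x (u $ x) = l u + 2 * d x y"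
proof (cases "u $ y = y")
  \<comment> \<open>The middle part is degenerate here and \<open>concat\<close> does not apply;
    instead the median of \<open>y\<close>, \<open>x\<close> and \<open>u $ x\<close> turns out to
    be fixed by \<open>u\<close>.\<close>
  case True
  then have lu: "l u = 0" using y by (simp add: C_def)
  obtain m where m: "d y x = d y m + d m x" "d y (u $ x) = d y m + d m (u $ x)"
    "d x (u $ x) = d x m + d m (u $ x)" by (rule ex_median[of y x "u $ x"])
  have yx: "d y (u $ x) = d y x" "d y (u $ m) = d y m" using u True by (metis iso_d)+
  have "d y (u $ x) = d y (u $ m) + d (u $ m) (u $ x)" using m yx u by simp
  moreover have "d y (u $ x) = d y m + d m (u $ x)" by fact
  ultimately have "u $ m = m" using yx(2) by (rule between_unique)
  then have "m \<in> C u" using lu by (simp add: C_def)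
  then have "m = y" using near[of m] m d_sym d_0_iff d_nonneg by (smt (verit))
  then show ?thesis using m yx lu d_sym by smt
next
  case False
  have C: "d y (u $ y) = l u" using y by (rule C_D)
  obtain m where m: "d x y = d x m + d m y" "d x (u $ y) = d x m + d m (u $ y)"
    "d y (u $ y) = d y m + d m (u $ y)" by (rule ex_median[of x y "u $ y"])
  have "m \<in> C u" using C_between u y m by blast
  then have "m = y" using near[of m] m d_0_iff[of m y] d_nonneg[of m y] by linarith
  have 1: "d x (u $ y) = d x y + d y (u $ y)" using m(2) unfolding \<open>m = y\<close> .
  obtain k where k: "d (u $ x) y = d (u $ x) k + d k y" "d (u $ x) (u $ y) = d (u $ x) k + d k (u $ y)"
    "d y (u $ y) = d y k + d k (u $ y)" by (rule ex_median[of "u $ x" y "u $ y"])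
  \<comment> \<open>Pulling the branch point near \<open>u $ y\<close> back by \<open>u\<close>
    gives a vertex of \<open>C u\<close> that competes with \<open>y\<close>.\<close>
  let ?k = "(- u) $ k"
  have ku: "d a ?k = d (u $ a) k" for a using u by (simp add: d_uminus)
  have "d ?k (u $ ?k) \<le> l u"
  proof -
    have "d ?k k \<le> d y ?k + d y k" using d_triangle[of "?k" k y] d_sym[of ?k y] by linarith
    also have "\<dots> = d (u $ y) k + d y k" by (simp only: ku)
    also have "\<dots> = l u" using k(3) C d_sym[of k "u $ y"] by linarith
    finally show ?thesis by simp
  qed
  then have "?k \<in> C u" by (simp add: C_iff)
  then have "d x y \<le> d (u $ x) k" using near[of ?k] by (simp only: ku)
  moreover have "d (u $ x) (u $ y) = d x y" using u by simp
  ultimately have "k = u $ y" using k(2) d_0_iff[of k "u $ y"] d_nonneg[of k "u $ y"] by linarith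
  have 2: "d y (u $ x) = d y (u $ y) + d (u $ y) (u $ x)"
    using k(1) d_sym[of y "u $ x"] d_sym[of y "u $ y"] d_sym[of "u $ y" "u $ x"]
    unfolding \<open>k = u $ y\<close> by linarith
  have "d x (u $ x) = d x y + d y (u $ y) + d (u $ y) (u $ x)"
    using concat[OF 1 2] False by auto
  then show ?thesis using C d_sym[of x y] iso_d[OF u, of y x] by linarith
qed

lemma ex_displacement:
  assumes "iso u"
  obtains y where "y \<in> C u" "\<And>z. z \<in> C u \<Longrightarrow> d x y \<le> d x z" "d x (u $ x) = l u + 2 * d x y"
proof -
  obtain y where y: "y \<in> C u" "\<forall>z\<in>C u. d x y \<le> d x z"
    using ex_nearest[of "C u" x] C_nonempty by blast
  then show ?thesis using displacement[OF assms] that by blast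
qed

text \<open>If \<open>x\<close> has distance \<open>r\<close> from \<open>C u\<close>, then
  \<open>u\<close> moves it by \<open>l u + 2 * r\<close>, but \<open>u + u\<close> by at most
  \<open>2 * l u + 2 * r\<close>. The assumption therefore forces \<open>r = 0\<close>.\<close>

lemma l_eq_displacement:
  assumes u: "iso u" and ge: "2 * d x (u $ x) \<le> d x (u $ u $ x)"
  shows "l u = d x (u $ x)"
proof -
  obtain y where y: "y \<in> C u" "d x (u $ x) = l u + 2 * d x y" by (rule ex_displacement[OF u])
  have "d x (u $ u $ x) \<le> d x y + d y (u $ y) + d (u $ y) (u $ u $ y) + d (u $ u $ y) (u $ u $ x)"
    using d_triangle[of x "u $ u $ x" y] d_triangle[of y "u $ u $ x" "u $ y"]
      d_triangle[of "u $ y" "u $ u $ x" "u $ u $ y"] by linarith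
  then have "d x (u $ u $ x) \<le> 2 * d x y + 2 * l u"
    using C_D[OF y(1)] d_sym[of x y] iso_d[OF u, of y "u $ y"] iso_d[OF u, of "u $ y" "u $ x"]
      iso_d[OF u, of y x] by linarith
  then show ?thesis using y ge d_nonneg[of x y] by linarith
qed

text \<open>The path \<open>x\<close>, \<open>y\<close>, \<open>u $ x\<close>, \<open>u $ y\<close>
  turns back neither at \<open>y\<close> nor at \<open>u $ x\<close>, and every turn in its
  translates by \<open>u\<close> is an image of one of these two.\<close>

lemma l_eq_two_step:
  assumes u: "iso u" and 1: "d x (u $ x) = d x y + d y (u $ x)"
    and 2: "d y (u $ y) = d y (u $ x) + d (u $ x) (u $ y)" and "x \<noteq> y" "y \<noteq> u $ x"
  shows "l u = d x y + d y (u $ x)"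
proof -
  have 3: "d x (u $ y) = d x y + d y (u $ x) + d (u $ x) (u $ y)"
    by (rule concat[OF 1 2 \<open>y \<noteq> u $ x\<close>])
  have "d x (u $ u $ x) = d x (u $ x) + d (u $ x) (u $ y) + d (u $ y) (u $ u $ x)"
  proof (rule concat)
    show "d x (u $ y) = d x (u $ x) + d (u $ x) (u $ y)" using 1 3 by linarith
    show "d (u $ x) (u $ u $ x) = d (u $ x) (u $ y) + d (u $ y) (u $ u $ x)"
      using 1 iso_d[OF u] by metis
    show "u $ x \<noteq> u $ y" using \<open>x \<noteq> y\<close> by simp
  qed
  then have "d x (u $ u $ x) = 2 * d x (u $ x)"
    using 1 iso_d[OF u, of x y] iso_d[OF u, of y "u $ x"] by linarith
  then show ?thesis using l_eq_displacement[OF u, of x] 1 by linarith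
qed

section \<open>Translation lengths of products\<close>

lemma l_plus_apart:
  assumes u: "iso u" and v: "iso v" and y: "y \<in> C u" and z: "z \<in> C v" and "y \<noteq> z"
    and min: "\<And>y' z'. y' \<in> C u \<Longrightarrow> z' \<in> C v \<Longrightarrow> d y z \<le> d y' z'"
  shows "l (u + v) = l u + l v + 2 * d y z"
proof -
  have du: "d z (u $ z) = l u + 2 * d z y"
    by (rule displacement[OF u y]) (use min[OF _ z] d_sym in simp)
  have dv: "d y (v $ y) = l v + 2 * d y z"
    by (rule displacement[OF v z]) (use min[OF y] in simp)
  note lu = C_D[OF y] and lv = C_D[OF z]
  have s: "d z y = d y z" by (rule d_sym)
  have a1: "d z (u $ z) = d z y + d y (u $ z)" "d y (u $ z) = l u + d y z"
    using d_triangle[of z "u $ z" y] d_triangle[of y "u $ z" "u $ y"] du lu s iso_d[OF u, of y z]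
    by linarith+
  have a2: "d y (v $ y) = d y z + d z (v $ y)" "d z (v $ y) = l v + d y z"
    using d_triangle[of y "v $ y" z] d_triangle[of z "v $ y" "v $ z"] dv lv s iso_d[OF v, of z y]
    by linarith+
  let ?u = "(- u) $ y" and ?v = "(- v) $ z"
  have b1: "d ?v y = d ?v z + d z y" "d ?v y = l v + d y z"
    using a2 lv s d_uminus'[OF v, of z z] d_uminus'[OF v, of z y] by linarith+
  have b2: "d ?u z = d ?u y + d y z" "d ?u z = l u + d y z"
    using a1 lu s d_uminus'[OF u, of y y] d_uminus'[OF u, of y z] by linarith+
  have c1: "d ?v (u $ z) = d ?v z + d z y + d y (u $ z)"
    using concat[OF b1(1) a1(1)] \<open>y \<noteq> z\<close> by blast
  have c2: "d ?u (v $ y) = d ?u y + d y z + d z (v $ y)"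
    using concat[OF b2(1) a2(1)] \<open>y \<noteq> z\<close> by blast
  \<comment> \<open>\<open>?v\<close>, \<open>y\<close> and \<open>u $ z\<close> lie on the axis of
    \<open>u + v\<close>, with \<open>u $ z\<close> the image of \<open>?v\<close>. This period
    crosses a translate of the bridge between \<open>y\<close> and \<open>z\<close> twice, which
    explains the term \<open>2 * d y z\<close>.\<close>
  have uv: "(u + v) $ ?v = u $ z" by simp
  have pos: "0 < d y z" using \<open>y \<noteq> z\<close> d_0_iff[of y z] d_nonneg[of y z]
    by linarith
  have "l (u + v) = d ?v y + d y (u $ z)"
    unfolding uv[symmetric]
  proof (rule l_eq_two_step)
    show "d ?v ((u + v) $ ?v) = d ?v y + d y ((u + v) $ ?v)" using c1 b1 unfolding uv by linarith
    have "d y ((u + v) $ y) = d ?u (v $ y)" using u by (simp add: d_uminus')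
    also have "\<dots> = d ?u z + d z (v $ y)" using c2 b2 by linarith
    also have "\<dots> = d y ((u + v) $ ?v) + d ((u + v) $ ?v) ((u + v) $ y)"
      using u by (simp add: d_uminus')
    finally show "d y ((u + v) $ y) = d y ((u + v) $ ?v) + d ((u + v) $ ?v) ((u + v) $ y)" .
    have "0 < d ?v y" using b1 pos l_nonneg[of v] by linarith
    then show "?v \<noteq> y" by auto
    have "0 < d y (u $ z)" using a1 pos l_nonneg[of u] by linarith
    then show "y \<noteq> (u + v) $ ?v" by auto
  qed (use u v in simp)
  then show ?thesis using a1 b1 by linarith
qed

lemma ex_nearest_pair:
  assumes "A \<noteq> {}" "B \<noteq> {}"
  obtains y z where "y \<in> A" "z \<in> B" "\<And>y' z'. y' \<in> A \<Longrightarrow> z' \<in> B \<Longrightarrow> d y z \<le> d y' z'"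
proof -
  obtain a b where "a \<in> A" "b \<in> B" using assms by blast
  then obtain p where "fst p \<in> A \<and> snd p \<in> B"
    "\<forall>q. fst q \<in> A \<and> snd q \<in> B \<longrightarrow> nat (d (fst p) (snd p)) \<le> nat (d (fst q) (snd q))"
    using ex_has_least_nat[of "\<lambda>p. fst p \<in> A \<and> snd p \<in> B" "(a, b)" "\<lambda>p. nat (d (fst p) (snd p))"]
    by auto
  then show ?thesis using that[of "fst p" "snd p"] by (auto simp: nat_le_eq_zle)
qed

lemma l_plus_le_meet:
  assumes "iso u" "iso v" "x \<in> C u" "x \<in> C v"
  shows "l (u + v) \<le> l u + l v"
proof -
  have "l (v + u) \<le> d x (v $ u $ x)" using l_le[of "v + u" x] by simp
  also have "\<dots> \<le> d x (v $ x) + d (v $ x) (v $ u $ x)" by (rule d_triangle)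
  finally show ?thesis using assms l_commute[of u v] by (simp add: C_def)
qed

text \<open>A length above \<open>l u + l v\<close> can come only from a bridge between disjoint
  sets, and the formula with the bridge does not see the sign of \<open>v\<close>.\<close>

lemma apart_if_l_plus_large:
  assumes "iso u" "iso v" "l u + l v < l (u + v)"
  shows "C u \<inter> C v = {}" "l (u - v) = l (u + v)"
proof -
  show disj: "C u \<inter> C v = {}" using assms l_plus_le_meet by fastforce
  obtain y z where yz: "y \<in> C u" "z \<in> C v" "\<And>y' z'. y' \<in> C u \<Longrightarrow> z' \<in> C v \<Longrightarrow> d y z \<le> d y' z'"
    using ex_nearest_pair[of "C u" "C v"] C_nonempty by blast
  have ne: "y \<noteq> z" using disj yz by auto
  have "l (u + v) = l u + l v + 2 * d y z" using l_plus_apart[OF assms(1,2) yz(1,2) ne yz(3)] .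
  moreover have "l (u + - v) = l u + l (- v) + 2 * d y z"
    using l_plus_apart[of u "- v" y z] assms yz ne by simp
  ultimately show "l (u - v) = l (u + v)" using assms by simp
qed

lemma l_plus_le_max:
  assumes "iso u" "iso v" shows "l (u + v) \<le> max (l u + l v) (l (u - v))"
  using apart_if_l_plus_large[OF assms] by (cases "l u + l v < l (u + v)") auto

end

section \<open>Lines and axes\<close>

context stree
begin

lemma d_pos: "x \<noteq> y \<Longrightarrow> 0 < d x y"
  using d_nonneg[of x y] d_0_iff[of x y] by linarith

definition line :: "(int \<Rightarrow> 'v) \<Rightarrow> bool" where
  "line P \<longleftrightarrow> (\<forall>m n. d (P m) (P n) = \<bar>m - n\<bar>)"

definition axis :: "'v bijection \<Rightarrow> (int \<Rightarrow> 'v) \<Rightarrow> bool" where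
  "axis g P \<longleftrightarrow> iso g \<and> 0 < l g \<and> line P \<and> (\<forall>m. g $ P m = P (m + l g))"

text \<open>Common points have equal parameters on both lines, so an overlap is traversed in the
  same direction. Disjoint lines are aligned vacuously, hence a common point is always given
  separately.\<close>

definition aligned :: "(int \<Rightarrow> 'v) \<Rightarrow> (int \<Rightarrow> 'v) \<Rightarrow> bool" where
  "aligned P Q \<longleftrightarrow> (\<forall>m n. P m = Q n \<longrightarrow> m = n)"

definition proj :: "(int \<Rightarrow> 'v) \<Rightarrow> 'v \<Rightarrow> int \<Rightarrow> bool" where
  "proj P x m \<longleftrightarrow> (\<forall>n. d x (P n) = d x (P m) + \<bar>n - m\<bar>)"

lemma line_d: "line P \<Longrightarrow> d (P m) (P n) = \<bar>m - n\<bar>"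
  by (simp add: line_def)

lemma line_eq_iff: "line P \<Longrightarrow> P m = P n \<longleftrightarrow> m = n"
  using line_d[of P m n] d_0_iff[of "P m" "P n"] by auto

lemma lineI:
  assumes 1: "\<And>m. d (P m) (P (m + 1)) = 1" and 2: "\<And>m. d (P m) (P (m + 2)) = 2"
  shows "line P"
proof -
  have *: "d (P m) (P (m + int n)) = int n" for m n
  proof (induction n rule: less_induct)
    case (less n)
    consider "n = 0" | "n = 1" | k where "n = Suc (Suc k)" by (metis One_nat_def not0_implies_Suc)
    then show ?case
    proof cases
      case 1
      then show ?thesis by simp
    next
      case 2
      then show ?thesis using assms(1)[of m] by simp
    next
      case 3
      let ?x = "P m" and ?y = "P (m + int k)" and ?z = "P (m + int k + 1)" and ?w = "P (m + int k + 2)"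
      have "m + int (Suc k) = m + int k + 1" "m + int n = m + int k + 2" using 3 by auto
      note e = this
      note 1 = assms(1) and 2 = assms(2)
      have xy: "d ?x ?y = int k" using less[of k] 3 by simp
      have xz: "d ?x ?z = int k + 1" using less[of "Suc k"] 3 unfolding e by simp
      have yz: "d ?y ?z = 1" "d ?y ?w = 2" "d ?z ?w = 1"
        using 1[of "m + int k"] 2[of "m + int k"] 1[of "m + int k + 1"]
        by (simp_all add: algebra_simps)
      have "d ?x ?w = d ?x ?y + d ?y ?z + d ?z ?w"
      proof (rule concat)
        show "d ?x ?z = d ?x ?y + d ?y ?z" unfolding xy xz yz ..
        show "d ?y ?w = d ?y ?z + d ?z ?w" unfolding yz by simp
        show "?y \<noteq> ?z" using yz by auto
      qed
      then show ?thesis unfolding e xy yz using 3 by simp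
    qed
  qed
  show ?thesis unfolding line_def
  proof (intro allI)
    fix m n
    show "d (P m) (P n) = \<bar>m - n\<bar>"
      using *[of m "nat (n - m)"] *[of n "nat (m - n)"] d_sym[of "P m" "P n"]
      by (cases "m \<le> n") auto
  qed
qed

lemma line_reflect: "line P \<Longrightarrow> line (\<lambda>m. P (c - m))"
  by (auto simp: line_def)

lemma line_shift: "line P \<Longrightarrow> line (\<lambda>m. P (m + c))"
  by (auto simp: line_def)

lemma axis_iso: "axis g P \<Longrightarrow> iso g"
  and axis_pos: "axis g P \<Longrightarrow> 0 < l g"
  and axis_line: "axis g P \<Longrightarrow> line P"
  and axis_act: "axis g P \<Longrightarrow> g $ P m = P (m + l g)"
  by (auto simp: axis_def)

lemma axis_act_uminus: "axis g P \<Longrightarrow> (- g) $ P m = P (m - l g)"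
  using axis_act[of g P "m - l g"] act_uminus_cancel(1)[of g "P (m - l g)"] by simp

lemma axis_reflect: "axis g P \<Longrightarrow> axis (- g) (\<lambda>m. P (c - m))"
  using axis_act_uminus[of g P] line_reflect[of P c] by (simp add: axis_def diff_diff_eq)

lemma axis_shift: "axis g P \<Longrightarrow> axis g (\<lambda>m. P (m + c))"
  using line_shift[of P c] by (simp add: axis_def add.assoc add.commute[of c])

lemma line_between:
  assumes P: "line P" and "m \<le> n" and z: "d (P m) (P n) = d (P m) z + d z (P n)"
  shows "z = P (m + d (P m) z)"
proof (rule between_unique)
  show "d (P m) (P n) = d (P m) z + d z (P n)" by fact
  have "d (P m) z \<le> n - m"
    using z line_d[OF P, of m n] \<open>m \<le> n\<close> d_nonneg[of z "P n"] by linarith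
  then show "d (P m) (P n) = d (P m) (P (m + d (P m) z)) + d (P (m + d (P m) z)) (P n)"
    using \<open>m \<le> n\<close> by (simp add: line_d[OF P])
  show "d (P m) z = d (P m) (P (m + d (P m) z))" by (simp add: line_d[OF P])
qed

lemma line_between_ex:
  assumes P: "line P" and z: "d (P m) (P n) = d (P m) z + d z (P n)"
  obtains j where "z = P j" "min m n \<le> j" "j \<le> max m n"
proof (cases "m \<le> n")
  case True
  then have "d (P m) z \<le> n - m" using z line_d[OF P, of m n] d_nonneg[of z "P n"] by linarith
  then show ?thesis using that[of "m + d (P m) z"] line_between[OF P True z] True by auto
next
  case False
  have z': "d (P n) (P m) = d (P n) z + d z (P m)" using z d_sym by smt
  then have "d (P n) z \<le> m - n" using line_d[OF P, of n m] d_nonneg[of z "P m"] False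
    by linarith
  then show ?thesis using that[of "n + d (P n) z"] line_between[OF P _ z'] False by auto
qed

lemma ex_proj:
  assumes P: "line P" obtains m where "proj P x m"
proof -
  obtain y where y: "y \<in> range P" "\<forall>z\<in>range P. d x y \<le> d x z"
    using ex_nearest[of "range P" x] by auto
  then obtain m where m: "y = P m" by auto
  have "d x (P n) = d x (P m) + \<bar>n - m\<bar>" for n
  proof -
    obtain c where c: "d x (P m) = d x c + d c (P m)" "d x (P n) = d x c + d c (P n)"
      "d (P m) (P n) = d (P m) c + d c (P n)" by (rule ex_median[of x "P m" "P n"])
    obtain j where "c = P j" using line_between_ex[OF P c(3)] by blast
    then have "c = P m" using y m c d_nonneg[of c "P m"] d_0_iff[of c "P m"] by (smt (verit) rangeI)
    from c(2) show ?thesis unfolding \<open>c = P m\<close> line_d[OF P, of m n] by linarith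
  qed
  then show ?thesis using that proj_def by blast
qed

lemma projD: "proj P x m \<Longrightarrow> d x (P n) = d x (P m) + \<bar>n - m\<bar>"
  unfolding proj_def by blast

lemma proj_apart:
  assumes P: "line P" and x: "proj P x m" and y: "proj P y n" and "m \<noteq> n"
  shows "d x y = d x (P m) + \<bar>m - n\<bar> + d (P n) y"
proof -
  have 1: "d x (P n) = d x (P m) + d (P m) (P n)" using projD[OF x, of n] line_d[OF P, of m n]
    by linarith
  have 2: "d (P m) y = d (P m) (P n) + d (P n) y"
    using projD[OF y, of m] line_d[OF P, of m n] d_sym[of y "P m"] d_sym[of y "P n"] by linarith
  have "P m \<noteq> P n" using \<open>m \<noteq> n\<close> line_eq_iff[OF P] by simp
  from concat[OF 1 2 this] show ?thesis using line_d[OF P, of m n] by linarith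
qed

text \<open>\<open>g\<close> shifts the projection of \<open>x\<close> to the axis by
  \<open>l g\<close>, so it moves \<open>x\<close> by \<open>l g\<close> plus twice the distance
  from the axis.\<close>

lemma axis_range: 
  assumes g: "axis g P" shows "C g = range P"
proof (intro equalityI subsetI)
  note P = axis_line[OF g] and i = axis_iso[OF g]
  fix x assume x: "x \<in> C g"
  obtain m where m: "proj P x m" by (rule ex_proj[OF P])
  have gm: "proj P (g $ x) (m + l g)"
    unfolding proj_def
  proof
    fix n
    have "d (g $ x) (P n) = d x (P (n - l g))"
      using d_uminus[OF i, of x "P n"] axis_act_uminus[OF g] by simp
    also have "\<dots> = d x (P m) + \<bar>n - (m + l g)\<bar>" using projD[OF m, of "n - l g"]
      by (simp add: algebra_simps)
    also have "d x (P m) = d (g $ x) (P (m + l g))" using i by (simp flip: axis_act[OF g])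
    finally show "d (g $ x) (P n) = d (g $ x) (P (m + l g)) + \<bar>n - (m + l g)\<bar>" .
  qed
  have "d (P (m + l g)) (g $ x) = d (P m) x" using i by (simp flip: axis_act[OF g])
  then have "d x (g $ x) = 2 * d x (P m) + l g"
    using proj_apart[OF P m gm] axis_pos[OF g] d_sym[of x] by simp
  then have "x = P m" using C_D[OF x] d_0_iff[of x "P m"] by simp
  then show "x \<in> range P" by simp
next
  fix x assume "x \<in> range P"
  then show "x \<in> C g" using line_d[OF axis_line[OF g]] axis_pos[OF g]
    by (auto simp: C_def axis_act[OF g])
qed

section \<open>Existence of axes\<close>

definition zpow :: "('v \<Rightarrow> 'v) \<Rightarrow> int \<Rightarrow> 'v \<Rightarrow> 'v" where
  "zpow f k = (if 0 \<le> k then f ^^ nat k else inv f ^^ nat (- k))"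

lemma zpow_Suc:
  assumes "bij f" shows "zpow f (k + 1) x = f (zpow f k x)"
proof (cases "0 \<le> k")
  case True
  then have "nat (k + 1) = Suc (nat k)" by simp
  then show ?thesis using True by (simp add: zpow_def)
next
  case False
  then have "nat (- k) = Suc (nat (- (k + 1)))" by simp
  then have "f (zpow f k x) = (inv f ^^ nat (- (k + 1))) x"
    using False surj_f_inv_f[OF bij_is_surj[OF assms]] by (simp add: zpow_def)
  then show ?thesis using False by (cases "k = -1") (auto simp: zpow_def)
qed

text \<open>Suppose the geodesics from \<open>g $ y\<close> to \<open>y\<close> and to
  \<open>g $ g $ y\<close> share a first edge, with far end \<open>z\<close>. Then \<open>z\<close>
  and its preimage are the vertices next to the two ends of the geodesic from \<open>y\<close> to
  \<open>g $ y\<close>, so the preimage is moved by only \<open>l g - 2\<close>; for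
  \<open>l g = 1\<close> the edge is inverted.\<close>

lemma two_step_hyperbolic:
  assumes g: "iso g" and pos: "0 < l g" and inv: "\<And>u. d u (g $ u) = 1 \<Longrightarrow> g $ g $ u \<noteq> u"
    and y: "y \<in> C g"
  shows "d y (g $ g $ y) = 2 * l g"
proof -
  let ?a = "g $ y" let ?b = "g $ g $ y"
  have ya: "d y ?a = l g" "d ?a ?b = l g" using C_D[OF y] g by auto
  obtain m where m: "d ?a y = d ?a m + d m y" "d ?a ?b = d ?a m + d m ?b" "d y ?b = d y m + d m ?b"
    by (rule ex_median[of ?a y ?b])
  have "m = ?a"
  proof (rule ccontr)
    assume "m \<noteq> ?a"
    then have "1 \<le> d ?a m" using d_pos[of ?a m] by fastforce
    then obtain z where z: "d ?a z = 1" "d z m = d ?a m - 1" using ex_point_between[of 1 ?a m]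
      by auto
    have az: "d z y = l g - 1" "d z ?b = l g - 1"
      using z m ya d_triangle[of z y m] d_triangle[of ?a y z] d_triangle[of z ?b m] d_triangle[of ?a ?b z]
        d_sym[of y ?a] by linarith+
    let ?z = "(- g) $ z"
    have zz: "d y ?z = 1" "d ?z ?a = l g - 1" "d ?z (g $ ?z) = d ?z z"
      using g z az by (simp_all add: d_uminus d_uminus')
    show False
    proof (cases "l g = 1")
      case True
      then have "z = y" "?z = ?a" using az zz by auto
      then have "y = g $ ?a" by (metis act_uminus_cancel(2))
      then show False using inv[of y] ya True by simp
    next
      case False
      then have "2 \<le> l g" using pos by linarith
      moreover obtain w where w: "d y w = 1" "d w z = l g - 2"
        using ex_point_between[of 1 y z] az d_sym[of y z] calculation by auto
      have "w = ?z"
      proof (rule between_unique[of y ?a w ?z])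
        show "d y ?a = d y w + d w ?a"
          using w z d_sym[of z ?a] d_triangle[of w ?a z] d_triangle[of y ?a w] ya by linarith
        show "d y ?a = d y ?z + d ?z ?a" using zz ya by simp
        show "d y w = d y ?z" using w zz by simp
      qed
      then have "d ?z (g $ ?z) = l g - 2" using w zz by simp
      then show False using l_le[of g ?z] by linarith
    qed
  qed
  from m(3) show ?thesis using ya d_sym[of y ?a] unfolding \<open>m = ?a\<close> by linarith
qed

lemma ex_axis:
  assumes g: "iso g" and pos: "0 < l g" and inv: "\<And>u. d u (g $ u) = 1 \<Longrightarrow> g $ g $ u \<noteq> u"
  obtains P where "axis g P"
proof -
  obtain y where y: "y \<in> C g" using C_nonempty by blast
  note C = C_D[OF y]
  have "\<exists>f n. reduced f n \<and> f 0 = y \<and> f n = g $ y \<and> int n = d y (g $ y)"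
    by (metis ex_reduced)
  then obtain f n where f: "reduced f n" "f 0 = y" "f n = g $ y" "int n = l g" using C by auto
  have fd: "d (f i) (f j) = int j - int i" if "i \<le> j" "j \<le> n" for i j
  proof -
    have "reduced (\<lambda>k. f (i + k)) (j - i)" using f(1) that unfolding reduced_def walk_def
      by auto
    from d_reduced[OF this] show ?thesis using that by simp
  qed
  \<comment> \<open>A geodesic from \<open>y\<close> to \<open>g $ y\<close> serves as fundamental
    segment: the quotient selects the translate and the remainder the position in it.\<close>
  define P where "P m = zpow (act g) (m div l g) (f (nat (m mod l g)))" for m
  have shift: "P (m + l g) = g $ P m" for m
    using zpow_Suc[OF bij_act, of g] pos by (simp add: P_def)
  have Pf: "P m = f (nat m)" if "0 \<le> m" "m \<le> l g" for m
  proof (cases "m = l g")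
    case True
    have "nat (l g) = n" using f(4) by linarith
    moreover have "P 0 = y" using f(2) by (simp add: P_def zpow_def)
    ultimately show ?thesis using shift[of 0] f(3) True by simp
  next
    case False
    then show ?thesis using that by (simp add: P_def zpow_def)
  qed
  have red: "\<exists>r. 0 \<le> r \<and> r < l g \<and> (\<forall>k. d (P m) (P (m + k)) = d (P r) (P (r + k)))" for m
  proof -
    have up: "d (P (m + l g)) (P (m + l g + k)) = d (P m) (P (m + k))" for m k
      using shift[of m] shift[of "m + k"] g by (simp add: algebra_simps)
    have *: "\<forall>k. d (P (r + int q * l g)) (P (r + int q * l g + k)) = d (P r) (P (r + k))" for r q
    proof (induction q)
      case (Suc q)
      then show ?case using up[of "r + int q * l g"] by (simp add: algebra_simps)
    qed simp
    have "\<forall>k. d (P m) (P (m + k)) = d (P (m mod l g)) (P (m mod l g + k))"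
    proof (cases "0 \<le> m div l g")
      case True
      then have "m mod l g + int (nat (m div l g)) * l g = m"
        by (simp add: mod_div_mult_eq)
      then show ?thesis using *[of "m mod l g" "nat (m div l g)"] by simp
    next
      case False
      then have "m + int (nat (- (m div l g))) * l g = m - m div l g * l g" by simp
      then have "m + int (nat (- (m div l g))) * l g = m mod l g"
        by (simp add: minus_div_mult_eq_mod)
      then show ?thesis using *[of m "nat (- (m div l g))"] by simp
    qed
    then show ?thesis using pos by (intro exI[of _ "m mod l g"]) auto
  qed
  have "line P"
  proof (rule lineI)
    fix m
    obtain r where r: "0 \<le> r" "r < l g" "\<forall>k. d (P m) (P (m + k)) = d (P r) (P (r + k))"
      using red by blast
    have "d (P r) (P (r + 1)) = 1" using fd[of "nat r" "nat (r + 1)"] r f(4) by (simp add: Pf)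
    then show "d (P m) (P (m + 1)) = 1" using r by simp
    have "d (P r) (P (r + 2)) = 2"
    proof (cases "r + 2 \<le> l g")
      case True
      then show ?thesis using fd[of "nat r" "nat (r + 2)"] r f(4) by (simp add: Pf)
    next
      case False
      \<comment> \<open>Only here do the three consecutive vertices lie in two translates.
        Backtracking at their common end would give a shortcut from \<open>y\<close> to
        \<open>g $ g $ y\<close>.\<close>
      then have r': "r = l g - 1" using r by simp
      have P0: "P 0 = y" "P (l g) = g $ y" "P (2 * l g) = g $ g $ y"
        using Pf[of 0] shift[of 0] shift[of "l g"] f pos by auto
      have "d y (P r) = l g - 1" using fd[of 0 "nat r"] r' f pos by (simp add: Pf)
      moreover have "d (P (r + 2)) (g $ g $ y) = l g - 1"
      proof -
        have "P (r + 2) = g $ P 1" using shift[of 1] r' by (simp add: add.commute)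
        moreover have "d (P 1) (P (l g)) = l g - 1"
          using fd[of 1 n] f pos by (simp add: Pf) (metis int_nat_eq nat_int)
        ultimately show ?thesis using g P0 by simp
      qed
      moreover have "d (P (r + 1)) (P (r + 2)) = 1"
      proof -
        have "P (r + 2) = g $ P 1" "P (r + 1) = g $ P 0" using shift[of 1] shift[of 0] r'
          by (simp_all add: add.commute)
        moreover have "d (P 0) (P 1) = 1" using fd[of 0 1] f pos by (simp add: Pf)
        ultimately show ?thesis using g by simp
      qed
      ultimately show ?thesis
        using two_step_hyperbolic[OF g pos inv y] \<open>d (P r) (P (r + 1)) = 1\<close>
          d_triangle[of y "g $ g $ y" "P r"] d_triangle[of "P r" "g $ g $ y" "P (r + 2)"]
          d_triangle[of "P r" "P (r + 2)" "P (r + 1)"] by linarith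
    qed
    then show "d (P m) (P (m + 2)) = 2" using r by simp
  qed
  then show ?thesis using that[of P] g pos shift by (simp add: axis_def)
qed

section \<open>Overlapping lines and the lengths of \<open>g + h\<close> and
  \<open>g - h\<close>\<close>

lemma line_agree_between:
  assumes "line P" "line Q" "P a = Q a" "P b = Q b" "a \<le> j" "j \<le> b"
  shows "P j = Q j"
proof (rule between_unique)
  show "d (P a) (P b) = d (P a) (P j) + d (P j) (P b)"
    using assms(5,6) by (simp add: line_d[OF \<open>line P\<close>])
  show "d (P a) (P b) = d (P a) (Q j) + d (Q j) (P b)"
    unfolding assms(3,4) using assms(5,6) by (simp add: line_d[OF \<open>line Q\<close>])
  show "d (P a) (P j) = d (P a) (Q j)"
    unfolding line_d[OF \<open>line P\<close>]
    unfolding assms(3) line_d[OF \<open>line Q\<close>] ..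
qed

lemma fork:
  assumes P: "line P" and Q: "line Q" and "P q = Q q" "P (q + 1) \<noteq> Q (q + 1)" "0 \<le> s" "0 \<le> t"
  shows "d (P (q + s)) (Q (q + t)) = s + t"
proof -
  obtain c where c: "d (P q) (P (q + s)) = d (P q) c + d c (P (q + s))"
    "d (P q) (Q (q + t)) = d (P q) c + d c (Q (q + t))"
    "d (P (q + s)) (Q (q + t)) = d (P (q + s)) c + d c (Q (q + t))"
    by (rule ex_median[of "P q" "P (q + s)" "Q (q + t)"])
  have cP: "c = P (q + d (P q) c)" using line_between[OF P _ c(1)] assms by simp
  have cQ: "c = Q (q + d (P q) c)" using line_between[OF Q, of q "q + t" c] c assms by simp
  have "c = P q"
  proof (rule ccontr)
    assume "c \<noteq> P q"
    then have "1 \<le> d (P q) c" using d_pos[of "P q" c] by fastforce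
    then have "P (q + 1) = Q (q + 1)"
      using line_agree_between[OF P Q, of q "q + d (P q) c" "q + 1"] cP cQ assms by simp
    then show False using assms by simp
  qed
  have "d (P (q + s)) (P q) = s" "d (Q q) (Q (q + t)) = t" 
    using \<open>0 \<le> s\<close> \<open>0 \<le> t\<close>
    by (simp_all add: line_d[OF P] line_d[OF Q])
  with c(3) show ?thesis using \<open>P q = Q q\<close> unfolding \<open>c = P q\<close> by simp
qed

lemma fork_down:
  assumes P: "line P" and Q: "line Q" and "P q = Q q" "P (q - 1) \<noteq> Q (q - 1)" "0 \<le> s" "0 \<le> t"
  shows "d (P (q - s)) (Q (q - t)) = s + t"
  using fork[OF line_reflect[OF P, of 0] line_reflect[OF Q, of 0], of "- q" s t] assms(3-6) by simp

lemma aligned_opposite: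
  assumes P: "line P" and Q: "line Q" and al: "aligned P Q" and m: "P m = Q m" and "0 \<le> s" "0 \<le> t"
  shows "d (P (m - s)) (Q (m + t)) = s + t"
proof -
  have "P (m - 1) \<noteq> Q (m + 1)"
  proof
    assume "P (m - 1) = Q (m + 1)"
    then have "m - 1 = m + 1" using al unfolding aligned_def by blast
    then show False by simp
  qed
  moreover have "2 * m - m = m" "2 * m - (m + 1) = m - 1" "2 * m - (m + s) = m - s" by simp_all
  ultimately show ?thesis
    using fork[OF line_reflect[OF P, of "2 * m"] Q, of m s t] m \<open>0 \<le> s\<close> \<open>0 \<le> t\<close> by presburger
qed

text \<open>The path that arrives at \<open>P m\<close> along \<open>Q\<close> and leaves along
  \<open>P\<close> never turns back, because both lines run in the same direction there; the same
  holds at its translate.\<close>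

lemma l_plus_aligned:
  assumes g: "axis g P" and h: "axis h Q" and al: "aligned P Q" and m: "P m = Q m"
  shows "l (g + h) = l g + l h"
proof -
  note P = axis_line[OF g] and Q = axis_line[OF h]
  have al': "aligned Q P" using al unfolding aligned_def by metis
  let ?x = "Q (m - l h)"
  have ux: "(g + h) $ ?x = P (m + l g)" using axis_act[OF h] axis_act[OF g] m[symmetric] by simp
  have v: "d ?x (P m) = l h" "d (P m) (P (m + l g)) = l g"
    unfolding line_d[OF P] unfolding m line_d[OF Q] by simp_all
  have "l (g + h) = d ?x (P m) + d (P m) ((g + h) $ ?x)"
  proof (rule l_eq_two_step)
    show "iso (g + h)" by (intro iso_plus axis_iso[OF g] axis_iso[OF h])
    show "d ?x ((g + h) $ ?x) = d ?x (P m) + d (P m) ((g + h) $ ?x)"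
      unfolding ux v using aligned_opposite[OF Q P al' m[symmetric], of "l h" "l g"] by simp
    have "(g + h) $ P m = g $ Q (m + l h)" using axis_act[OF h] m by simp
    moreover have "d (P m) (g $ Q (m + l h)) = d (P (m - l g)) (Q (m + l h))"
      using d_uminus'[OF axis_iso[OF g]] axis_act_uminus[OF g] by metis
    moreover have "d (P (m + l g)) (g $ Q (m + l h)) = l h"
      unfolding axis_act[OF g, symmetric] iso_d[OF axis_iso[OF g]] m line_d[OF Q] by simp
    ultimately show "d (P m) ((g + h) $ P m) = d (P m) ((g + h) $ ?x) + d ((g + h) $ ?x) ((g + h) $ P m)"
      unfolding ux using aligned_opposite[OF P Q al m, of "l g" "l h"] v by simp
    show "?x \<noteq> P m" using v(1) axis_pos[OF h] by auto
    show "P m \<noteq> (g + h) $ ?x" unfolding ux using v(2) axis_pos[OF g] by auto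
  qed
  then show ?thesis unfolding ux v by simp
qed

text \<open>The overlap is traversed in opposite directions and cancels from both periods. Since it
  is shorter than each of them, something remains of both, and the remainders are joined at the
  forks at \<open>p\<close> and \<open>q\<close>, where no further cancellation occurs.\<close>

lemma l_minus_overlap:
  assumes g: "axis g P" and h: "axis h Q" and "p \<le> q" and p: "P p = Q p" "P (p - 1) \<noteq> Q (p - 1)"
    and q: "P q = Q q" "P (q + 1) \<noteq> Q (q + 1)" and lg: "q - p < l g" and lh: "q - p < l h"
  shows "l (g - h) = l g + l h - 2 * (q - p)"
proof -
  note P = axis_line[OF g] and Q = axis_line[OF h]
  let ?x = "Q (p + l h)"
  have ux: "(g - h) $ ?x = P (p + l g)" using axis_act_uminus[OF h] axis_act[OF g] p(1)[symmetric]
    by simp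
  have xy: "d ?x (P q) = l h - (q - p)" "d (P q) (P (p + l g)) = l g - (q - p)"
    using lh unfolding line_d[OF P] unfolding q(1) line_d[OF Q] using lg by simp_all
  have "l (g - h) = d ?x (P q) + d (P q) ((g - h) $ ?x)"
  proof (rule l_eq_two_step)
    show "iso (g - h)" by (intro iso_minus axis_iso[OF g] axis_iso[OF h])
    show "d ?x ((g - h) $ ?x) = d ?x (P q) + d (P q) ((g - h) $ ?x)"
      unfolding ux xy
      using fork[OF Q P q(1)[symmetric] q(2)[symmetric], of "l h - (q - p)" "l g - (q - p)"] lg lh
      by (simp add: algebra_simps)
    have "(g - h) $ P q = g $ Q (q - l h)" using axis_act_uminus[OF h] q by simp
    moreover have "d (P q) (g $ Q (q - l h)) = d (P (q - l g)) (Q (q - l h))"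
      using d_uminus'[OF axis_iso[OF g]] axis_act_uminus[OF g] by metis
    moreover have "d (P (p + l g)) (g $ Q (q - l h)) = l h - (q - p)"
      unfolding axis_act[OF g, symmetric] iso_d[OF axis_iso[OF g]] p(1) line_d[OF Q]
      using lh \<open>p \<le> q\<close> by simp
    ultimately show "d (P q) ((g - h) $ P q) = d (P q) ((g - h) $ ?x) + d ((g - h) $ ?x) ((g - h) $ P q)"
      unfolding ux xy using fork_down[OF P Q p, of "l g - (q - p)" "l h - (q - p)"] lg lh
      by (simp add: algebra_simps)
    show "?x \<noteq> P q" using xy lh by auto
    show "P q \<noteq> (g - h) $ ?x" unfolding ux using xy lg by auto
  qed
  then show ?thesis unfolding ux xy by simp
qed

text \<open>On the overlap \<open>- h + g\<close> moves along \<open>Q\<close> backwards by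
  \<open>l h - l g\<close>. The overlap has to exceed \<open>l g\<close> by at least one edge, so
  that two adjacent vertices are moved in this way and the direction of the motion is
  determined.\<close>

lemma l_minus_long_overlap:
  assumes g: "axis g P" and h: "axis h Q" and p: "P p = Q p" and q: "P q = Q q"
    and lg: "l g < q - p" and lt: "l g < l h"
  shows "l (g - h) = l h - l g"
proof -
  note P = axis_line[OF g] and Q = axis_line[OF h] and i = axis_iso[OF g] axis_iso[OF h]
  have PQ: "P j = Q j" if "p \<le> j" "j \<le> q" for j using line_agree_between[OF P Q p q] that
    by blast
  let ?v = "- h + g" let ?c = "l h - l g"
  have v: "?v $ Q j = Q (j - ?c)" if "p \<le> j" "j + l g \<le> q" for j
    using PQ[of j] PQ[of "j + l g"] that axis_act[OF g, of j] axis_act_uminus[OF h] axis_pos[OF g]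
    by (simp add: algebra_simps)
  have v0: "?v $ Q p = Q (p - ?c)" "?v $ Q (p + 1) = Q (p + 1 - ?c)" using v[of p] v[of "p + 1"] lg
    by auto
  have iv: "iso ?v" using i by simp
  have "d (Q p) (?v $ Q (p - ?c)) = d (Q p) (Q (p + 1 - ?c)) + d (Q (p + 1 - ?c)) (Q (p - ?c))
      + d (Q (p - ?c)) (?v $ Q (p - ?c))"
  proof (rule concat)
    show "d (Q p) (Q (p - ?c)) = d (Q p) (Q (p + 1 - ?c)) + d (Q (p + 1 - ?c)) (Q (p - ?c))"
      using lt by (simp add: line_d[OF Q])
    have "d (Q (p + 1 - ?c)) (?v $ Q (p - ?c)) = ?c + 1"
      using iso_d[OF iv, of "Q (p + 1)" "Q (p - ?c)"] v0 lt by (simp add: line_d[OF Q])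
    moreover have "d (Q (p - ?c)) (?v $ Q (p - ?c)) = ?c"
      using iso_d[OF iv, of "Q p" "Q (p - ?c)"] v0 lt by (simp add: line_d[OF Q])
    ultimately show "d (Q (p + 1 - ?c)) (?v $ Q (p - ?c)) = d (Q (p + 1 - ?c)) (Q (p - ?c))
        + d (Q (p - ?c)) (?v $ Q (p - ?c))" by (simp add: line_d[OF Q])
    show "Q (p + 1 - ?c) \<noteq> Q (p - ?c)" using line_eq_iff[OF Q] by simp
  qed
  moreover have "d (Q (p - ?c)) (?v $ Q (p - ?c)) = ?c"
    using iso_d[OF iv, of "Q p" "Q (p - ?c)"] v0 lt by (simp add: line_d[OF Q])
  ultimately have "d (Q p) (?v $ ?v $ Q p) = 2 * ?c" using v0 lt by (simp add: line_d[OF Q])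
  moreover have "d (Q p) (?v $ Q p) = ?c" using v0 lt by (simp add: line_d[OF Q])
  ultimately have "l ?v = ?c" using l_eq_displacement[OF iv, of "Q p"] by simp
  then show ?thesis using l_commute[of "- h" g] i by simp
qed

text \<open>Both parametrizations are isometric, so on the common points they differ by a shift or
  by a reflection; the reflection is absorbed by passing to \<open>- h\<close>.\<close>

lemma ex_aligned:
  assumes P: "line P" and h: "axis h Q" and ab: "P a = Q b"
  obtains k R where "k = h \<or> k = - h" "axis k R" "range R = range Q" "aligned P R" "P a = R a"
proof -
  note Q = axis_line[OF h]
  have dd: "\<bar>m - m'\<bar> = \<bar>n - n'\<bar>" if "P m = Q n" "P m' = Q n'" for m n m' n'
    using line_d[OF P, of m m'] line_d[OF Q, of n n'] that by simp
  define c where "c = b - a"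
  have surj1: "range (\<lambda>m. Q (m + c)) = range Q"
    by (metis (mono_tags, lifting) diff_add_cancel image_iff rangeI subsetI subset_antisym image_subsetI)
  have surj2: "range (\<lambda>m. Q (a + b - m)) = range Q"
  proof -
    have "Q m = Q (a + b - (a + b - m))" for m by simp
    then show ?thesis
      by (metis (mono_tags, lifting) image_iff rangeI subsetI subset_antisym image_subsetI)
  qed
  show ?thesis
  proof (cases "\<forall>m n. P m = Q n \<longrightarrow> n = m + c")
    case True
    then have "aligned P (\<lambda>m. Q (m + c))" unfolding aligned_def by (metis add_right_cancel)
    then show ?thesis using that[of h "\<lambda>m. Q (m + c)"] axis_shift[OF h] ab surj1
      by (simp add: c_def)
  next
    case False
    then obtain m n where mn: "P m = Q n" "n \<noteq> m + c" by blast
    have *: "n' = a + b - m'" if "P m' = Q n'" for m' n'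
      using dd[OF mn(1) ab] dd[OF that ab] dd[OF that mn(1)] mn(2) unfolding c_def by linarith
    have "aligned P (\<lambda>m. Q (a + b - m))"
      unfolding aligned_def
    proof (intro allI impI)
      fix m n assume "P m = Q (a + b - n)"
      from *[OF this] show "m = n" by simp
    qed
    then show ?thesis using that[of "- h" "\<lambda>m. Q (a + b - m)"] axis_reflect[OF h] ab surj2
      by simp
  qed
qed

lemma lines_apart:
  assumes P: "line P" and Q: "line Q" and disj: "range P \<inter> range Q = {}"
  obtains m0 n0 where "\<And>m n. d (P m) (Q n) = \<bar>m - m0\<bar> + d (P m0) (Q n0) + \<bar>n - n0\<bar>"
proof -
  obtain y z where yz: "y \<in> range P" "z \<in> range Q"
    "\<And>y' z'. y' \<in> range P \<Longrightarrow> z' \<in> range Q \<Longrightarrow> d y z \<le> d y' z'"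
    using ex_nearest_pair[of "range P" "range Q"] by auto
  then obtain m0 n0 where e: "y = P m0" "z = Q n0" by auto
  have min: "d (P m0) (Q n0) \<le> d (P m) (Q n)" for m n
    using yz(3)[of "P m" "Q n"] unfolding e by simp
  obtain m1 where m1: "proj P (Q n0) m1" by (rule ex_proj[OF P])
  then have "m1 = m0"
    using min[of m1 n0] projD[OF m1, of m0] d_sym[of "Q n0" "P m1"] d_sym[of "Q n0" "P m0"]
    by linarith
  then have 1: "d (P m) (Q n0) = \<bar>m - m0\<bar> + d (P m0) (Q n0)" for m
    using projD[OF m1, of m] d_sym[of "Q n0" "P m"] d_sym[of "Q n0" "P m0"]
    unfolding \<open>m1 = m0\<close> by linarith
  obtain n1 where n1: "proj Q (P m0) n1" by (rule ex_proj[OF Q])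
  then have "n1 = n0" using min[of m0 n1] projD[OF n1, of n0] by linarith
  have 2: "d (P m0) (Q n) = d (P m0) (Q n0) + \<bar>n - n0\<bar>" for n
    using projD[OF n1, of n] unfolding \<open>n1 = n0\<close> .
  have "P m0 \<noteq> Q n0" using disj by auto
  then have "d (P m) (Q n) = d (P m) (P m0) + d (P m0) (Q n0) + d (Q n0) (Q n)" for m n
    using 1[of m] 2[of n] line_d[OF P, of m m0] line_d[OF Q, of n0 n]
    by (intro concat) linarith+
  then have "d (P m) (Q n) = \<bar>m - m0\<bar> + d (P m0) (Q n0) + \<bar>n - n0\<bar>" for m n
    using line_d[OF P, of m m0] line_d[OF Q, of n0 n] by (metis abs_minus_commute)
  then show ?thesis by (rule that)
qed

end

section \<open>Minimal triples\<close>

text \<open>These rules compute normal forms of words. They have to be used with \<open>simp only\<close>, because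
  \<open>diff_conv_add_uminus\<close> is the inverse of a default simplification rule.\<close>

lemmas word_simps = diff_conv_add_uminus minus_add minus_minus add.assoc minus_add_cancel
  add_minus_cancel left_minus right_minus add_0_left add_0_right

context stree
begin

section \<open>Minimality and its symmetries\<close>

definition F :: "'v bijection \<Rightarrow> 'v bijection \<Rightarrow> int" where
  "F g h = l (g + h) + l (g - h)"

definition total :: "'v bijection \<Rightarrow> 'v bijection \<Rightarrow> 'v bijection \<Rightarrow> int" where
  "total g h k = l g + l h + l k + F g h + F g k + F h k"

definition moves :: "'v bijection \<Rightarrow> 'v bijection \<Rightarrow> 'v bijection set" where
  "moves g h = {h, g + h, h - g, g + h - g}"

text \<open>The first argument is the acting isometry. The independent choices of \<open>h'\<close>
  and \<open>k'\<close> correspond to the choices of the two sets \<open>S1\<close> and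
  \<open>S2\<close>.\<close>

definition min_at :: "'v bijection \<Rightarrow> 'v bijection \<Rightarrow> 'v bijection \<Rightarrow> bool" where
  "min_at g h k \<longleftrightarrow> (\<forall>h'\<in>moves g h. \<forall>k'\<in>moves g k. total g h k \<le> total g h' k')"

definition minimal3 :: "'v bijection \<Rightarrow> 'v bijection \<Rightarrow> 'v bijection \<Rightarrow> bool" where
  "minimal3 g h k \<longleftrightarrow> iso g \<and> iso h \<and> iso k \<and> min_at g h k \<and> min_at h g k \<and> min_at k g h"

lemma l_rotate: "iso g \<Longrightarrow> iso h \<Longrightarrow> u = g + h \<Longrightarrow> v = h + g \<Longrightarrow> l u = l v"
  using l_commute by blast

lemma l_eq_uminus: "iso g \<Longrightarrow> u = - g \<Longrightarrow> l u = l g"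
  by simp

lemma F_commute: "iso g \<Longrightarrow> iso h \<Longrightarrow> F g h = F h g"
  using l_commute[of g h] l_minus_commute[of g h] by (simp add: F_def)

lemma F_uminus_right [simp]: "F g (- h) = F g h"
  by (simp add: F_def)

lemma F_uminus_left [simp]: "iso g \<Longrightarrow> iso h \<Longrightarrow> F (- g) h = F g h"
  using F_commute[of "- g" h] F_commute[of g h] by simp

lemma F_conj: "iso c \<Longrightarrow> iso g \<Longrightarrow> iso h \<Longrightarrow> F (c + g - c) (c + h - c) = F g h"
proof -
  assume i: "iso c" "iso g" "iso h"
  have "c + g - c + (c + h - c) = c + (g + h) - c" "c + g - c - (c + h - c) = c + (g - h) - c"
    by (simp_all only: word_simps)
  then show ?thesis using l_conj[of c "g + h"] l_conj[of c "g - h"] i unfolding F_def by simp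
qed

lemma iso_moves: "iso g \<Longrightarrow> iso h \<Longrightarrow> h' \<in> moves g h \<Longrightarrow> iso h'"
  by (auto simp: moves_def)

lemma total_uminus: "iso g \<Longrightarrow> iso h \<Longrightarrow> iso k \<Longrightarrow> total (- g) h k = total g h k"
  "iso g \<Longrightarrow> iso h \<Longrightarrow> iso k \<Longrightarrow> total g (- h) k = total g h k"
  by (simp_all add: total_def)

lemma total_swap: "iso h \<Longrightarrow> iso k \<Longrightarrow> total g h k = total g k h"
  using F_commute[of h k] by (simp add: total_def)

lemma total_conj:
  assumes "iso g" "iso h" "iso k" shows "total g (g + h - g) (g + k - g) = total g h k"
proof -
  have e: "g + g - g = g" by (simp only: word_simps)
  note F_conj[of g g h, unfolded e] F_conj[of g g k, unfolded e] F_conj[of g h k]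
  then show ?thesis using l_conj[of g h] l_conj[of g k] assms unfolding total_def by linarith
qed

lemma min_at_swap: "iso g \<Longrightarrow> iso h \<Longrightarrow> iso k \<Longrightarrow> min_at g h k \<Longrightarrow> min_at g k h"
  unfolding min_at_def by (metis iso_moves total_swap)

text \<open>Conjugation by \<open>g\<close> fixes \<open>g\<close> and preserves the total length,
  and it turns a multiplication by \<open>- g\<close> on one side into a division by
  \<open>g\<close> on the other.\<close>

lemma min_at_uminus_left:
  assumes i: "iso g" "iso h" "iso k" and m: "min_at g h k" shows "min_at (- g) h k"
  unfolding min_at_def
proof (intro ballI)
  fix h' k' assume "h' \<in> moves (- g) h" "k' \<in> moves (- g) k"
  moreover have "g + h' - g \<in> moves g h" if "h' \<in> moves (- g) h" for h h'
    using that unfolding moves_def by (auto simp only: word_simps insert_iff empty_iff)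
  ultimately have "total g h k \<le> total g (g + h' - g) (g + k' - g)"
    using m unfolding min_at_def by blast
  moreover have "iso h'" "iso k'"
    using iso_moves \<open>h' \<in> moves (- g) h\<close> \<open>k' \<in> moves (- g) k\<close> i
    by (metis iso_uminus)+
  ultimately show "total (- g) h k \<le> total (- g) h' k'" using i
    by (simp add: total_conj total_uminus)
qed

lemma min_at_uminus_right:
  assumes i: "iso g" "iso h" "iso k" and m: "min_at g h k" shows "min_at g (- h) k"
  unfolding min_at_def
proof (intro ballI)
  fix h' k' assume "h' \<in> moves g (- h)" "k' \<in> moves g k"
  moreover have "- h' \<in> moves g h"
    using \<open>h' \<in> moves g (- h)\<close> unfolding moves_def
    by (auto simp only: word_simps insert_iff empty_iff)
  ultimately have "total g h k \<le> total g (- h') k'" using m unfolding min_at_def by blast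
  moreover have "iso h'" "iso k'"
    using iso_moves \<open>h' \<in> moves g (- h)\<close> \<open>k' \<in> moves g k\<close> i
    by (metis iso_uminus)+
  ultimately show "total g (- h) k \<le> total g h' k'" using i by (simp add: total_uminus)
qed

lemma minimal3_swap12: "minimal3 g h k \<Longrightarrow> minimal3 h g k"
  unfolding minimal3_def using min_at_swap by blast

lemma minimal3_swap23: "minimal3 g h k \<Longrightarrow> minimal3 g k h"
  unfolding minimal3_def using min_at_swap by blast

lemma minimal3_uminus1: "minimal3 g h k \<Longrightarrow> minimal3 (- g) h k"
  unfolding minimal3_def using min_at_uminus_left min_at_uminus_right by simp

lemma minimal3_uminus2: "minimal3 g h k \<Longrightarrow> minimal3 g (- h) k"
  using minimal3_uminus1 minimal3_swap12 by blast

lemma minimal3_uminus3: "minimal3 g h k \<Longrightarrow> minimal3 g h (- k)"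
  using minimal3_uminus2 minimal3_swap23 by blast

lemma minimal3_uminus: "minimal3 g h k \<Longrightarrow> minimal3 (- g) (- h) (- k)"
  by (intro minimal3_uminus1 minimal3_uminus2 minimal3_uminus3)

lemma minimal3_iso: "minimal3 g h k \<Longrightarrow> iso g" "minimal3 g h k \<Longrightarrow> iso h" "minimal3 g h k \<Longrightarrow> iso k"
  by (auto simp: minimal3_def)

section \<open>Inequalities expressing minimality\<close>

lemma minimal3_conj:
  assumes m: "minimal3 g h k" shows "F h k \<le> F h (g + k - g)"
proof -
  note i = minimal3_iso[OF m]
  have "total g h k \<le> total g h (g + k - g)"
    using m unfolding minimal3_def min_at_def moves_def by blast
  moreover have "g + g - g = g" by (simp only: word_simps)
  then have "F g (g + k - g) = F g k" using F_conj[of g g k] i by simp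
  ultimately show ?thesis using i by (simp add: total_def l_conj)
qed

lemma minimal3_conj_uminus: "minimal3 g h k \<Longrightarrow> F h k \<le> F h (- g + k + g)"
  using minimal3_conj[OF minimal3_uminus1] by fastforce

lemma F_minus_self:
  assumes "iso g" "iso h" shows "F g (h - g) = l h + l (h - g - g)"
proof -
  have "l (g + (h - g)) = l h" using l_conj[of g h] assms by (simp add: add_diff_eq)
  moreover have "l (g - (h - g)) = l (h - g - g)" using assms l_minus_commute[of g "h - g"] by simp
  ultimately show ?thesis by (simp add: F_def)
qed

text \<open>The lengths of \<open>h\<close> and \<open>h - g\<close> occur in both totals and
  cancel, because \<open>g + (h - g)\<close> is conjugate to \<open>h\<close>.\<close>

lemma minimal3_single:
  assumes m: "minimal3 g h k" shows "l (h + g) + F h k \<le> l (h - g - g) + F (h - g) k"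
proof -
  note i = minimal3_iso[OF m]
  have "total g h k \<le> total g (h - g) k"
    using m unfolding minimal3_def min_at_def moves_def by blast
  moreover have "F g h = l (h + g) + l (h - g)" using F_commute[of g h] i by (simp add: F_def)
  ultimately show ?thesis using F_minus_self[OF i(1,2)] unfolding total_def by linarith
qed

lemma minimal3_single_left:
  assumes m: "minimal3 g h k" shows "l (h + g) + F h k \<le> l (h - g - g) + F (- g + h) k"
proof -
  note i = minimal3_iso[OF m]
  have "minimal3 (- g) (- h) (- k)" by (rule minimal3_uminus[OF m])
  from minimal3_single[OF this]
  have *: "l (- h + - g) + F (- h) (- k) \<le> l (- h - - g - - g) + F (- h - - g) (- k)" .
  have "l (- h + - g) = l (g + h)" by (rule l_eq_uminus)
    (use i in \<open>auto simp only: word_simps iso_plus\<close>)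
  moreover have "l (- h - - g - - g) = l (- g - g + h)"
    by (rule l_eq_uminus) (use i in \<open>auto simp only: word_simps iso_plus iso_uminus\<close>)
  moreover have "l (- g - g + h) = l (h - g - g)"
    by (rule l_rotate[of "- g - g" h])
    (use i in \<open>auto simp only: word_simps iso_plus iso_uminus\<close>)
  moreover have "- h - - g = - (- g + h)" by (simp only: word_simps)
  then have "F (- h - - g) (- k) = F (- g + h) k" using i by simp
  moreover have "F (- h) (- k) = F h k" using i by simp
  ultimately show ?thesis using * l_commute[of g h] i by simp
qed

text \<open>Dividing both isometries by \<open>g\<close> on the right preserves
  \<open>h - k\<close>; of the terms in \<open>F h k\<close> only \<open>l (h + k)\<close>
  changes.\<close>

lemma minimal3_double:
  assumes m: "minimal3 g h k"
  shows "l (h + g) + l (k + g) + l (h + k) \<le> l (h - g - g) + l (k - g - g) + l (h - g + k - g)"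
proof -
  note i = minimal3_iso[OF m]
  have "total g h k \<le> total g (h - g) (k - g)"
    using m unfolding minimal3_def min_at_def moves_def by blast
  moreover have "F g h = l (h + g) + l (h - g)" "F g k = l (k + g) + l (k - g)"
    using F_commute[of g h] F_commute[of g k] i by (simp_all add: F_def)
  moreover have "h - g + (k - g) = h - g + k - g" "h - g - (k - g) = h - k"
    by (simp_all only: word_simps)
  then have "F (h - g) (k - g) = l (h - g + k - g) + l (h - k)" unfolding F_def by simp
  ultimately show ?thesis using F_minus_self[OF i(1,2)] F_minus_self[OF i(1,3)] F_def[of h k]
    unfolding total_def by linarith
qed

subsection \<open>Upper bounds from closed paths\<close>

text \<open>One vertex is chosen for each letter of the cyclic word. A letter costs only the
  distance by which it fails to carry the next vertex to its own, and good choices make most letters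
  free.\<close>

lemma l_le_path2: "iso a \<Longrightarrow> l (a + b) \<le> d x (a $ y) + d y (b $ x)"
  using l_le[of "a + b" x] d_triangle[of x "a $ b $ x" "a $ y"] iso_d[of a y "b $ x"] by simp

lemma l_le_path3:
  "iso a \<Longrightarrow> iso b \<Longrightarrow> l (a + b + c) \<le> d x (a $ y) + d y (b $ z) + d z (c $ x)"
  using l_le_path2[of "a + b" c x z] d_triangle[of x "a $ b $ z" "a $ y"] iso_d[of a y "b $ z"]
  by simp

lemma l_le_path4:
  "iso a \<Longrightarrow> iso b \<Longrightarrow> iso c \<Longrightarrow>
    l (a + b + c + e) \<le> d x (a $ y) + d y (b $ z) + d z (c $ w) + d w (e $ x)"
  using l_le_path3[of "a + b" c e x z w] d_triangle[of x "a $ b $ z" "a $ y"] iso_d[of a y "b $ z"]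
  by simp

lemma aligned_sym: "aligned P Q \<Longrightarrow> aligned Q P"
  unfolding aligned_def by metis

lemma aligned_if_agree:
  assumes Q: "line Q" and R: "line R" and "Q a = R a" "Q b = R b" "a < b"
  shows "aligned Q R"
  unfolding aligned_def
proof (intro allI impI)
  fix x y assume xy: "Q x = R y"
  have "\<bar>x - a\<bar> = \<bar>y - a\<bar>" "\<bar>x - b\<bar> = \<bar>y - b\<bar>"
    using xy assms(3,4) line_d[OF Q, of x a] line_d[OF Q, of x b] line_d[OF R, of y a] line_d[OF R, of y b]
    by simp_all
  then show "x = y" using \<open>a < b\<close> by linarith
qed

text \<open>With the chosen vertices the first two letters are free. The last one costs at most
  \<open>l g\<close> plus the length \<open>l h - l g\<close> of the rest of the period.\<close>

lemma l_minus_minus_le: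
  assumes h: "axis h P" and g: "axis g S" and s: "S s = P s" "S (s + l g) = P (s + l g)"
    and le: "l g \<le> l h"
  shows "l (h - g - g) \<le> l h"
proof -
  note P = axis_line[OF h] and i = axis_iso[OF g] axis_iso[OF h]
  let ?a = "l g"
  have gP: "g $ P s = P (s + ?a)" using axis_act[OF g, of s] s by simp
  have gg: "g $ P (s + ?a) = S (s + ?a + ?a)" using axis_act[OF g, of "s + ?a"] s by simp
  have 1: "d (S (s + ?a + ?a)) (P (s + ?a)) = ?a"
    unfolding s(2)[symmetric] line_d[OF axis_line[OF g]] by simp
  have 2: "d (P (s + ?a)) (P (s + l h)) = l h - ?a" using le by (simp add: line_d[OF P])
  have "l (h + - g + - g) \<le> d (P (s + l h)) (h $ P s) + d (P s) ((- g) $ P (s + ?a))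
      + d (P (s + ?a)) ((- g) $ P (s + l h))"
    by (rule l_le_path3) (use i in auto)
  also have "\<dots> = d (S (s + ?a + ?a)) (P (s + l h))"
    using gP gg by (simp add: axis_act[OF h] d_uminus[OF i(1)])
  also have "\<dots> \<le> l h"
    using d_triangle[of "S (s + ?a + ?a)" "P (s + l h)" "P (s + ?a)"] 1 2 by linarith
  finally show ?thesis by (simp only: word_simps)
qed

text \<open>\<open>h - g\<close> carries \<open>P (s + l g)\<close> to \<open>P (s + l h)\<close>,
  so only \<open>k\<close> has a cost in the closed paths. The summand \<open>l g\<close> is the
  gain of \<open>l (h - g - g)\<close> over \<open>l (h + g)\<close>.\<close>

lemma shorten_right:
  assumes m: "minimal3 g h k" and h: "axis h P" and g: "axis g S" and al: "aligned P S"
    and s: "S s = P s" "S (s + l g) = P (s + l g)" and le: "l g \<le> l h"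
  shows "F h k + l g \<le> d (P (s + l g)) (k $ P (s + l h)) + d (P (s + l h)) (k $ P (s + l g))"
proof -
  note P = axis_line[OF h] and i = minimal3_iso[OF m]
  let ?a = "l g"
  have gP: "g $ P s = P (s + ?a)" using axis_act[OF g, of s] s by simp
  have hg: "l (h + g) = l h + l g" by (rule l_plus_aligned[OF h g al s(1)[symmetric]])
  have "l (h + - g + k) \<le> d (P (s + l h)) (h $ P s) + d (P s) ((- g) $ P (s + ?a))
      + d (P (s + ?a)) (k $ P (s + l h))"
    by (rule l_le_path3) (use i in auto)
  then have 1: "l (h - g + k) \<le> d (P (s + ?a)) (k $ P (s + l h))"
    using gP by (simp add: axis_act[OF h] d_uminus[OF i(1)])
  have "l (h + - g + - k) \<le> d (P (s + l h)) (h $ P s) + d (P s) ((- g) $ P (s + ?a))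
      + d (P (s + ?a)) ((- k) $ P (s + l h))"
    by (rule l_le_path3) (use i in auto)
  then have 2: "l (h - g - k) \<le> d (P (s + l h)) (k $ P (s + ?a))"
    using gP d_sym[of "k $ P (s + ?a)"]
    by (simp add: axis_act[OF h] d_uminus[OF i(1)] d_uminus[OF i(3)])
  show ?thesis
    using minimal3_single[OF m] hg l_minus_minus_le[OF h g s le] 1 2 F_def[of "h - g" k] by linarith
qed

lemma shorten_left:
  assumes m: "minimal3 g h k" and h: "axis h P" and g: "axis g S" and al: "aligned P S"
    and s: "S s = P s" "S (s + l g) = P (s + l g)" and le: "l g \<le> l h"
  shows "F h k + l g \<le> d (P s) (k $ P (s + l g - l h)) + d (P (s + l g - l h)) (k $ P s)"
proof -
  note i = minimal3_iso[OF m]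
  have m': "minimal3 (- g) (- h) (- k)" by (rule minimal3_uminus[OF m])
  have al': "aligned (\<lambda>m. P (0 - m)) (\<lambda>m. S (0 - m))" using al unfolding aligned_def
    by fastforce
  have e: "l (- g) = l g" "l (- h) = l h" "F (- h) (- k) = F h k" using i by simp_all
  have p: "0 - (- s - l g) = s + l g" "0 - (- s - l g + l g) = s" "0 - (- s - l g + l h) = s + l g - l h"
    by simp_all
  have "F h k + l g \<le> d (P s) ((- k) $ P (s + l g - l h)) + d (P (s + l g - l h)) ((- k) $ P s)"
    using shorten_right[OF m' axis_reflect[OF h] axis_reflect[OF g] al', of "- s - l g"] s le
    unfolding e p by simp
  then show ?thesis
    using d_uminus[OF i(3), of "P s" "P (s + l g - l h)"] d_uminus[OF i(3), of "P (s + l g - l h)" "P s"]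
      d_sym[of "P s"] d_sym[of "k $ P s"] by simp
qed

text \<open>Along the common segment each factor of \<open>h - g + k - g\<close> loses
  \<open>l g\<close> compared with \<open>h + k\<close>, and the pairs with \<open>g\<close> become
  shorter as well.\<close>

lemma no_common_segment:
  assumes m: "minimal3 g h k" and h: "axis h P" and g: "axis g S" and k: "axis k R"
    and al: "aligned P S" "aligned P R"
    and s: "S s = P s" "S (s + l g) = P (s + l g)" "R s = P s" "R (s + l g) = P (s + l g)"
    and le: "l g \<le> l h" "l g \<le> l k"
  shows False
proof -
  note i = minimal3_iso[OF m] and P = axis_line[OF h] and S = axis_line[OF g] and R = axis_line[OF k]
  let ?a = "l g"
  have pos: "0 < ?a" using axis_pos[OF g] .
  have aRS: "aligned R S"
    by (rule aligned_if_agree[OF R S, of s "s + ?a"]) (use s pos in simp_all)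
  have hg: "l (h + g) = l h + ?a" by (rule l_plus_aligned[OF h g al(1) s(1)[symmetric]])
  have hk: "l (h + k) = l h + l k" by (rule l_plus_aligned[OF h k al(2) s(3)[symmetric]])
  have kg: "l (k + g) = l k + ?a" by (rule l_plus_aligned[OF k g aRS, of s]) (simp add: s)
  have hgg: "l (h - g - g) \<le> l h" by (rule l_minus_minus_le[OF h g s(1,2) le(1)])
  have kgg: "l (k - g - g) \<le> l k"
    by (rule l_minus_minus_le[OF k g _ _ le(2), of s]) (simp_all add: s)
  have gP: "g $ P s = P (s + ?a)" using axis_act[OF g, of s] s by simp
  have kP: "k $ P s = R (s + l k)" using axis_act[OF k, of s] s by simp
  have "l (h + - g + k + - g) \<le> d (P (s + ?a)) (h $ P s) + d (P s) ((- g) $ P (s + ?a))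
      + d (P (s + ?a)) (k $ P s) + d (P s) ((- g) $ P (s + ?a))"
    by (rule l_le_path4) (use i in auto)
  also have "\<dots> = d (P (s + ?a)) (P (s + l h)) + d (P (s + ?a)) (R (s + l k))"
    using gP kP by (simp add: axis_act[OF h] d_uminus[OF i(1)])
  also have "\<dots> = (l h - ?a) + (l k - ?a)"
    unfolding s(4)[symmetric] line_d[OF R] unfolding s(4) line_d[OF P] using le by simp
  finally have "l (h - g + k - g) \<le> l h + l k - 2 * ?a" by simp
  then show False using minimal3_double[OF m] hg hk kg hgg kgg pos by linarith
qed

end

section \<open>Long overlaps contradict minimality\<close>

context stree
begin

lemma l_pm_apart:
  assumes h: "axis h P" and k: "axis k R" and min: "\<And>m n. D \<le> d (P m) (R n)" and D: "0 < D"
  obtains m n where "F h k = 2 * l h + 2 * l k + 4 * d (P m) (R n)"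
proof -
  note i = axis_iso[OF h] axis_iso[OF k]
  obtain y z where yz: "y \<in> C h" "z \<in> C k" "\<And>y' z'. y' \<in> C h \<Longrightarrow> z' \<in> C k \<Longrightarrow> d y z \<le> d y' z'"
    using ex_nearest_pair[of "C h" "C k"] C_nonempty by blast
  obtain m n where mn: "y = P m" "z = R n" using yz axis_range[OF h] axis_range[OF k] by auto
  have ne: "y \<noteq> z" using min[of m n] D unfolding mn by fastforce
  have "l (h + k) = l h + l k + 2 * d y z" by (rule l_plus_apart[OF i yz(1,2) ne yz(3)])
  moreover have "l (h + - k) = l h + l (- k) + 2 * d y z"
    by (rule l_plus_apart) (use i yz ne in auto)
  ultimately show ?thesis using that[of m n] i mn unfolding F_def by simp
qed

lemma F_le:
  assumes i: "iso h" "iso k" and x: "x \<in> C h" and y: "y \<in> C k"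
  shows "F h k \<le> 2 * l h + 2 * l k + 4 * d x y"
proof -
  have *: "l (h + k) \<le> l h + l k + 2 * d x y" if "iso k" "y \<in> C k" for k
  proof -
    have "l (h + k) \<le> d x (h $ x) + d x (k $ x)" by (rule l_le_path2[OF i(1)])
    also have "d x (k $ x) \<le> d x y + d y (k $ y) + d (k $ y) (k $ x)"
      using d_triangle[of x "k $ x" y] d_triangle[of y "k $ x" "k $ y"] by linarith
    finally show ?thesis
      using that C_D[OF x] C_D[OF that(2)] iso_d[OF that(1), of y x] d_sym[of y x]
      by linarith
  qed
  show ?thesis using *[of k] *[of "- k"] i y unfolding F_def by simp
qed

lemma C_conj: "iso g \<Longrightarrow> iso k \<Longrightarrow> y \<in> C k \<Longrightarrow> (- g) $ y \<in> C (- g + k + g)"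
  using l_conj[of "- g" k] by (simp add: C_def)

text \<open>The vertices of the projection of \<open>Q\<close> to \<open>P\<close>, given by their
  parameters. Minimizing over both lines covers disjoint and meeting lines uniformly
  (\<open>near_cases\<close>).\<close>

definition near :: "(int \<Rightarrow> 'v) \<Rightarrow> (int \<Rightarrow> 'v) \<Rightarrow> int set" where
  "near P Q = {m. \<exists>n. \<forall>m' n'. d (P m) (Q n) \<le> d (P m') (Q n')}"

lemma near_apart:
  assumes "\<And>m n. d (P m) (Q n) = \<bar>m - m0\<bar> + e + \<bar>n - n0\<bar>"
  shows "near P Q = {m0}"
proof -
  have "m = m0" if "\<forall>m' n'. d (P m) (Q n) \<le> d (P m') (Q n')" for m n
    using that[rule_format, of m0 n0] assms[of m n] assms[of m0 n0] by linarith
  moreover have "d (P m0) (Q n0) \<le> d (P m') (Q n')" for m' n'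
    using assms[of m' n'] assms[of m0 n0] by linarith
  ultimately show ?thesis unfolding near_def by auto
qed

lemma near_meet:
  assumes "P a = Q b" shows "near P Q = {m. P m \<in> range Q}"
proof -
  have "P m \<in> range Q" if "\<forall>m' n'. d (P m) (Q n) \<le> d (P m') (Q n')" for m n
    using that[rule_format, of a b] assms d_pos[of "P m" "Q n"] by fastforce
  then show ?thesis unfolding near_def by auto (metis d_nonneg d_self)
qed

lemma near_cases:
  assumes P: "line P" and Q: "line Q"
  obtains (apart) m0 n0 e where "0 < e" "near P Q = {m0}"
      "\<And>m n. d (P m) (Q n) = \<bar>m - m0\<bar> + e + \<bar>n - n0\<bar>"
    | (meet) a b where "P a = Q b" "near P Q = {m. P m \<in> range Q}"
proof (cases "range P \<inter> range Q = {}")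
  case True
  obtain m0 n0 where *: "\<And>m n. d (P m) (Q n) = \<bar>m - m0\<bar> + d (P m0) (Q n0) + \<bar>n - n0\<bar>"
    using lines_apart[OF P Q True] by blast
  have "0 < d (P m0) (Q n0)" using True by (intro d_pos) auto
  from apart[OF this near_apart[OF *] *] show ?thesis .
next
  case False
  then obtain a b where "P a = Q b" by auto
  then show ?thesis using near_meet by (intro meet) auto
qed

lemma near_projections:
  assumes P: "line P" and Q: "line Q"
  obtains e where "0 \<le> e" "\<And>m. m \<in> near P Q \<Longrightarrow> \<exists>n. d (P m) (Q n) = e"
    "\<And>n. \<exists>m\<in>near P Q. proj P (Q n) m \<and> e \<le> d (Q n) (P m)"
proof (rule near_cases[OF P Q])
  fix m0 n0 e
  assume a: "0 < e" "near P Q = {m0}" "\<And>m n. d (P m) (Q n) = \<bar>m - m0\<bar> + e + \<bar>n - n0\<bar>"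
  show ?thesis
  proof (rule that[of e])
    fix m assume "m \<in> near P Q"
    then show "\<exists>n. d (P m) (Q n) = e" using a(2) a(3)[of m n0] by auto
  next
    fix n
    have "d (Q n) (P m) = \<bar>m - m0\<bar> + e + \<bar>n - n0\<bar>" for m
      using a(3)[of m n] d_sym[of "Q n"] by simp
    then have "proj P (Q n) m0 \<and> e \<le> d (Q n) (P m0)" unfolding proj_def by simp
    then show "\<exists>m\<in>near P Q. proj P (Q n) m \<and> e \<le> d (Q n) (P m)" using a(2)
      by blast
  qed (use a in simp)
next
  fix a b
  assume ab: "P a = Q b" and nr: "near P Q = {m. P m \<in> range Q}"
  show ?thesis
  proof (rule that[of 0])
    fix m assume "m \<in> near P Q"
    then obtain n where "P m = Q n" using nr by auto
    then have "d (P m) (Q n) = 0" by simp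
    then show "\<exists>n. d (P m) (Q n) = 0" ..
  next
    fix n
    obtain m where m: "proj P (Q n) m" by (rule ex_proj[OF P])
    have "d (Q n) (Q b) = d (Q n) (P m) + d (P m) (Q b)"
      using projD[OF m, of a] line_d[OF P, of m a] unfolding ab by linarith
    then have "P m \<in> range Q" using line_between_ex[OF Q] by blast
    then show "\<exists>m\<in>near P Q. proj P (Q n) m \<and> 0 \<le> d (Q n) (P m)" using m nr
      by auto
  qed simp
qed

lemma near_convex:
  assumes P: "line P" and Q: "line Q" and "a \<in> near P Q" "b \<in> near P Q" "a \<le> j" "j \<le> b"
  shows "j \<in> near P Q"
proof (rule near_cases[OF P Q])
  fix m0 assume "near P Q = {m0}"
  then show ?thesis using assms by simp
next
  assume nr: "near P Q = {m. P m \<in> range Q}"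
  then obtain a' b' where "P a = Q a'" "P b = Q b'" using assms by auto
  moreover have "d (P a) (P b) = d (P a) (P j) + d (P j) (P b)" using assms(5,6)
    by (simp add: line_d[OF P])
  ultimately have "d (Q a') (Q b') = d (Q a') (P j) + d (P j) (Q b')" by simp
  then show ?thesis using line_between_ex[OF Q] nr by blast
qed

lemma near_nonempty: "line P \<Longrightarrow> line Q \<Longrightarrow> near P Q \<noteq> {}"
  by (rule near_projections[of P Q]) auto

text \<open>Conjugating \<open>k\<close> by \<open>g\<close> moves the projection of its axis along the axis of \<open>g\<close> by \<open>l g\<close>,
  so minimality bounds the gap between two disjoint projections.\<close>

lemma gap_le_shifted_gap:
  assumes m: "minimal3 g h k" and g: "axis g P" and h: "axis h Q" and k: "axis k R"
    and disj: "near P Q \<inter> near P R = {}" and j: "j \<in> near P Q" and c: "c \<in> near P R"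
  obtains j' c' where "j' \<in> near P Q" "c' \<in> near P R" "\<bar>c' - j'\<bar> \<le> \<bar>c - j - l g\<bar>"
proof -
  note P = axis_line[OF g] and Q = axis_line[OF h] and R = axis_line[OF k] and i = minimal3_iso[OF m]
  obtain e where e: "0 \<le> e" "\<And>m. m \<in> near P Q \<Longrightarrow> \<exists>n. d (P m) (Q n) = e"
    "\<And>n. \<exists>m\<in>near P Q. proj P (Q n) m \<and> e \<le> d (Q n) (P m)"
    using near_projections[OF P Q] by blast
  obtain e' where e': "0 \<le> e'" "\<And>m. m \<in> near P R \<Longrightarrow> \<exists>n. d (P m) (R n) = e'"
    "\<And>n. \<exists>m\<in>near P R. proj P (R n) m \<and> e' \<le> d (R n) (P m)"
    using near_projections[OF P R] by blast
  have low: "\<exists>j'\<in>near P Q. \<exists>c'\<in>near P R. e + \<bar>c' - j'\<bar> + e' \<le> d (Q n) (R n')" for n n'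
  proof -
    obtain j' where j': "j' \<in> near P Q" "proj P (Q n) j'" "e \<le> d (Q n) (P j')" using e(3)
      by blast
    obtain c' where c': "c' \<in> near P R" "proj P (R n') c'" "e' \<le> d (R n') (P c')"
      using e'(3) by blast
    have "j' \<noteq> c'" using j' c' disj by blast
    from proj_apart[OF P j'(2) c'(2) this] have "e + \<bar>c' - j'\<bar> + e' \<le> d (Q n) (R n')"
      using j' c' d_sym[of "P c'" "R n'"] by linarith
    then show ?thesis using j' c' by blast
  qed
  have "1 \<le> d (Q n) (R n')" for n n'
  proof -
    obtain j' c' where "j' \<in> near P Q" "c' \<in> near P R" "e + \<bar>c' - j'\<bar> + e' \<le> d (Q n) (R n')"
      using low by blast
    moreover from calculation have "j' \<noteq> c'" using disj by blast
    ultimately show ?thesis using e e' by linarith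
  qed
  from l_pm_apart[OF h k this] obtain n n' where n: "F h k = 2 * l h + 2 * l k + 4 * d (Q n) (R n')"
    by auto
  obtain n1 n2 where n1: "d (P j) (Q n1) = e" and n2: "d (P c) (R n2) = e'" using e(2) e'(2) j c
    by blast
  have Ch: "Q n1 \<in> C h" "R n2 \<in> C k" using axis_range h k by blast+
  have "F h (- g + k + g) \<le> 2 * l h + 2 * l (- g + k + g) + 4 * d (Q n1) ((- g) $ R n2)"
    by (rule F_le) (use i Ch C_conj in auto)
  moreover have "l (- g + k + g) = l k" using l_conj[of "- g" k] i by simp
  moreover have "d (Q n1) ((- g) $ R n2) \<le> e + \<bar>c - j - l g\<bar> + e'"
  proof -
    have "d ((- g) $ P c) ((- g) $ R n2) = e'" using i n2 by simp
    moreover have "d (P j) ((- g) $ P c) = \<bar>c - j - l g\<bar>"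
      unfolding axis_act_uminus[OF g] line_d[OF P] by linarith
    ultimately show ?thesis
      using d_triangle[of "Q n1" "(- g) $ R n2" "P j"] d_triangle[of "P j" "(- g) $ R n2" "(- g) $ P c"]
        n1 d_sym[of "P j" "Q n1"] by linarith
  qed
  ultimately have le: "d (Q n) (R n') \<le> e + \<bar>c - j - l g\<bar> + e'"
    using minimal3_conj_uminus[OF m] n by linarith
  obtain j' c' where "j' \<in> near P Q" "c' \<in> near P R" "e + \<bar>c' - j'\<bar> + e' \<le> d (Q n) (R n')"
    using low by blast
  then show ?thesis using that le by fastforce
qed

text \<open>Otherwise take a pair of parameters from the two projections with the smallest gap. As
  the projections spread over at least \<open>l g\<close>, shifting by \<open>l g\<close> produces a
  smaller gap, contrary to \<open>gap_le_shifted_gap\<close>.\<close>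

lemma near_intersect:
  assumes m: "minimal3 g h k" and g: "axis g P" and h: "axis h Q" and k: "axis k R"
    and j: "j \<in> near P Q" and c: "c \<in> near P R" and far: "l g \<le> c - j"
  shows "near P Q \<inter> near P R \<noteq> {}"
proof
  assume disj: "near P Q \<inter> near P R = {}"
  note P = axis_line[OF g] and Q = axis_line[OF h] and R = axis_line[OF k]
  have pos: "0 < l g" using axis_pos[OF g] .
  obtain x where x: "fst x \<in> near P Q \<and> snd x \<in> near P R"
    "\<forall>y. fst y \<in> near P Q \<and> snd y \<in> near P R \<longrightarrow> nat \<bar>snd x - fst x\<bar> \<le> nat \<bar>snd y - fst y\<bar>"
    using ex_has_least_nat[of "\<lambda>x. fst x \<in> near P Q \<and> snd x \<in> near P R" "(j, c)" "\<lambda>x. nat \<bar>snd x - fst x\<bar>"]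
      j c by auto
  define j1 p where "j1 = fst x" and "p = snd x"
  have J: "j1 \<in> near P Q" "p \<in> near P R" and
    least: "\<And>j' c'. j' \<in> near P Q \<Longrightarrow> c' \<in> near P R \<Longrightarrow> \<bar>p - j1\<bar> \<le> \<bar>c' - j'\<bar>"
    using x unfolding j1_def p_def by fastforce+
  note cJ = near_convex[OF P Q] and cK = near_convex[OF P R]
  have "j1 < p"
  proof (rule ccontr)
    assume "\<not> j1 < p"
    then consider "j1 < j" | "j \<le> j1" "p \<le> j" | "j \<le> j1" "j < p" by linarith
    then show False
    proof cases
      case 1
      then have "j \<in> near P R" using cK[of p c j] J c far pos \<open>\<not> j1 < p\<close>
        by linarith
      then show False using j disj by blast
    next
      case 2
      then have "j \<in> near P R" using cK[of p c j] J c far pos by linarith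
      then show False using j disj by blast
    next
      case 3
      then have "p \<in> near P Q" using cJ[of j j1 p] J j \<open>\<not> j1 < p\<close> by linarith
      then show False using J disj by blast
    qed
  qed
  have "\<exists>z\<in>near P Q. \<exists>w\<in>near P R. \<bar>w - z - l g\<bar> < p - j1"
  proof (cases "j1 < p - l g")
    case True
    then have "\<bar>p - j1 - l g\<bar> < p - j1" using pos by linarith
    then show ?thesis using J by blast
  next
    case False
    \<comment> \<open>The choice places \<open>z\<close> in the first projection and
      \<open>z + l g\<close> in the second, so the shifted gap is zero.\<close>
    define z where "z = max j (p - l g)"
    have "j \<le> j1"
    proof (rule ccontr)
      assume a: "\<not> j \<le> j1"
      then have "p \<le> j \<or> j < p" by linarith
      then show False
      proof
        assume "p \<le> j"
        then have "j \<in> near P R" using cK[of p c j] J c far pos by linarith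
        then show False using j disj by blast
      next
        assume "j < p"
        then show False using least[OF j J(2)] a by linarith
      qed
    qed
    then have "z \<in> near P Q" using cJ[of j j1 z] J j False unfolding z_def by linarith
    moreover have "p \<le> c"
    proof (rule ccontr)
      assume a: "\<not> p \<le> c"
      have "j1 < c"
      proof (rule ccontr)
        assume "\<not> j1 < c"
        then have "c \<in> near P Q" using cJ[of j j1 c] j J far pos by linarith
        then show False using c disj by blast
      qed
      then show False using least[OF J(1) c] a by linarith
    qed
    then have "z + l g \<in> near P R" using cK[of p c "z + l g"] J c far unfolding z_def
      by linarith
    moreover have "\<bar>z + l g - z - l g\<bar> < p - j1" using \<open>j1 < p\<close> by simp
    ultimately show ?thesis by blast
  qed
  then obtain z w where zw: "z \<in> near P Q" "w \<in> near P R" "\<bar>w - z - l g\<bar> < p - j1"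
    by blast
  obtain j' c' where "j' \<in> near P Q" "c' \<in> near P R" "\<bar>c' - j'\<bar> \<le> \<bar>w - z - l g\<bar>"
    using gap_le_shifted_gap[OF m g h k disj zw(1,2)] by blast
  then show False using least[of j' c'] zw \<open>j1 < p\<close> by linarith
qed

text \<open>The detours from \<open>P y\<close> to \<open>P y'\<close> and from \<open>P z\<close>
  to \<open>P z'\<close> are each paid twice, and between them \<open>k\<close> translates along
  \<open>R\<close>. With \<open>t = z' - y'\<close> the maximum is half of
  \<open>|l k + t| + |l k - t|\<close>.\<close>

lemma shifted_path_le:
  assumes P: "line P" and k: "axis k R" and y: "P y' = R y'" and z: "P z' = R z'"
  shows "d (P y) (k $ P z) + d (P z) (k $ P y) \<le> 2 * \<bar>y - y'\<bar> + 2 * \<bar>z - z'\<bar> + 2 * max (l k) \<bar>z' - y'\<bar>"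
proof -
  note R = axis_line[OF k] and i = axis_iso[OF k]
  have kyz: "d (P y') (k $ P z') = \<bar>z' + l k - y'\<bar>" "d (P z') (k $ P y') = \<bar>y' + l k - z'\<bar>"
    unfolding y z axis_act[OF k] line_d[OF R] by linarith+
  have ee: "d (P y) (P y') = \<bar>y - y'\<bar>" "d (P z) (P z') = \<bar>z - z'\<bar>"
    "d (k $ P y') (k $ P y) = \<bar>y - y'\<bar>" "d (k $ P z') (k $ P z) = \<bar>z - z'\<bar>"
    unfolding iso_d[OF i] line_d[OF P] by linarith+
  have "d (P y) (k $ P z) \<le> \<bar>y - y'\<bar> + \<bar>z' + l k - y'\<bar> + \<bar>z - z'\<bar>"
    using d_triangle[of "P y" "k $ P z" "P y'"] d_triangle[of "P y'" "k $ P z" "k $ P z'"] kyz ee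
    by linarith
  moreover have "d (P z) (k $ P y) \<le> \<bar>z - z'\<bar> + \<bar>y' + l k - z'\<bar> + \<bar>y - y'\<bar>"
    using d_triangle[of "P z" "k $ P y" "P z'"] d_triangle[of "P z'" "k $ P y" "k $ P y'"] kyz ee
    by linarith
  moreover have "\<bar>z' + l k - y'\<bar> + \<bar>y' + l k - z'\<bar> \<le> 2 * max (l k) \<bar>z' - y'\<bar>"
    using axis_pos[OF k] by (simp add: max_def abs_if)
  moreover have "u + v \<le> 2 * A + 2 * B + 2 * M" if "u \<le> A + X + B" "v \<le> B + Y + A" "X + Y \<le> 2 * M"
    for u v A B X Y M :: int using that by linarith
  ultimately show ?thesis by blast
qed

lemma shifted_path_le_apart:
  assumes k: "axis k R" and P: "line P" and e: "d (P m) (R n) = e"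
  shows "d (P y) (k $ P z) + d (P z) (k $ P y) \<le> 4 * e + 2 * \<bar>y - m\<bar> + 2 * \<bar>z - m\<bar> + 2 * l k"
proof -
  have *: "d (P y) (k $ P z) \<le> 2 * e + \<bar>y - m\<bar> + \<bar>z - m\<bar> + l k" for y z
  proof -
    have "d (R n) (k $ R n) = l k" unfolding axis_act[OF k] line_d[OF axis_line[OF k]] by simp
    moreover have "d (k $ R n) (k $ P m) = e" "d (k $ P m) (k $ P z) = \<bar>z - m\<bar>" "d (P y) (P m) = \<bar>y - m\<bar>"
      unfolding iso_d[OF axis_iso[OF k]] line_d[OF P] using e d_sym
      by (auto simp: abs_minus_commute)
    ultimately show ?thesis
      using e d_triangle[of "P y" "k $ P z" "P m"] d_triangle[of "P m" "k $ P z" "R n"]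
        d_triangle[of "R n" "k $ P z" "k $ R n"] d_triangle[of "k $ R n" "k $ P z" "k $ P m"]
        by linarith
  qed
  have "u + v \<le> 4 * e + 2 * A + 2 * B + 2 * M" if "u \<le> 2 * e + A + B + M" "v \<le> 2 * e + B + A + M"
    for u v A B M :: int using that by linarith
  then show ?thesis using *[of y z] *[of z y] by blast
qed

text \<open>Both \<open>g\<close> and \<open>k\<close> can be split off from \<open>h\<close>, on disjoint or partially overlapping segments of its axis.
  If neither \<open>h - g\<close> nor \<open>- k + h\<close> is an improvement, then \<open>l (h - g)\<close> and \<open>l (h - k)\<close> are so small that
  replacing \<open>h\<close> and \<open>k\<close> by \<open>h - g\<close> and \<open>k - g\<close> is one. This is the only case in which
  \<open>l (h - k)\<close> can be less than \<open>l h - l k\<close>, by cancellation beyond the overlap.\<close>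

lemma two_short_overlaps:
  assumes m: "minimal3 g h k" and h: "axis h P" and g: "axis g S" and k: "axis k R"
    and al: "aligned P S" "aligned P R"
    and s: "S s = P s" "S (s + l g) = P (s + l g)"
    and p: "P p = R p" "P (p + l k) = R (p + l k)"
    and ab: "l g \<le> l h" and cb: "l k \<le> l h"
    and sp: "s \<le> p" "s + l g \<le> p + l k" "p + l k \<le> s + l h" "2 * p + l k \<le> 2 * s + l g + l h"
  shows False
proof -
  note P = axis_line[OF h] and S = axis_line[OF g] and R = axis_line[OF k]
  define a b c where "a = l g" and "b = l h" and "c = l k"
  note abc = a_def[symmetric] b_def[symmetric] c_def[symmetric]
  note s = s[unfolded abc] and p = p[unfolded abc] and ab = ab[unfolded abc] and cb = cb[unfolded abc]
    and sp = sp[unfolded abc]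
  have pos: "0 < a" "0 < b" "0 < c" using axis_pos g h k unfolding a_def b_def c_def by blast+
  have i: "iso g" "iso h" "iso k" using minimal3_iso[OF m] by blast+
  have gP: "g $ P s = P (s + a)" using axis_act[OF g, of s] s by (simp add: abc)
  have kP: "k $ P p = P (p + c)" using axis_act[OF k, of p] p by (simp add: abc)
  have hP: "h $ P x = P (x + b)" for x using axis_act[OF h, of x] by (simp add: abc)
  have ig: "(- g) $ P (s + a) = P s" and ik: "(- k) $ P (p + c) = P p"
    by (simp_all only: act_uminus_cancel gP[symmetric] kP[symmetric])
  have dP: "d (P x) (P y) = \<bar>x - y\<bar>" for x y by (rule line_d[OF P])
  define N Mk Mj where "N = l (h - g - k)" and "Mk = l (h - k)" and "Mj = l (h - g)"
  have isos: "iso (- g)" "iso (- k)" "iso (- h)" using i by auto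
  have hg: "l (h + g) = b + a" unfolding a_def b_def
    by (rule l_plus_aligned[OF h g al(1) s(1)[symmetric]])
  have hk: "l (h + k) = b + c" unfolding c_def b_def by (rule l_plus_aligned[OF h k al(2) p(1)])
  have hgg: "l (h - g - g) \<le> b"
    unfolding b_def by (rule l_minus_minus_le[OF h g, of s])
    (use s ab in \<open>simp_all add: a_def b_def\<close>)
  have hkk: "l (h - k - k) \<le> b"
    unfolding b_def by (rule l_minus_minus_le[OF h k, of p])
    (use p cb in \<open>simp_all add: c_def b_def\<close>)
  \<comment> \<open>\<open>h - k\<close> and \<open>h - g - k\<close> are conjugate to
    \<open>r\<close> and \<open>r - g\<close>, which reduces the comparison of \<open>Mk\<close> and
    \<open>N\<close> to the pair \<open>r\<close>, \<open>g\<close>.\<close>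
  define r where "r = - k + h"
  have ir: "iso r" unfolding r_def using i by simp
  have lr: "l r = Mk" unfolding r_def Mk_def
    by (rule l_rotate[of "- k" h]) (use i in \<open>auto simp only: word_simps iso_uminus\<close>)
  have lrg: "l (r - g) = N" unfolding r_def N_def
    by (rule l_rotate[of "- k" "h - g"])
    (use i in \<open>auto simp only: word_simps iso_uminus iso_plus\<close>)
  have F1: "F (h - g) k = l (h - g + k) + N" unfolding F_def N_def ..
  have Fhk: "F h k = b + c + Mk" unfolding F_def hk Mk_def ..
  have Fhg: "F h g = b + a + Mj" unfolding F_def hg Mj_def ..
  have F2: "F (- k + h) g = l (r + g) + N" unfolding F_def lrg[symmetric] r_def ..
  have single_g: "b + a + (b + c + Mk) \<le> b + (l (h - g + k) + N)"
    using minimal3_single[OF m] hg hgg Fhk F1 by linarith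
  have "minimal3 k h g" using m minimal3_swap12 minimal3_swap23 by blast
  from minimal3_single_left[OF this]
  have single_k: "b + c + (b + a + Mj) \<le> b + (l (r + g) + N)" using hk hkk Fhg F2 by linarith
  have U1: "l (h - g + k) \<le> b + c - a"
  proof -
    \<comment> \<open>The leftmost vertex on the known overlap with \<open>R\<close> that is not
      left of the end of the segment of \<open>g\<close>; reaching it costs no detour, and there
      \<open>k\<close> costs only \<open>c\<close>.\<close>
    define y where "y = max p (s + a)"
    have "P y = R y"
      by (rule line_agree_between[OF P R p]) (use sp pos in \<open>auto simp: y_def\<close>)
    then have "d (P y) (k $ P y) = c" using axis_act[OF k, of y] line_d[OF R] pos by (simp add: abc)
    moreover have "l (h + - g + k) \<le> d (P y) (h $ P s) + d (P s) ((- g) $ P (s + a)) + d (P (s + a)) (k $ P y)"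
      by (rule l_le_path3) (use i in auto)
    moreover have "d (P (s + a)) (k $ P y) \<le> d (P (s + a)) (P y) + d (P y) (k $ P y)"
      by (rule d_triangle)
    ultimately have "l (h + - g + k) \<le> \<bar>y - (s + b)\<bar> + \<bar>s + a - y\<bar> + c"
      unfolding hP ig dP by simp
    moreover have "s + a \<le> y" "y \<le> s + b" using sp pos ab unfolding y_def by linarith+
    ultimately show ?thesis by simp
  qed
  have gPp: "d (g $ P p) (P (s + a)) = p - s"
    unfolding gP[symmetric] iso_d[OF i(1)] dP using sp by simp
  have U2: "l (r + g) \<le> b + a - c"
  proof -
    have "l (- k + h + g) \<le> d (P p) ((- k) $ P (p + c)) + d (P (p + c)) (h $ P s) + d (P s) (g $ P p)"
      by (rule l_le_path3) (use isos i in auto)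
    moreover have "d (P s) (g $ P p) \<le> a + (p - s)"
      using d_triangle[of "P s" "g $ P p" "P (s + a)"] gPp d_sym[of "g $ P p" "P (s + a)"] dP[of s "s + a"] pos
      by linarith
    ultimately have "l (- k + h + g) \<le> \<bar>p + c - (s + b)\<bar> + (a + (p - s))"
      unfolding hP ik dP by simp
    then show ?thesis unfolding r_def using sp by linarith
  qed
  have N1: "Mk + 2 * a \<le> N" using single_g U1 by linarith
  have N2: "Mj + 2 * c \<le> N" using single_k U2 by linarith
  have lg': "l (- g) = a" "l (- k) = c" using i by (simp_all add: abc)
  \<comment> \<open>\<open>N\<close> now exceeds \<open>l r + l g\<close>, so \<open>C r\<close> and
    \<open>C g\<close> are disjoint and the sign of \<open>g\<close> is immaterial. The same happens
    for \<open>h - g\<close> and \<open>k\<close>, and the values \<open>N\<close> can be put back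
    into the inequalities of minimality.\<close>
  have big1: "l r + l (- g) < l (r + - g)" using N1 lrg lr pos lg' by simp
  note apart1 = apart_if_l_plus_large[OF ir isos(1) big1]
  have e1: "l (r + g) = N" using apart1(2) lrg by simp
  have hgk: "l (h - g + - k) = N" unfolding N_def by (simp only: word_simps)
  have big2: "l (h - g) + l (- k) < l (h - g + - k)" using N2 hgk pos lg' Mj_def by linarith
  have e2: "l (h - g + k) = N"
    using apart_if_l_plus_large(2)[OF _ isos(2) big2] i hgk by simp
  have bMk: "Mk + a + b + c \<le> 2 * N" and bMj: "Mj + a + b + c \<le> 2 * N"
    using single_g single_k e1 e2 by linarith+
  \<comment> \<open>\<open>r\<close> carries \<open>P (p + c - b)\<close> to \<open>P p\<close>, so
    \<open>C r\<close> contains the concentric interval \<open>[lo, hi]\<close> of \<open>P\<close>,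
    which has to avoid \<open>[s, s + a]\<close>. If it lies on the left, the bound is immediate. If
    it lies on the right, the last inequality of \<open>sp\<close> is used: it says that the
    midpoint of \<open>[p + c - b, p]\<close> is not to the right of that of
    \<open>[s, s + a]\<close>.\<close>
  have N3: "N \<le> b + a - c - 2 * p + 2 * s"
  proof -
    let ?x = "P (p + c - b)"
    have rx: "r $ ?x = P p" unfolding r_def using hP[of "p + c - b"] ik by simp
    obtain y where y: "y \<in> C r" "d ?x (r $ ?x) = l r + 2 * d ?x y"
      by (rule ex_displacement[OF ir])
    define t where "t = d ?x y"
    have t: "b - c = Mk + 2 * t" using y(2) cb unfolding rx dP lr t_def by linarith
    have xp: "d ?x (P p) = b - c" using cb unfolding dP by linarith
    note ly = C_D[OF y(1)]
    have ryx: "d (r $ y) (P p) = t" unfolding rx[symmetric] iso_d[OF ir] t_def by (rule d_sym)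
    have b1: "d ?x (P p) = d ?x y + d y (P p)" "d y (P p) = Mk + t"
      using d_triangle[of y "P p" "r $ y"] d_triangle[of ?x "P p" y] ryx ly lr t xp unfolding t_def
      by linarith+
    have b2: "d ?x (P p) = d ?x (r $ y) + d (r $ y) (P p)" "d ?x (r $ y) = t + Mk"
      using d_triangle[of ?x "r $ y" y] d_triangle[of ?x "P p" "r $ y"] ryx ly lr t xp
      unfolding t_def by linarith+
    define lo hi where "lo = p + c - b + t" and "hi = p - t"
    have yP: "y = P lo" "r $ y = P hi"
      using line_between[OF P _ b1(1)] line_between[OF P _ b2(1)] cb b2(2) t
      unfolding t_def[symmetric] lo_def hi_def
      by (simp_all add: algebra_simps)
    have lohi: "hi = lo + Mk" using t unfolding lo_def hi_def by linarith
    have CrP: "P x \<in> C r" if "lo \<le> x" "x \<le> hi" for x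
      by (rule C_between[OF ir y(1)])
      (use that in \<open>simp add: yP(2); simp add: yP(1) dP\<close>)
    have CgP: "P x \<in> C g" if "s \<le> x" "x \<le> s + a" for x
    proof -
      have "P x = S x" using line_agree_between[OF P S s(1)[symmetric] s(2)[symmetric] that] .
      then show ?thesis using axis_range[OF g] by simp
    qed
    have Mk0: "0 \<le> Mk" unfolding Mk_def by simp
    have "hi < s \<or> s + a < lo"
    proof (rule ccontr)
      assume "\<not> (hi < s \<or> s + a < lo)"
      then have "P (max lo s) \<in> C r" "P (max lo s) \<in> C g"
        using CrP[of "max lo s"] CgP[of "max lo s"] lohi Mk0 pos by auto
      then show False using apart1(1) i by auto
    qed
    moreover have up: "N \<le> a + Mk + \<bar>u - v\<bar> + \<bar>u - v\<bar>" if u: "s \<le> u" "u \<le> s + a" and v: "lo \<le> v" "v \<le> hi" for u v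
    proof -
      have "l (r + - g) \<le> d (P u) (r $ P u) + d (P u) ((- g) $ P u)" by (rule l_le_path2[OF ir])
      moreover have "d (P u) ((- g) $ P u) = a"
        using C_D[OF CgP[OF u]] d_uminus[OF i(1)] d_sym by (simp add: abc)
      moreover have "d (P u) (r $ P u) \<le> d (P u) (P v) + d (P v) (r $ P v) + d (r $ P v) (r $ P u)"
        using d_triangle[of "P u" "r $ P u" "P v"] d_triangle[of "P v" "r $ P u" "r $ P v"]
        by linarith
      moreover have "d (P v) (r $ P v) = Mk" using C_D[OF CrP[OF v]] lr by simp
      moreover have "l (r + - g) = N" using lrg by simp
      ultimately show ?thesis unfolding iso_d[OF ir] dP abs_minus_commute[of v u] by linarith
    qed
    ultimately show ?thesis
    proof (elim disjE)
      assume "hi < s"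
      then have "N \<le> a + Mk + 2 * s - 2 * hi" using up[of s hi] pos lohi Mk0 by simp
      then show ?thesis using t hi_def by linarith
    next
      assume "s + a < lo"
      then have "N \<le> Mk + 2 * lo - 2 * s - a" using up[of "s + a" lo] pos lohi Mk0 by simp
      then show ?thesis using t sp lo_def by linarith
    qed
  qed
  have gPq: "d (P p) ((- g) $ P (p + c)) \<le> c + 2 * p - 2 * s - a"
  proof -
    have "d (P p) ((- g) $ P (p + c)) = d (g $ P p) (P (p + c))" by (rule d_uminus[OF i(1)])
    also have "\<dots> \<le> (p - s) + (p + c - (s + a))"
      using d_triangle[of "g $ P p" "P (p + c)" "P (s + a)"] gPp dP[of "s + a" "p + c"] sp
      by linarith
    finally show ?thesis by simp
  qed
  have kgg: "l (k - g - g) \<le> c + 2 * p - 2 * s"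
  proof -
    have "l (k + - g + - g) \<le> d (P (p + c)) (k $ P p) + d (P p) ((- g) $ P (s + a)) + d (P (s + a)) ((- g) $ P (p + c))"
      by (rule l_le_path3) (use i in auto)
    moreover have "d (P (s + a)) ((- g) $ P (p + c)) \<le> a + (p + c - (s + a))"
    proof -
      have "P (s + a) \<in> C g" using axis_range[OF g] s by (metis rangeI)
      then have "d (g $ P (s + a)) (P (s + a)) = a" using C_D[of "P (s + a)" g] d_sym
        by (simp add: abc)
      then show ?thesis unfolding d_uminus[OF i(1)]
        using d_triangle[of "g $ P (s + a)" "P (p + c)" "P (s + a)"] dP[of "s + a" "p + c"] sp
        by linarith
    qed
    ultimately have "l (k + - g + - g) \<le> \<bar>p - s\<bar> + (a + (p + c - (s + a)))"
      unfolding kP ig dP by simp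
    then show ?thesis using sp by simp
  qed
  \<comment> \<open>\<open>h - g + k - g\<close> is conjugate to \<open>r + t + t\<close>, whereas
    \<open>r + t\<close> is conjugate to \<open>h - g\<close> and \<open>r + t - t\<close> is
    \<open>r\<close>; thus \<open>l_plus_le_max\<close> bounds the double move by \<open>Mj\<close>
    and \<open>Mk\<close>.\<close>
  define t where "t = - g + k"
  have it: "iso t" unfolding t_def using i by simp
  have lt: "l t \<le> c + 2 * p - 2 * s - a"
  proof -
    have "l (k + - g) \<le> d (P (p + c)) (k $ P p) + d (P p) ((- g) $ P (p + c))"
      by (rule l_le_path2[OF i(3)])
    moreover have "l (k + - g) = l t" unfolding t_def using l_commute[of k "- g"] i by simp
    ultimately show ?thesis using gPq unfolding kP by simp
  qed
  have K: "l (h - g + k - g) = l (r + t + t)"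
    by (rule l_rotate[of "h - g + k - g + k" "- k"])
    (use i in \<open>auto simp only: word_simps r_def t_def iso_uminus iso_plus\<close>) 
  have rt: "l (r + t) = Mj" unfolding Mj_def
    by (rule l_rotate[of "- k" "h - g + k"])
    (use i in \<open>auto simp only: word_simps r_def t_def iso_uminus iso_plus\<close>)
  have "l (r + t + t) \<le> max (l (r + t) + l t) (l (r + t - t))" by (rule l_plus_le_max)
    (use ir it in auto)
  moreover have "r + t - t = r" by (simp only: word_simps)
  ultimately have "l (h - g + k - g) \<le> Mj + l t \<or> l (h - g + k - g) \<le> Mk"
    unfolding K rt using lr by (simp add: le_max_iff_disj)
  moreover have "a + b \<le> 2 * p - 2 * s + l (h - g + k - g)"
    using minimal3_double[OF m] hg hk hgg kgg l_nonneg[of "k + g"] by linarith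
  moreover have "Mj \<le> b + a - 3 * c - 4 * p + 4 * s" "Mk \<le> b + a - 3 * c - 4 * p + 4 * s"
    using bMj bMk N3 by linarith+
  ultimately show False using lt pos sp(1) by (elim disjE) linarith+
qed

text \<open>\<open>g\<close> translates the segment \<open>[s, s + l g]\<close> of the axis \<open>P\<close> of \<open>h\<close>, and the axis of \<open>k\<close> meets
  \<open>P\<close> in \<open>[p, q]\<close>, or in a larger segment if \<open>q - p\<close> is at least \<open>l h\<close>.\<close>

definition long_pair where
  "long_pair g h k S P R s p q \<longleftrightarrow> minimal3 g h k \<and> axis g S \<and> axis h P \<and> axis k R \<and>
     aligned P S \<and> aligned P R \<and> S s = P s \<and> S (s + l g) = P (s + l g) \<and> l g \<le> l h \<and>
     p \<le> q \<and> P p = R p \<and> P q = R q \<and>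
     (q - p < l h \<longrightarrow> P (p - 1) \<noteq> R (p - 1) \<and> P (q + 1) \<noteq> R (q + 1)) \<and>
     (l h < l k \<longrightarrow> q - p < l h)"

lemma aligned_reflect: "aligned P S \<Longrightarrow> aligned (\<lambda>m. P (0 - m)) (\<lambda>m. S (0 - m))"
  unfolding aligned_def by fastforce

lemma long_pair_reflect:
  assumes b: "long_pair g h k S P R s p q"
  shows "long_pair (- g) (- h) (- k) (\<lambda>m. S (0 - m)) (\<lambda>m. P (0 - m)) (\<lambda>m. R (0 - m)) (- s - l g) (- q) (- p)"
proof -
  have i: "iso g" "iso h" "iso k" using b minimal3_iso unfolding long_pair_def by blast+
  have e: "0 - (- s - l g) = s + l g" "0 - (- s - l g + l g) = s" "0 - (- q) = q" "0 - (- p) = p"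
    "0 - (- q - 1) = q + 1" "0 - (- p + 1) = p - 1" "- p - - q = q - p" by simp_all
  from b have "minimal3 (- g) (- h) (- k)" "axis (- g) (\<lambda>m. S (0 - m))" "axis (- h) (\<lambda>m. P (0 - m))"
    "axis (- k) (\<lambda>m. R (0 - m))" "aligned (\<lambda>m. P (0 - m)) (\<lambda>m. S (0 - m))"
    "aligned (\<lambda>m. P (0 - m)) (\<lambda>m. R (0 - m))"
    unfolding long_pair_def by (simp_all only: minimal3_uminus axis_reflect aligned_reflect)
  moreover from b have "S s = P s" "S (s + l g) = P (s + l g)" "l g \<le> l h" "- q \<le> - p" "P p = R p" "P q = R q"
    "q - p < l h \<longrightarrow> P (q + 1) \<noteq> R (q + 1) \<and> P (p - 1) \<noteq> R (p - 1)" "l h < l k \<longrightarrow> q - p < l h"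
    unfolding long_pair_def by auto
  ultimately show ?thesis
    unfolding long_pair_def l_uminus[OF i(1)] l_uminus[OF i(2)] l_uminus[OF i(3)] e by (intro conjI)
qed

text \<open>An overlap that may have been truncated yields only lower bounds. If
  \<open>l k < l h\<close>, they use \<open>l_minus_long_overlap\<close>; if
  \<open>l k = l h\<close>, already \<open>l (h + k)\<close> is large enough.\<close>

lemma long_pair_F:
  assumes b: "long_pair g h k S P R s p q"
  shows "q - p < l h \<Longrightarrow> q - p < l k \<Longrightarrow> F h k = 2 * l h + 2 * l k - 2 * (q - p)"
    and "l h \<le> q - p \<Longrightarrow> 2 * l h \<le> F h k \<and> l k \<le> l h"
    and "l h + l k \<le> F h k"
proof -
  have h: "axis h P" and k: "axis k R" and al: "aligned P R" and p: "P p = R p" and q: "P q = R q" and "p \<le> q"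
    and ends: "q - p < l h \<Longrightarrow> P (p - 1) \<noteq> R (p - 1)" "q - p < l h \<Longrightarrow> P (q + 1) \<noteq> R (q + 1)"
    and max: "l h < l k \<Longrightarrow> q - p < l h"
    using b unfolding long_pair_def by blast+
  have hk: "l (h + k) = l h + l k" by (rule l_plus_aligned[OF h k al p])
  show "l h + l k \<le> F h k" using hk unfolding F_def by simp
  show "F h k = 2 * l h + 2 * l k - 2 * (q - p)" if "q - p < l h" "q - p < l k"
    using l_minus_overlap[OF h k \<open>p \<le> q\<close> p ends(1) q ends(2)] that hk
    unfolding F_def by simp
  show "2 * l h \<le> F h k \<and> l k \<le> l h" if o: "l h \<le> q - p"
  proof
    show kh: "l k \<le> l h" using max o by linarith
    show "2 * l h \<le> F h k"
    proof (cases "l k = l h")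
      case True
      then show ?thesis using hk unfolding F_def by simp
    next
      case False
      then have "l (k - h) = l h - l k"
        by (intro l_minus_long_overlap[OF k h p[symmetric] q[symmetric]]) (use o kh in linarith)+
      then show ?thesis using hk l_minus_commute[of h k] axis_iso h k unfolding F_def by simp
    qed
  qed
qed

text \<open>The overlap with \<open>k\<close> covers the right end of the segment of
  \<open>g\<close>, so the part of \<open>h\<close> retained by \<open>h - g\<close> begins on the
  axis of \<open>k\<close>. If a whole period of \<open>k\<close> fits into the overlap,
  \<open>k\<close> can be split off as well.\<close>

lemma long_pair_ends:
  assumes b: "long_pair g h k S P R s p q" and w: "s < p" "p \<le> s + l g" "s + l g \<le> q"
  shows False
proof -
  have m: "minimal3 g h k" and g: "axis g S" and h: "axis h P" and k: "axis k R"
    and al: "aligned P S" "aligned P R" and s: "S s = P s" "S (s + l g) = P (s + l g)"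
    and ab: "l g \<le> l h" and p: "P p = R p" and q: "P q = R q"
    using b unfolding long_pair_def by blast+
  note P = axis_line[OF h] and R = axis_line[OF k]
  have pos: "0 < l g" "0 < l h" "0 < l k" using axis_pos g h k by blast+
  have PR: "P j = R j" if "p \<le> j" "j \<le> q" for j using line_agree_between[OF P R p q that] .
  \<comment> \<open>\<open>z\<close> marks how far the retained part is followed along the axis of
    \<open>k\<close>; it will be the smaller of \<open>s + l h\<close> and \<open>q\<close>.\<close>
  have S1: "F h k + l g \<le> 2 * \<bar>s + l h - z\<bar> + 2 * max (l k) \<bar>z - (s + l g)\<bar>" if "p \<le> z" "z \<le> q" for z
  proof -
    have "F h k + l g \<le> d (P (s + l g)) (k $ P (s + l h)) + d (P (s + l h)) (k $ P (s + l g))"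
      by (rule shorten_right[OF m h g al(1) s ab])
    also have "\<dots> \<le> 2 * \<bar>s + l g - (s + l g)\<bar> + 2 * \<bar>s + l h - z\<bar> + 2 * max (l k) \<bar>z - (s + l g)\<bar>"
      by (rule shifted_path_le[OF P k]) (use PR w that in auto)
    finally show ?thesis by simp
  qed
  consider "q - p < l h" "q - p < l k" | "l h \<le> q - p" | "l k \<le> q - p" "q - p < l h"
  by linarith
  then show False
  proof cases
    case 1
    then have Fhk: "F h k = 2 * l h + 2 * l k - 2 * (q - p)" using long_pair_F(1)[OF b] by blast
    show False
    proof (cases "s + l h \<le> q")
      case True
      then have "F h k + l g \<le> 2 * l k" using S1[of "s + l h"] w ab 1
        by (simp add: max_def split: if_splits)
      then show False using Fhk 1 pos by simp
    next
      case False
      then have "F h k + l g \<le> 2 * (s + l h - q) + 2 * l k"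
        using S1[of q] w ab 1 by (simp add: max_def split: if_splits)
      then show False using Fhk w pos by simp
    qed
  next
    case 2
    then have Fhk: "2 * l h \<le> F h k" "l k \<le> l h" using long_pair_F(2)[OF b] by blast+
    show False
    proof (cases "s + l h \<le> q")
      case True
      then show False using S1[of "s + l h"] w ab Fhk pos by (simp add: max_def split: if_splits)
    next
      case False
      then show False using 2 w by linarith
    qed
  next
    case 3
    have F3: "l h + l k \<le> F h k" by (rule long_pair_F(3)[OF b])
    have q': "P (p + l k) = R (p + l k)" using PR 3 pos by simp
    consider "p + l k \<le> s + l g" | "s + l g \<le> p + l k" "p + l k \<le> s + l h" | "s + l g \<le> p + l k" "s + l h < p + l k"
      by linarith
    then show False
    proof cases
      case 1
      have "minimal3 k h g" using m minimal3_swap12 minimal3_swap23 by blast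
      moreover have "S j = P j" if "s \<le> j" "j \<le> s + l g" for j
        using line_agree_between[OF axis_line[OF g] P s that] .
      ultimately show False
        using no_common_segment[OF _ h k g al(2,1), of p] p q' 1 w pos 3 by simp
    next
      case 2
      show False by (rule two_short_overlaps[OF m h g k al s p q' ab]) (use 2 3 w pos in linarith)+
    next
      case c: 3
      then have "F h k + l g \<le> 2 * l k"
        using S1[of "s + l h"] 3 w ab pos by (simp add: max_def split: if_splits)
      then show False using F3 3 pos by linarith
    qed
  qed
qed

text \<open>The part retained by \<open>h - g\<close> contains the whole overlap with
  \<open>k\<close>, so its bound for \<open>F h k + l g\<close> is \<open>F h k - 2 * l g\<close>
  unless a period of \<open>k\<close> fits into the overlap. In that case the assumption on the gaps
  supplies the midpoint condition of \<open>two_short_overlaps\<close>.\<close>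

lemma long_pair_beyond:
  assumes b: "long_pair g h k S P R s p q" and w: "s + l g < p" "q < s + l h" "p - (s + l g) \<le> s + l h - q"
  shows False
proof -
  have m: "minimal3 g h k" and g: "axis g S" and h: "axis h P" and k: "axis k R"
    and al: "aligned P S" "aligned P R" and s: "S s = P s" "S (s + l g) = P (s + l g)"
    and ab: "l g \<le> l h" and p: "P p = R p" and q: "P q = R q" and pq: "p \<le> q"
    using b unfolding long_pair_def by blast+
  note P = axis_line[OF h] and R = axis_line[OF k]
  have pos: "0 < l g" "0 < l h" "0 < l k" using axis_pos g h k by blast+
  show False
  proof (cases "l k \<le> q - p")
    case True
    have q': "P (p + l k) = R (p + l k)" by (rule line_agree_between[OF P R p q])
      (use True pos in auto)
    show False by (rule two_short_overlaps[OF m h g k al s p q' ab]) (use True w pos in linarith)+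
  next
    case False
    have "F h k + l g \<le> d (P (s + l g)) (k $ P (s + l h)) + d (P (s + l h)) (k $ P (s + l g))"
      by (rule shorten_right[OF m h g al(1) s ab])
    also have "\<dots> \<le> 2 * \<bar>s + l g - p\<bar> + 2 * \<bar>s + l h - q\<bar> + 2 * max (l k) \<bar>q - p\<bar>"
      by (rule shifted_path_le[OF P k p q])
    also have "\<dots> = 2 * (p - (s + l g)) + 2 * (s + l h - q) + 2 * l k" using w pq False by simp
    finally show False using long_pair_F(1)[OF b] w pos False by simp
  qed
qed

text \<open>Dividing on the right is penalized by the distance of the overlap from the right end of
  the segment, dividing on the left by that from the left end. In the sum of the two inequalities
  the position cancels and \<open>2 * l g <= 0\<close> remains.\<close>

lemma long_pair_inside:
  assumes b: "long_pair g h k S P R s p q" and w: "s \<le> p" "q \<le> s + l g" "q - p < l g"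
  shows False
proof -
  have m: "minimal3 g h k" and g: "axis g S" and h: "axis h P" and k: "axis k R"
    and al: "aligned P S" "aligned P R" and s: "S s = P s" "S (s + l g) = P (s + l g)"
    and ab: "l g \<le> l h" and p: "P p = R p" and q: "P q = R q" and pq: "p \<le> q"
    using b unfolding long_pair_def by blast+
  note P = axis_line[OF h] and R = axis_line[OF k]
  have pos: "0 < l g" "0 < l h" "0 < l k" using axis_pos g h k by blast+
  show False
  proof (cases "l k \<le> q - p")
    case True
    have q': "P (p + l k) = R (p + l k)" by (rule line_agree_between[OF P R p q])
      (use True pos in auto)
    have "minimal3 k h g" using m minimal3_swap12 minimal3_swap23 by blast
    moreover have "S j = P j" if "s \<le> j" "j \<le> s + l g" for j
      using line_agree_between[OF axis_line[OF g] P s that] .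
    ultimately show False
      using no_common_segment[OF _ h k g al(2,1), of p] p q' True w pos ab by simp
  next
    case False
    have "F h k + l g \<le> d (P (s + l g)) (k $ P (s + l h)) + d (P (s + l h)) (k $ P (s + l g))"
      by (rule shorten_right[OF m h g al(1) s ab])
    also have "\<dots> \<le> 2 * \<bar>s + l g - q\<bar> + 2 * \<bar>s + l h - q\<bar> + 2 * max (l k) \<bar>q - q\<bar>"
      by (rule shifted_path_le[OF P k q q])
    also have "\<dots> = 2 * (s + l g - q) + 2 * (s + l h - q) + 2 * l k" using w ab pos by simp
    finally have 1: "F h k + l g \<le> 2 * (s + l g - q) + 2 * (s + l h - q) + 2 * l k" .
    have "F h k + l g \<le> d (P s) (k $ P (s + l g - l h)) + d (P (s + l g - l h)) (k $ P s)"
      by (rule shorten_left[OF m h g al(1) s ab])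
    also have "\<dots> \<le> 2 * \<bar>s - p\<bar> + 2 * \<bar>s + l g - l h - p\<bar> + 2 * max (l k) \<bar>p - p\<bar>"
      by (rule shifted_path_le[OF P k p p])
    also have "\<dots> = 2 * (p - s) + 2 * (p - (s + l g - l h)) + 2 * l k" using w ab pos by simp
    finally have 2: "F h k + l g \<le> 2 * (p - s) + 2 * (p - (s + l g - l h)) + 2 * l k" .
    have "F h k = 2 * l h + 2 * l k - 2 * (q - p)" using long_pair_F(1)[OF b] w ab False by simp
    then show False using 1 2 w pos by simp
  qed
qed

text \<open>An overlap may be infinite, so it is cut to a window of radius \<open>N\<close> around
  \<open>z\<close>. If the result is shorter than \<open>N\<close>, then \<open>p - 1\<close> and
  \<open>q + 1\<close> are still in the window and hence outside \<open>A\<close>.\<close>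

lemma interval_truncate:
  fixes A :: "int set"
  assumes z: "z \<in> A" and N: "0 \<le> N"
  obtains p q where "p \<in> A" "q \<in> A" "p \<le> z" "z \<le> q"
    "q - p < N \<longrightarrow> p - 1 \<notin> A \<and> q + 1 \<notin> A"
proof -
  define B where "B = A \<inter> {z - N..z + N}"
  have B: "finite B" "z \<in> B" unfolding B_def using z N by auto
  define p q where "p = Min B" and "q = Max B"
  have pq: "p \<in> B" "q \<in> B" "p \<le> z" "z \<le> q"
    unfolding p_def q_def using B by (auto intro: Min_in Max_in)
  have "p - 1 \<notin> A" if "q - p < N"
  proof
    assume "p - 1 \<in> A"
    then have "p - 1 \<in> B" using that pq unfolding B_def by auto
    then have "p \<le> p - 1" unfolding p_def using B by (intro Min_le) auto
    then show False by simp
  qed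
  moreover have "q + 1 \<notin> A" if "q - p < N"
  proof
    assume "q + 1 \<in> A"
    then have "q + 1 \<in> B" using that pq unfolding B_def by auto
    then have "q + 1 \<le> q" unfolding q_def using B by (intro Max_ge) auto
    then show False by simp
  qed
  ultimately show ?thesis using that pq unfolding B_def by blast
qed

lemma near_reflectI:
  assumes "m \<in> near P Q" shows "- m \<in> near (\<lambda>m. P (0 - m)) (\<lambda>m. Q (0 - m))"
proof -
  obtain n where n: "\<And>m' n'. d (P m) (Q n) \<le> d (P m') (Q n')" using assms
    unfolding near_def by blast
  have "d (P (0 - (- m))) (Q (0 - (- n))) \<le> d (P (0 - m')) (Q (0 - n'))" for m' n'
    using n[of "0 - m'" "0 - n'"] by simp
  then show ?thesis unfolding near_def by blast
qed

lemma near_reflectD: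
  assumes "m \<in> near (\<lambda>m. P (0 - m)) (\<lambda>m. Q (0 - m))" shows "- m \<in> near P Q"
  using near_reflectI[OF assms] by simp

lemma range_reflect: "range (\<lambda>m. Q (0 - m :: int)) = range Q"
proof
  have "Q m \<in> range (\<lambda>m. Q (0 - m))" for m by (rule image_eqI[of _ _ "- m"]) auto
  then show "range Q \<subseteq> range (\<lambda>m. Q (0 - m))" by blast
qed auto

lemma near_aligned:
  assumes al: "aligned P R" and a: "P a = R a" shows "near P R = {m. P m = R m}"
proof -
  have "P m = R m" if "P m = R n" for m n using al that unfolding aligned_def by metis
  then have "{m. P m \<in> range R} = {m. P m = R m}" by auto
  then show ?thesis using near_meet[of P a R a] a by simp
qed

lemma near_bounded:
  assumes m: "minimal3 g h k" and h: "axis h P" and g: "axis g S" and k: "axis k R"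
    and disj: "near P S \<inter> near P R = {}" and "j \<in> near P S" "c \<in> near P R"
  shows "\<bar>c - j\<bar> < l h"
proof -
  have m': "minimal3 h g k" and m'': "minimal3 h k g"
    using m minimal3_swap12 minimal3_swap23 by blast+
  have "c - j < l h" using near_intersect[OF m' h g k assms(6,7)] disj by linarith
  moreover have "j - c < l h" using near_intersect[OF m'' h k g assms(7,6)] disj
    by (metis Int_commute linorder_not_less)
  ultimately show ?thesis by linarith
qed

text \<open>The segment of \<open>g\<close> is slid as close as possible to the projection of the
  axis of \<open>k\<close>. Conjugation by \<open>h\<close> then gives, by
  \<open>gap_le_shifted_gap\<close>, the comparison of the gaps that \<open>long_pair_beyond\<close>
  expects.\<close>

lemma no_long_pair_right:
  assumes m: "minimal3 g h k" and h: "axis h P" and g: "axis g S" and k: "axis k R"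
    and al: "aligned P S" and s0: "S s0 = P s0" "S (s0 + l g) = P (s0 + l g)" and ab: "l g \<le> l h"
    and meet: "aligned P R \<and> P a = R a \<or> range P \<inter> range R = {}"
    and disj: "near P S \<inter> near P R = {}" and c0: "c0 \<in> near P R" "s0 < c0"
  shows False
proof -
  note P = axis_line[OF h] and R = axis_line[OF k] and S = axis_line[OF g]
  have pos: "0 < l g" "0 < l h" "0 < l k" using axis_pos g h k by blast+
  have J: "near P S = {m. P m = S m}" by (rule near_aligned[OF al s0(1)[symmetric]])
  have s0J: "s0 \<in> near P S" "s0 + l g \<in> near P S" unfolding J using s0 by auto
  note bnd = near_bounded[OF m h g k disj]
  note cJ = near_convex[OF P S] and cK = near_convex[OF P R]
  have finJ: "finite (near P S)"
    by (rule finite_subset[of _ "{c0 - l h..c0 + l h}"]) (use bnd[OF _ c0(1)] in fastforce)+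
  have finK: "finite (near P R)"
    by (rule finite_subset[of _ "{s0 - l h..s0 + l h}"]) (use bnd[OF s0J(1)] in fastforce)+
  define j1 p q where "j1 = Max (near P S)" and "p = Min (near P R)" and "q = Max (near P R)"
  have j1: "j1 \<in> near P S" "s0 + l g \<le> j1"
    unfolding j1_def using finJ s0J by (auto intro: Max_in)
  have pq: "p \<in> near P R" "q \<in> near P R" "p \<le> c0" "c0 \<le> q"
    unfolding p_def q_def using finK c0 by (auto intro: Min_in Max_in)
  have "s0 < p"
  proof (rule ccontr)
    assume "\<not> s0 < p"
    then have "s0 \<in> near P R" using cK[of p c0 s0] pq c0 by linarith
    then show False using s0J disj by blast
  qed
  then have j1p: "j1 < p"
  proof (rule_tac ccontr)
    assume "\<not> j1 < p"
    then have "p \<in> near P S" using cJ[of s0 j1 p] j1 s0J \<open>s0 < p\<close> by linarith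
    then show False using pq disj by blast
  qed
  define s where "s = j1 - l g"
  have sJ: "s \<in> near P S" using cJ[of s0 j1 s] j1 s0J pos unfolding s_def by linarith
  have s: "S s = P s" "S (s + l g) = P (s + l g)" using sJ j1(1) unfolding J s_def by auto
  have qs: "q < s + l h" using bnd[OF sJ pq(2)] by linarith
  have gap: "p - (s + l g) \<le> s + l h - q"
  proof -
    have "minimal3 h g k" using m minimal3_swap12 by blast
    from gap_le_shifted_gap[OF this h g k disj sJ pq(2)]
    obtain j' c' where jc: "j' \<in> near P S" "c' \<in> near P R" "\<bar>c' - j'\<bar> \<le> \<bar>q - s - l h\<bar>" by blast
    have "j' \<le> j1" "p \<le> c'" unfolding j1_def p_def using finJ finK jc by auto
    then show ?thesis using jc j1p qs unfolding s_def by linarith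
  qed
  show False using meet
  proof
    assume al2: "aligned P R \<and> P a = R a"
    then have K: "near P R = {m. P m = R m}" using near_aligned by blast
    have ends: "P (p - 1) \<noteq> R (p - 1)" "P (q + 1) \<noteq> R (q + 1)"
    proof -
      have "p - 1 \<notin> near P R" unfolding p_def
        using finK Min_le[of "near P R" "Min (near P R) - 1"] by auto
      moreover have "q + 1 \<notin> near P R" unfolding q_def
        using finK Max_ge[of "near P R" "Max (near P R) + 1"] by auto
      ultimately show "P (p - 1) \<noteq> R (p - 1)" "P (q + 1) \<noteq> R (q + 1)" unfolding K
        by auto
    qed
    have "P p = R p" "P q = R q" using pq unfolding K by auto
    then have "long_pair g h k S P R s p q"
      unfolding long_pair_def using m g h k al al2 s ab ends pq j1p qs pos(1) unfolding s_def
      by auto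
    then show False by (rule long_pair_beyond) (use j1p qs gap in \<open>auto simp: s_def\<close>)
  next
    assume ap: "range P \<inter> range R = {}"
    show False
    proof (rule near_cases[OF P R])
      fix m0 n0 e assume a: "0 < e" "near P R = {m0}" "\<And>m n. d (P m) (R n) = \<bar>m - m0\<bar> + e + \<bar>n - n0\<bar>"
      have m0: "p = m0" "q = m0" using pq a(2) by auto
      have e: "d (P m0) (R n0) = e" using a(3) by simp
      have "e \<le> d (P m) (R n)" for m n using a(3)[of m n] by linarith
      then obtain m n where "F h k = 2 * l h + 2 * l k + 4 * d (P m) (R n)"
        using l_pm_apart[OF h k _ a(1)] by blast
      then have "2 * l h + 2 * l k + 4 * e \<le> F h k" using a(3)[of m n] by linarith
      moreover have "F h k + l g \<le> d (P (s + l g)) (k $ P (s + l h)) + d (P (s + l h)) (k $ P (s + l g))"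
        by (rule shorten_right[OF m h g al(1) s ab])
      moreover have "d (P (s + l g)) (k $ P (s + l h)) + d (P (s + l h)) (k $ P (s + l g))
          \<le> 4 * e + 2 * \<bar>s + l g - m0\<bar> + 2 * \<bar>s + l h - m0\<bar> + 2 * l k"
        by (rule shifted_path_le_apart[OF k P e])
      moreover have "2 * \<bar>s + l g - m0\<bar> + 2 * \<bar>s + l h - m0\<bar> = 2 * l h - 2 * l g"
        using j1p qs unfolding m0 s_def by simp
      ultimately show False using pos by linarith
    next
      fix a b assume "P a = R b" then show False using ap by auto
    qed
  qed
qed

text \<open>Disjoint projections reduce to \<open>no_long_pair_right\<close>, after reversing all
  axes if necessary. If the projections intersect, the segment of \<open>g\<close> may slide within
  \<open>[j0, j1]\<close>, and a suitable position is selected.\<close>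

lemma no_long_pair_aux:
  assumes m: "minimal3 g h k" and h: "axis h P" and g: "axis g S" and k: "axis k R"
    and al: "aligned P S" and s0: "S s0 = P s0" "S (s0 + l g) = P (s0 + l g)" and ab: "l g \<le> l h"
    and meet: "aligned P R \<and> P a = R a \<or> range P \<inter> range R = {}"
    and max: "\<And>x y. l h < l k \<Longrightarrow> P x \<in> range R \<Longrightarrow> P y \<in> range R \<Longrightarrow> y - x < l h"
  shows False
proof (cases "near P S \<inter> near P R = {}")
  case True
  obtain c0 where c0: "c0 \<in> near P R" using near_nonempty[OF axis_line[OF h] axis_line[OF k]]
    by blast
  have J: "near P S = {m. P m = S m}" by (rule near_aligned[OF al s0(1)[symmetric]])
  have s0J: "s0 \<in> near P S" "s0 + l g \<in> near P S" unfolding J using s0 by auto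
  show False
  proof (cases "s0 < c0")
    case r: True
    show False by (rule no_long_pair_right[OF m h g k al s0 ab meet True c0 r])
  next
    case False
    have i: "iso g" "iso h" "iso k" using minimal3_iso[OF m] by blast+
    have e: "l (- g) = l g" "l (- h) = l h" using i by simp_all
    have e2: "0 - (- s0 - l g) = s0 + l g" "0 - (- s0 - l g + l g) = s0" "0 - (- a) = a" by simp_all
    have ne: "c0 \<noteq> s0" using c0 s0J True by blast
    show False
    proof (rule no_long_pair_right[OF minimal3_uminus[OF m] axis_reflect[OF h, of 0] axis_reflect[OF g, of 0] axis_reflect[OF k, of 0]
          aligned_reflect[OF al], of "- s0 - l g" "- a" "- c0", unfolded e e2 range_reflect[of P] range_reflect[of R]])
      show "aligned (\<lambda>m. P (0 - m)) (\<lambda>m. R (0 - m)) \<and> P a = R a \<or> range P \<inter> range R = {}"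
        using meet aligned_reflect[of P R] by blast
      show "near (\<lambda>m. P (0 - m)) (\<lambda>m. S (0 - m)) \<inter> near (\<lambda>m. P (0 - m)) (\<lambda>m. R (0 - m)) = {}"
        using True near_reflectD[of _ P S] near_reflectD[of _ P R] by blast
      show "- c0 \<in> near (\<lambda>m. P (0 - m)) (\<lambda>m. R (0 - m))"
        using near_reflectI[OF c0] .
      show "- s0 - l g < - c0" using False ne axis_pos[OF g] by linarith
    qed (use s0 ab in auto)
  qed
next
  case False
  note P = axis_line[OF h] and R = axis_line[OF k] and S = axis_line[OF g]
  have pos: "0 < l g" "0 < l h" "0 < l k" using axis_pos g h k by blast+
  obtain z where z: "z \<in> near P S" "z \<in> near P R" using False by blast
  have J: "near P S = {m. P m = S m}" by (rule near_aligned[OF al s0(1)[symmetric]])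
  have s0J: "s0 \<in> near P S" "s0 + l g \<in> near P S" unfolding J using s0 by auto
  note cJ = near_convex[OF P S] and cK = near_convex[OF P R]
  define j0 j1 where "j0 = min z s0" and "j1 = max z (s0 + l g)"
  have j: "j0 \<in> near P S" "j1 \<in> near P S" "j0 \<le> z" "z \<le> j1" "j0 + l g \<le> j1"
    using z s0J unfolding j0_def j1_def by (auto simp: min_def max_def)
  have S: "S s = P s" "S (s + l g) = P (s + l g)" if "j0 \<le> s" "s + l g \<le> j1" for s
    using cJ[OF j(1,2), of s] cJ[OF j(1,2), of "s + l g"] that pos unfolding J by auto
  show False using meet
  proof
    assume ap: "range P \<inter> range R = {}"
    show False
    proof (rule near_cases[OF P R])
      fix m0 n0 e assume a: "0 < e" "near P R = {m0}" "\<And>m n. d (P m) (R n) = \<bar>m - m0\<bar> + e + \<bar>n - n0\<bar>"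
      have m0: "z = m0" using z a(2) by auto
      \<comment> \<open>The segment is slid so that it contains \<open>z\<close>. Its exact position
        cancels when the inequalities for both sides are added.\<close>
      define s where "s = max j0 (z - l g)"
      have w: "j0 \<le> s" "s + l g \<le> j1" "s \<le> z" "z \<le> s + l g" using j pos
        unfolding s_def by linarith+
      note s = S[OF w(1,2)]
      have e: "d (P z) (R n0) = e" using a(3) m0 by simp
      have "e \<le> d (P m) (R n)" for m n using a(3)[of m n] by linarith
      then obtain m' n where "F h k = 2 * l h + 2 * l k + 4 * d (P m') (R n)"
        using l_pm_apart[OF h k _ a(1)] by blast
      then have Fhk: "2 * l h + 2 * l k + 4 * e \<le> F h k" using a(3)[of m' n] by linarith
      have "F h k + l g \<le> 4 * e + 2 * \<bar>s + l g - z\<bar> + 2 * \<bar>s + l h - z\<bar> + 2 * l k"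
        using shorten_right[OF m h g al(1) s ab] shifted_path_le_apart[OF k P e, of "s + l g" "s + l h"] by linarith
      moreover have "F h k + l g \<le> 4 * e + 2 * \<bar>s - z\<bar> + 2 * \<bar>s + l g - l h - z\<bar> + 2 * l k"
        using shorten_left[OF m h g al(1) s ab] shifted_path_le_apart[OF k P e, of s "s + l g - l h"] by linarith
      ultimately show False using Fhk w ab pos by simp
    next
      fix a b assume "P a = R b" then show False using ap by auto
    qed
  next
    assume al2: "aligned P R \<and> P a = R a"
    then have K: "near P R = {m. P m = R m}" using near_aligned by blast
    obtain p q where pq: "p \<in> near P R" "q \<in> near P R" "p \<le> z" "z \<le> q"
      "q - p < l h \<longrightarrow> p - 1 \<notin> near P R \<and> q + 1 \<notin> near P R"
      by (rule interval_truncate[OF z(2) l_nonneg[of h]])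
    have lp: "long_pair g h k S P R s p q" if "j0 \<le> s" "s + l g \<le> j1" for s
    proof -
      have "q - p < l h" if "l h < l k" using max[OF that, of p q] pq unfolding K by auto
      then show ?thesis unfolding long_pair_def using m g h k al al2 S[OF that] ab pq unfolding K
        by auto
    qed
    \<comment> \<open>In (a) and (b) the overlap with \<open>k\<close> covers exactly one end of an
      extreme position of the segment; in (c) all three axes share a segment of length
      \<open>l g\<close>; in (d) the segment can be slid over the whole overlap.\<close>
    consider (a) "j1 - l g < p" "j1 \<le> q" | (b) "q < j0 + l g" "p \<le> j0"
      | (c) "p \<le> j1 - l g \<or> q < j1" "j0 + l g \<le> q \<or> j0 < p" "l g \<le> q - p"
      | (d) "p \<le> j1 - l g \<or> q < j1" "j0 + l g \<le> q \<or> j0 < p" "q - p < l g"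
      by linarith
    then show False
    proof cases
      case a
      show False by (rule long_pair_ends[OF lp[of "j1 - l g"]]) (use a j pq in linarith)+
    next
      case b
      have i: "iso g" using minimal3_iso[OF m] by blast
      show False
        by (rule long_pair_ends[OF long_pair_reflect[OF lp[of j0]], unfolded l_uminus[OF i]])
           (use b j pq in linarith)+
    next
      case c
      define s where "s = max p j0"
      have w: "j0 \<le> s" "s + l g \<le> j1" "p \<le> s" "s + l g \<le> q" using c j pq
        unfolding s_def by linarith+
      have PR: "R x = P x" if "p \<le> x" "x \<le> q" for x using cK[OF pq(1,2) that] unfolding K
        by simp
      have PS: "S x = P x" if "j0 \<le> x" "x \<le> j1" for x using cJ[OF j(1,2) that] unfolding J
        by simp
      show False
      proof (cases "l g \<le> l k")
        case True
        show False
          by (rule no_common_segment[OF m h g k al conjunct1[OF al2], of s])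
          (use PR PS w pos ab True in auto)
      next
        case False
        have "minimal3 k h g" using m minimal3_swap12 minimal3_swap23 by blast
        then show False
          by (rule no_common_segment[OF _ h k g conjunct1[OF al2] al, of s])
          (use PR PS w pos ab False in auto)
      qed
    next
      case d
      define s where "s = max j0 (q - l g)"
      have w: "j0 \<le> s" "s + l g \<le> j1" "s \<le> p" "q \<le> s + l g" using d j pq
        unfolding s_def by linarith+
      show False by (rule long_pair_inside[OF lp[OF w(1,2)] w(3,4) d(3)])
    qed
  qed
qed

text \<open>By convexity two such vertices make the axes share a full period of the isometry with
  the smaller translation length.\<close>

definition overlap :: "'v bijection \<Rightarrow> 'v bijection \<Rightarrow> bool" where
  "overlap g h \<longleftrightarrow> (\<exists>x y. {x, y} \<subseteq> C g \<inter> C h \<and> min (l g) (l h) \<le> d x y)"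

lemma overlap_sym: "overlap g h \<Longrightarrow> overlap h g"
  unfolding overlap_def by (metis Int_commute min.commute)

lemma overlap_aligned:
  assumes g: "axis g S" and h: "axis h P" and ov: "overlap g h" and le: "l g \<le> l h"
  obtains g' S' s where "g' = g \<or> g' = - g" "axis g' S'" "aligned P S'" "S' s = P s" "S' (s + l g) = P (s + l g)"
proof -
  note P = axis_line[OF h]
  obtain x y where xy: "x \<in> C g" "x \<in> C h" "y \<in> C g" "y \<in> C h" "l g \<le> d x y"
    using ov le unfolding overlap_def by auto
  obtain a b where ab: "x = P a" "y = P b" using xy axis_range[OF h] by auto
  obtain c where c: "P a = S c" using xy ab axis_range[OF g] by auto
  obtain g' S' where S': "g' = g \<or> g' = - g" "axis g' S'" "range S' = range S" "aligned P S'" "P a = S' a"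
    using ex_aligned[OF P g c] by blast
  have "P b \<in> range S'" using xy ab axis_range[OF g] S' by auto
  then have b: "P b = S' b" using S'(4) unfolding aligned_def by auto
  have *: "S' j = P j" if "min a b \<le> j" "j \<le> max a b" for j
    using line_agree_between[OF P axis_line[OF S'(2)], of a b j] line_agree_between[OF P axis_line[OF S'(2)], of b a j]
      S'(5) b that by (cases "a \<le> b") auto
  have "l g \<le> \<bar>a - b\<bar>" using xy(5) unfolding ab line_d[OF P] .
  then have "min a b + l g \<le> max a b" by linarith
  then have "S' (min a b) = P (min a b)" "S' (min a b + l g) = P (min a b + l g)"
    using axis_pos[OF g] by (intro *; linarith)+
  then show ?thesis by (rule that[OF S'(1,2,4)])
qed

text \<open>The last assumption selects, among the pairs with a long overlap, one with maximal \<open>l h\<close>. It excludes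
  the case that the axis of \<open>k\<close> overlaps that of \<open>h\<close> in length exactly \<open>l h < l k\<close>.\<close>

lemma no_overlap_aux:
  assumes m: "minimal3 g h k" and ax: "axis g S" "axis h P" "axis k R"
    and ov: "overlap g h" and le: "l g \<le> l h" and max: "l h < l k \<Longrightarrow> \<not> overlap h k"
  shows False
proof -
  note P = axis_line[OF ax(2)]
  obtain g' S' s where S': "g' = g \<or> g' = - g" "axis g' S'" "aligned P S'" "S' s = P s" "S' (s + l g) = P (s + l g)"
    using overlap_aligned[OF ax(1,2) ov le] by blast
  have lg: "l g' = l g" using S'(1) axis_iso[OF ax(1)] by auto
  have m': "minimal3 g' h k" using S'(1) m minimal3_uminus1 by blast
  have mx: "y - x < l h" if "l h < l k" "P x \<in> range R" "P y \<in> range R" for x y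
  proof (rule ccontr)
    assume "\<not> y - x < l h"
    then have "min (l h) (l k) \<le> d (P x) (P y)" unfolding line_d[OF P] using that(1) by linarith
    then have "overlap h k" unfolding overlap_def axis_range[OF ax(2)] axis_range[OF ax(3)]
      using that(2,3) by blast
    then show False using max that by blast
  qed
  show False
  proof (cases "range P \<inter> range R = {}")
    case True
    show False
      by (rule no_long_pair_aux[OF m' ax(2) S'(2) ax(3) S'(3,4), unfolded lg, OF S'(5) le _ mx])
      (use True in auto)
  next
    case False
    then obtain a b where "P a = R b" by auto
    from ex_aligned[OF P ax(3) this] obtain k' R' where R': "k' = k \<or> k' = - k" "axis k' R'" "range R' = range R"
      "aligned P R'" "P a = R' a" by blast
    have m'': "minimal3 g' h k'" using R'(1) m' minimal3_uminus3 by blast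
    have lk: "l k' = l k" using R'(1) axis_iso[OF ax(3)] by auto
    show False
      by (rule no_long_pair_aux[OF m'' ax(2) S'(2) R'(2) S'(3,4), unfolded lg lk R'(3), OF S'(5) le _ mx]) (use R' in auto)
  qed
qed

theorem no_overlap:
  assumes m: "minimal3 g h k" and ax: "axis g S" "axis h P" "axis k R"
  shows "\<not> overlap g h" "\<not> overlap g k" "\<not> overlap h k"
proof -
  have m2: "minimal3 g k h" "minimal3 h g k" "minimal3 h k g" "minimal3 k g h" "minimal3 k h g"
    using m minimal3_swap12 minimal3_swap23 by blast+
  \<comment> \<open>A pair that fails the maximality condition leads to another overlapping pair
    whose longer member is the third isometry. That pair satisfies the condition, so the six
    orderings suffice.\<close>
  note A = no_overlap_aux[OF m ax(1,2,3)] no_overlap_aux[OF m2(1) ax(1,3,2)] no_overlap_aux[OF m2(2) ax(2,1,3)]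
    no_overlap_aux[OF m2(3) ax(2,3,1)] no_overlap_aux[OF m2(4) ax(3,1,2)] no_overlap_aux[OF m2(5) ax(3,2,1)]
  show "\<not> overlap g h" "\<not> overlap g k" "\<not> overlap h k"
    using A overlap_sym[of g h] overlap_sym[of g k] overlap_sym[of h k] overlap_sym[of h g] overlap_sym[of k g] overlap_sym[of k h]
    by (smt (verit))+
qed

end

section \<open>Projections of the axes\<close>

context stree
begin

lemma near_small:
  assumes g: "axis g P" and h: "axis h Q" and no: "\<not> overlap g h" and m: "m \<in> near P Q" "m' \<in> near P Q"
  shows "\<bar>m - m'\<bar> < l g" "P m \<in> range Q \<Longrightarrow> P m' \<in> range Q \<Longrightarrow> \<bar>m - m'\<bar> < l h"
proof -
  note P = axis_line[OF g]
  have *: "\<bar>m - m'\<bar> < min (l g) (l h)" if "P m \<in> range Q" "P m' \<in> range Q"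
  proof (rule ccontr)
    assume "\<not> \<bar>m - m'\<bar> < min (l g) (l h)"
    then have "min (l g) (l h) \<le> d (P m) (P m')" unfolding line_d[OF P] by linarith
    then show False using no that unfolding overlap_def axis_range[OF g] axis_range[OF h] by blast
  qed
  then show "P m \<in> range Q \<Longrightarrow> P m' \<in> range Q \<Longrightarrow> \<bar>m - m'\<bar> < l h" by simp
  show "\<bar>m - m'\<bar> < l g"
  proof (rule near_cases[OF P axis_line[OF h]])
    fix m0 assume "near P Q = {m0}"
    then show ?thesis using m axis_pos[OF g] by simp
  next
    assume "near P Q = {m. P m \<in> range Q}"
    then show ?thesis using m * by auto
  qed
qed

text \<open>The double move bounds the sum of both overlap lengths and \<open>j1 - p\<close> by
  \<open>l g\<close>. But the two overlap lengths already add up to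
  \<open>q - j0 + (j1 - p)\<close>, which exceeds \<open>l g\<close>.\<close>

lemma no_wide_overlap:
  assumes m: "minimal3 g h k" and g: "axis g P" and h: "axis h Q" and k: "axis k R"
    and al: "aligned P Q" "aligned P R"
    and Q: "P j0 = Q j0" "P j1 = Q j1" and R: "P p = R p" "P q = R q"
    and u: "j1 - j0 < l g" "j1 - j0 < l h" and v: "q - p < l g" "q - p < l k"
    and wide: "l g \<le> q - j0" "p < j1"
  shows False
proof -
  note P = axis_line[OF g] and i = minimal3_iso[OF m]
  have ord: "j0 < p" "j1 < q" using u v wide by linarith+
  let ?a = "l g"
  have PQ: "P x = Q x" if "j0 \<le> x" "x \<le> j1" for x
    using line_agree_between[OF P axis_line[OF h] Q that] .
  have PR: "P x = R x" if "p \<le> x" "x \<le> q" for x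
    using line_agree_between[OF P axis_line[OF k] R that] .
  have hg: "l (h + g) = l h + ?a"
    by (rule l_plus_aligned[OF h g aligned_sym[OF al(1)] Q(1)[symmetric]])
  have kg: "l (k + g) = l k + ?a"
    by (rule l_plus_aligned[OF k g aligned_sym[OF al(2)] R(1)[symmetric]])
  have QR: "Q p = R p" "Q j1 = R j1" using PQ[of p] PR[of p] PQ[of j1] PR[of j1] ord wide by auto
  have "aligned Q R" by (rule aligned_if_agree[OF axis_line[OF h] axis_line[OF k] QR])
    (use wide in simp)
  then have hk: "l (h + k) = l h + l k" by (rule l_plus_aligned[OF h k _ QR(1)])
  have ig: "(- g) $ P x = P (x - ?a)" for x by (rule axis_act_uminus[OF g])
  have hP: "d (P j1) (h $ P j0) = l h - (j1 - j0)"
    unfolding Q axis_act[OF h] line_d[OF axis_line[OF h]] using u by simp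
  have kP: "d (P q) (k $ P p) = l k - (q - p)"
    unfolding R axis_act[OF k] line_d[OF axis_line[OF k]] using v by simp
  have "l (h + - g + - g) \<le> d (P j1) (h $ P j0) + d (P j0) ((- g) $ P (j0 + ?a)) + d (P (j0 + ?a)) ((- g) $ P j1)"
    by (rule l_le_path3) (use i in auto)
  then have hgg: "l (h - g - g) \<le> l h + 2 * ?a - 2 * (j1 - j0)"
    unfolding hP ig line_d[OF P] using u axis_pos[OF g] by simp
  have "l (k + - g + - g) \<le> d (P q) (k $ P p) + d (P p) ((- g) $ P (p + ?a)) + d (P (p + ?a)) ((- g) $ P q)"
    by (rule l_le_path3) (use i in auto)
  then have kgg: "l (k - g - g) \<le> l k + 2 * ?a - 2 * (q - p)"
    unfolding kP ig line_d[OF P] using v axis_pos[OF g] by simp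
  \<comment> \<open>By \<open>wide\<close> and the length bounds \<open>j0 + l g\<close> lies in
    \<open>[p, q]\<close>, so it can be measured along \<open>R\<close>.\<close>
  have kP': "d (P (j0 + ?a)) (k $ P p) = l k - (j0 + ?a - p)"
    unfolding R(1) axis_act[OF k]
    using PR[of "j0 + ?a"] line_d[OF axis_line[OF k], of "j0 + ?a" "p + l k"] ord u v wide by simp
  have "l (h + - g + k + - g) \<le> d (P j1) (h $ P j0) + d (P j0) ((- g) $ P (j0 + ?a))
      + d (P (j0 + ?a)) (k $ P p) + d (P p) ((- g) $ P j1)"
    by (rule l_le_path4) (use i in auto)
  then have "l (h - g + k - g) \<le> l h + l k - 2 * (j1 - p)"
    unfolding hP kP' ig line_d[OF P] using u ord wide by simp
  then show False using minimal3_double[OF m] hg kg hk hgg kgg wide ord by simp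
qed

text \<open>The axes \<open>P\<close>, \<open>Q\<close>, \<open>R\<close> of \<open>g\<close>, \<open>h\<close>, \<open>k\<close> pass through a common vertex at parameter \<open>0\<close> and
  overlap pairwise in three legs of lengths \<open>\<alpha>\<close> (for \<open>g\<close>, \<open>h\<close>), \<open>\<beta>\<close> (for \<open>g\<close>, \<open>k\<close>) and
  \<open>\<epsilon>\<close> (for \<open>h\<close>, \<open>k\<close>).\<close>

definition tripod where
  "tripod g h k P Q R \<alpha> \<beta> \<epsilon> \<longleftrightarrow> minimal3 g h k \<and> axis g P \<and> axis h Q \<and> axis k R \<and>
     0 \<le> \<alpha> \<and> 0 \<le> \<beta> \<and> 0 \<le> \<epsilon> \<and> (\<forall>m. 0 \<le> m \<and> m \<le> \<alpha> \<longrightarrow> P (- m) = Q (- m)) \<and>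
     (\<forall>m. 0 \<le> m \<and> m \<le> \<beta> \<longrightarrow> P m = R m) \<and> (\<forall>m. 0 \<le> m \<and> m \<le> \<epsilon> \<longrightarrow> Q m = R (- m)) \<and>
     \<alpha> < l g \<and> \<alpha> < l h \<and> \<beta> < l g \<and> \<beta> < l k \<and> \<epsilon> < l h \<and> \<epsilon> < l k \<and>
     l (g + h) = l g + l h \<and> l (g + k) = l g + l k \<and> l (h - k) = l h + l k \<and>
     F g h = 2 * l g + 2 * l h - 2 * \<alpha> \<and> F g k = 2 * l g + 2 * l k - 2 * \<beta> \<and>
     F h k = 2 * l h + 2 * l k - 2 * \<epsilon>"

lemma axis_neg: "axis g P \<Longrightarrow> axis (- g) (\<lambda>m. P (- m))"
  using axis_reflect[of g P 0] by simp

text \<open>Reversing all axes exchanges \<open>h\<close> and \<open>k\<close>. Together with the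
  next two lemmas, where a change of sign restores the orientation of the legs, this allows any
  isometry and either of its legs to come first.\<close>

lemma tripod_mirror:
  assumes t: "tripod g h k P Q R \<alpha> \<beta> \<epsilon>"
  shows "tripod (- g) (- k) (- h) (\<lambda>m. P (- m)) (\<lambda>m. R (- m)) (\<lambda>m. Q (- m)) \<beta> \<alpha> \<epsilon>"
proof -
  have m: "minimal3 g h k" and ax: "axis g P" "axis h Q" "axis k R" using t unfolding tripod_def
    by blast+
  note i = minimal3_iso[OF m]
  have "l (- g + - k) = l (g + k)" "l (- g + - h) = l (g + h)" "l (- k - - h) = l (h - k)"
    using i l_commute[of g k] l_commute[of g h] l_commute[of h "- k"] l_uminus[of "k + g"] l_uminus[of "h + g"]
    by (simp_all add: minus_add)
  moreover have "minimal3 (- g) (- k) (- h)" using minimal3_uminus[OF m] minimal3_swap23 by blast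
  moreover note axis_neg[OF ax(1)] axis_neg[OF ax(2)] axis_neg[OF ax(3)]
  moreover have "F (- g) (- k) = F g k" "F (- g) (- h) = F g h" "F (- k) (- h) = F h k"
    using i F_commute[of h k] by simp_all
  moreover have "Q (- (- m)) = R (- m)" if "0 \<le> m \<and> m \<le> \<epsilon>" for m using t that
    unfolding tripod_def by simp
  ultimately show ?thesis using t i unfolding tripod_def by simp
qed

lemma tripod_turn2:
  assumes t: "tripod g h k P Q R \<alpha> \<beta> \<epsilon>"
  shows "tripod h g (- k) Q P (\<lambda>m. R (- m)) \<alpha> \<epsilon> \<beta>"
proof -
  have m: "minimal3 g h k" and ax: "axis k R" using t unfolding tripod_def by blast+
  note i = minimal3_iso[OF m]
  have "l (h + g) = l (g + h)" using l_commute i by blast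
  moreover have "minimal3 h g (- k)" using minimal3_uminus3[OF m] minimal3_swap12 by blast
  moreover note axis_neg[OF ax]
  moreover have "F h g = F g h" using F_commute i by blast
  ultimately show ?thesis using t i unfolding tripod_def by simp
qed

lemma tripod_turn3:
  assumes t: "tripod g h k P Q R \<alpha> \<beta> \<epsilon>"
  shows "tripod k (- h) g R (\<lambda>m. Q (- m)) P \<epsilon> \<beta> \<alpha>"
proof -
  have m: "minimal3 g h k" and ax: "axis h Q" using t unfolding tripod_def by blast+
  note i = minimal3_iso[OF m]
  have "l (k - h) = l (h - k)" "l (k + g) = l (g + k)" using l_commute l_minus_commute i by blast+
  moreover have "l (- h - g) = l (g + h)" using l_uminus[of "g + h"] i by (simp add: minus_add)
  moreover have "minimal3 k (- h) g" using minimal3_uminus2[OF m] minimal3_swap12 minimal3_swap23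
    by blast
  moreover note axis_neg[OF ax]
  moreover have "F k h = F h k" "F k g = F g k" "F h g = F g h" using F_commute i by blast+
  ultimately show ?thesis using t i unfolding tripod_def by simp
qed

text \<open>Minimality against \<open>h - g\<close> yields
  \<open>4 * \<alpha> \<le> l g + 2 * (\<epsilon> - e)\<close>, where \<open>\<epsilon> - e\<close>
  is at most the excess \<open>\<alpha> + \<beta> - l g\<close>, this being the largest of the
  three. Since \<alpha> is the longer leg, this is a contradiction.\<close>

lemma tripod_first_leg:
  assumes t: "tripod g h k P Q R \<alpha> \<beta> \<epsilon>" and E: "l g \<le> \<alpha> + \<beta>" "\<alpha> + \<epsilon> - l h \<le> \<alpha> + \<beta> - l g"
    "\<beta> + \<epsilon> - l k \<le> \<alpha> + \<beta> - l g" and "\<beta> \<le> \<alpha>"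
  shows False
proof -
  have m: "minimal3 g h k" and g: "axis g P" and h: "axis h Q" and k: "axis k R"
    and legs: "\<And>m. 0 \<le> m \<Longrightarrow> m \<le> \<alpha> \<Longrightarrow> P (- m) = Q (- m)" "\<And>m. 0 \<le> m \<Longrightarrow> m \<le> \<beta> \<Longrightarrow> P m = R m"
      "\<And>m. 0 \<le> m \<Longrightarrow> m \<le> \<epsilon> \<Longrightarrow> Q m = R (- m)"
    and b: "0 \<le> \<alpha>" "0 \<le> \<beta>" "0 \<le> \<epsilon>" "\<alpha> < l g" "\<alpha> < l h" "\<beta> < l g" "\<beta> < l k"
    and gh: "l (g + h) = l g + l h" and Fhk: "F h k = 2 * l h + 2 * l k - 2 * \<epsilon>"
    using t unfolding tripod_def by blast+
  note i = minimal3_iso[OF m] and P = axis_line[OF g] and Q = axis_line[OF h] and R = axis_line[OF k]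
  have ig: "(- g) $ P x = P (x - l g)" for x by (rule axis_act_uminus[OF g])
  have PQ: "P (- \<alpha>) = Q (- \<alpha>)" "P 0 = Q 0" using legs(1)[of \<alpha>] legs(1)[of 0] b
    by auto
  have PR: "P (l g - \<alpha>) = R (l g - \<alpha>)" "P 0 = R 0"
    using legs(2)[of "l g - \<alpha>"] legs(2)[of 0] b E by auto
  \<comment> \<open>The part of the third leg that still fits into the remainders
    \<open>l h - \<alpha>\<close> and \<open>l k - (l g - \<alpha>)\<close> of the periods of
    \<open>h\<close> and \<open>k\<close>, so that no distance in the closed path below changes
    sign.\<close>
  define e where "e = min \<epsilon> (min (l h - \<alpha>) (l k - (l g - \<alpha>)))"
  have e: "0 \<le> e" "e \<le> \<epsilon>" "e \<le> l h - \<alpha>" "e \<le> l k - (l g - \<alpha>)"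
    using b E unfolding e_def by auto
  have QRe: "Q e = R (- e)" using legs(3) e by simp
  have h0: "d (P 0) (h $ P (- \<alpha>)) = l h - \<alpha>"
    unfolding PQ axis_act[OF h] line_d[OF Q] using b by simp
  have he: "d (Q e) (h $ P (- \<alpha>)) = l h - \<alpha> - e"
    unfolding PQ axis_act[OF h] line_d[OF Q] using b e by simp
  have ke: "d (P (l g - \<alpha>)) (k $ Q e) = l k - e - (l g - \<alpha>)"
    unfolding PR(1) QRe axis_act[OF k] line_d[OF R] using e b by simp
  have k0: "d (P 0) ((- k) $ P 0) = l k"
    unfolding PR(2) axis_act_uminus[OF k] line_d[OF R] by simp
  have "l (h + - g + - g) \<le> d (P 0) (h $ P (- \<alpha>)) + d (P (- \<alpha>)) ((- g) $ P (l g - \<alpha>))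
      + d (P (l g - \<alpha>)) ((- g) $ P 0)"
    by (rule l_le_path3) (use i in auto)
  then have 1: "l (h - g - g) \<le> l h + 2 * l g - 2 * \<alpha>" unfolding h0 ig line_d[OF P]
    using b by simp
  have "l (h + - g + k) \<le> d (Q e) (h $ P (- \<alpha>)) + d (P (- \<alpha>)) ((- g) $ P (l g - \<alpha>))
      + d (P (l g - \<alpha>)) (k $ Q e)"
    by (rule l_le_path3) (use i in auto)
  then have 2: "l (h - g + k) \<le> l h + l k - l g - 2 * e" unfolding he ke ig line_d[OF P] using b
    by simp
  have "l (h + - g + - k) \<le> d (P 0) (h $ P (- \<alpha>)) + d (P (- \<alpha>)) ((- g) $ P 0) + d (P 0) ((- k) $ P 0)"
    by (rule l_le_path3) (use i in auto)
  then have 3: "l (h - g - k) \<le> l h + l k + l g - 2 * \<alpha>" unfolding h0 k0 ig line_d[OF P]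
    using b by simp
  have hg: "l (h + g) = l g + l h" using gh l_commute i by metis
  have "\<epsilon> - e \<le> \<alpha> + \<beta> - l g" using E b unfolding e_def by linarith
  moreover have "2 * \<alpha> + 2 * \<alpha> \<le> l g + 2 * \<epsilon> - 2 * e"
    using minimal3_single[OF m] hg Fhk 1 2 3 F_def[of "h - g" k] by linarith
  ultimately show False using \<open>\<beta> \<le> \<alpha>\<close> b by linarith
qed

lemma tripod_largest:
  assumes t: "tripod g h k P Q R \<alpha> \<beta> \<epsilon>" and E: "l g \<le> \<alpha> + \<beta>" "\<alpha> + \<epsilon> - l h \<le> \<alpha> + \<beta> - l g"
    "\<beta> + \<epsilon> - l k \<le> \<alpha> + \<beta> - l g"
  shows False
proof (cases "\<beta> \<le> \<alpha>")
  case True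
  then show False using tripod_first_leg[OF t E] by blast
next
  case False
  have i: "iso g" "iso h" "iso k" using t minimal3_iso unfolding tripod_def by blast+
  show False
    by (rule tripod_first_leg[OF tripod_mirror[OF t], unfolded l_uminus[OF i(1)] l_uminus[OF i(2)] l_uminus[OF i(3)]])
       (use E False in linarith)+
qed

text \<open>If one excess is nonnegative, so is the largest one, and its isometry can be turned into
  the first place.\<close>

lemma tripod_short:
  assumes t: "tripod g h k P Q R \<alpha> \<beta> \<epsilon>" shows "\<alpha> + \<beta> < l g"
proof (rule ccontr)
  assume "\<not> \<alpha> + \<beta> < l g"
  then have E: "l g \<le> \<alpha> + \<beta>" by simp
  have i: "iso g" "iso h" "iso k" using t minimal3_iso unfolding tripod_def by blast+
  note e = l_uminus[OF i(1)] l_uminus[OF i(2)] l_uminus[OF i(3)]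
  consider (1) "\<alpha> + \<epsilon> - l h \<le> \<alpha> + \<beta> - l g" "\<beta> + \<epsilon> - l k \<le> \<alpha> + \<beta> - l g"
    | (2) "\<alpha> + \<beta> - l g \<le> \<alpha> + \<epsilon> - l h" "\<beta> + \<epsilon> - l k \<le> \<alpha> + \<epsilon> - l h"
    | (3) "\<alpha> + \<beta> - l g \<le> \<beta> + \<epsilon> - l k" "\<alpha> + \<epsilon> - l h \<le> \<beta> + \<epsilon> - l k" by linarith
  then show False
  proof cases
    case 1
    then show False using tripod_largest[OF t E] by blast
  next
    case 2
    show False by (rule tripod_largest[OF tripod_turn2[OF t], unfolded e]) (use E 2 in linarith)+
  next
    case 3
    show False by (rule tripod_largest[OF tripod_turn3[OF t], unfolded e]) (use E 3 in linarith)+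
  qed
qed

text \<open>A common point with equal nonzero parameters would force the lines to agree at
  \<open>1\<close> or at \<open>- 1\<close>, so common points have opposite parameters.\<close>

lemma aligned_reverse:
  assumes Q: "line Q" and R: "line R" and 0: "Q 0 = R 0" and 1: "Q 1 \<noteq> R 1" "Q (- 1) \<noteq> R (- 1)"
  shows "aligned Q (\<lambda>m. R (- m))"
  unfolding aligned_def
proof (intro allI impI)
  fix x y assume xy: "Q x = R (- y)"
  have "\<bar>x\<bar> = \<bar>y\<bar>" using xy 0 line_d[OF Q, of x 0] line_d[OF R, of "- y" 0]
    by simp
  show "x = y"
  proof (rule ccontr)
    assume "x \<noteq> y"
    then have y: "y = - x" "x \<noteq> 0" using \<open>\<bar>x\<bar> = \<bar>y\<bar>\<close>
      by linarith+
    then have "Q x = R x" using xy by simp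
    then have "0 < x \<Longrightarrow> Q 1 = R 1" "x < 0 \<Longrightarrow> Q (- 1) = R (- 1)"
      using line_agree_between[OF Q R 0, of x 1] line_agree_between[OF Q R _ 0, of x "- 1"] by auto
    then show False using 1 y by linarith
  qed
qed

lemma no_wide_tripod:
  assumes m: "minimal3 g h k" and g: "axis g P" and h: "axis h Q" and k: "axis k R"
    and al: "aligned P Q" "aligned P R"
    and Q: "P (- \<alpha>) = Q (- \<alpha>)" "P 0 = Q 0" "P (- \<alpha> - 1) \<noteq> Q (- \<alpha> - 1)" "P 1 \<noteq> Q 1"
    and R: "P 0 = R 0" "P \<beta> = R \<beta>" "P (- 1) \<noteq> R (- 1)" "P (\<beta> + 1) \<noteq> R (\<beta> + 1)"
    and \<alpha>: "0 < \<alpha>" "\<alpha> < l g" "\<alpha> < l h" and \<beta>: "0 < \<beta>" "\<beta> < l g" "\<beta> < l k"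
    and no: "\<not> overlap h k"
  shows "\<alpha> + \<beta> < l g"
proof -
  note i = minimal3_iso[OF m] and lP = axis_line[OF g] and lQ = axis_line[OF h] and lR = axis_line[OF k]
  have PQ: "P x = Q x" if "- \<alpha> \<le> x" "x \<le> 0" for x
    using line_agree_between[OF lP lQ Q(1,2) that] .
  have PR: "P x = R x" if "0 \<le> x" "x \<le> \<beta>" for x
    using line_agree_between[OF lP lR R(1,2) that] .
  have gh: "l (g + h) = l g + l h" by (rule l_plus_aligned[OF g h al(1) Q(2)])
  have gk: "l (g + k) = l g + l k" by (rule l_plus_aligned[OF g k al(2) R(1)])
  have gh': "l (g - h) = l g + l h - 2 * \<alpha>"
    using l_minus_overlap[OF g h _ Q(1,3,2)] Q(4) \<alpha> by simp
  have gk': "l (g - k) = l g + l k - 2 * \<beta>"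
    using l_minus_overlap[OF g k _ R(1) _ R(2)] R(3,4) \<beta> by simp
  have QR: "Q 0 = R 0" using Q R by simp
  have ne: "Q 1 \<noteq> R 1" "Q (- 1) \<noteq> R (- 1)"
    using PQ[of "- 1"] PR[of 1] Q(4) R(3) \<alpha> \<beta> by auto
  have al': "aligned Q (\<lambda>m. R (- m))" by (rule aligned_reverse[OF lQ lR QR ne])
  note k' = axis_neg[OF k]
  define B where "B = {m. Q m = R (- m)}"
  have Bsmall: "\<bar>x - y\<bar> < l h \<and> \<bar>x - y\<bar> < l k" if "x \<in> B" "y \<in> B" for x y
  proof (rule ccontr)
    assume "\<not> (\<bar>x - y\<bar> < l h \<and> \<bar>x - y\<bar> < l k)"
    then have "min (l h) (l k) \<le> d (Q x) (Q y)" unfolding line_d[OF lQ] by linarith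
    moreover have "Q x \<in> range R" "Q y \<in> range R" using that unfolding B_def by auto
    ultimately show False using no unfolding overlap_def axis_range[OF h] axis_range[OF k] by blast
  qed
  have B0: "0 \<in> B" using QR unfolding B_def by simp
  have finB: "finite B"
    by (rule finite_subset[of _ "{- l h..l h}"]) (use Bsmall[OF _ B0] in fastforce)+
  \<comment> \<open>Only the far end of the third leg has to be found: it starts at
    \<open>0\<close>, because \<open>Q (- 1)\<close> and \<open>R 1\<close> are distinct vertices of
    \<open>P\<close>.\<close>
  define \<epsilon> where "\<epsilon> = Max B"
  have \<epsilon>: "\<epsilon> \<in> B" "0 \<le> \<epsilon>" "\<epsilon> + 1 \<notin> B" 
    unfolding \<epsilon>_def using finB B0 Max_ge[of B "Max B + 1"] by (auto intro: Max_in)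
  have \<epsilon>l: "\<epsilon> < l h" "\<epsilon> < l k" using Bsmall[OF \<epsilon>(1) B0] by auto
  have ends: "Q (0 - 1) \<noteq> R (- (0 - 1))" "Q (\<epsilon> + 1) \<noteq> R (- (\<epsilon> + 1))"
  proof -
    have "Q (- 1) = P (- 1)" "R 1 = P 1" using PQ[of "- 1"] PR[of 1] \<alpha> \<beta> by auto
    then show "Q (0 - 1) \<noteq> R (- (0 - 1))" using line_eq_iff[OF lP, of "- 1" 1] by simp
    show "Q (\<epsilon> + 1) \<noteq> R (- (\<epsilon> + 1))" using \<epsilon>(3) unfolding B_def
      by simp
  qed
  have Qe: "Q \<epsilon> = R (- \<epsilon>)" using \<epsilon>(1) unfolding B_def by simp
  have Q0: "Q 0 = R (- 0)" using QR by simp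
  have lk: "l (- k) = l k" using i by simp
  have "l (h - (- k)) = l h + l (- k) - 2 * (\<epsilon> - 0)"
    by (rule l_minus_overlap[OF h k' \<epsilon>(2) Q0 ends(1) Qe ends(2)])
    (use \<epsilon>l lk in auto)
  then have hk: "l (h + k) = l h + l k - 2 * \<epsilon>" using lk by simp
  have "l (h + - k) = l h + l (- k)" by (rule l_plus_aligned[OF h k' al' Q0])
  then have hk': "l (h - k) = l h + l k" using lk by simp
  have legs: "P (- x) = Q (- x)" if "0 \<le> x" "x \<le> \<alpha>" for x using PQ[of "- x"] that
    by simp
  have legs': "Q x = R (- x)" if "0 \<le> x" "x \<le> \<epsilon>" for x
    using line_agree_between[OF lQ axis_line[OF k'] Q0 Qe that] .
  have "tripod g h k P Q R \<alpha> \<beta> \<epsilon>"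
    unfolding tripod_def F_def
    using m g h k \<alpha> \<beta> \<epsilon>(2) \<epsilon>l gh gk gh' gk' hk hk' legs legs' PR
    by auto
  then show ?thesis by (rule tripod_short)
qed

text \<open>By \<open>near_intersect\<close> the projections have a common parameter. If one were a
  single vertex, the other alone would be too wide; hence both are overlaps, and they share either a
  segment or exactly one vertex.\<close>

lemma near_diameter_aux:
  assumes m: "minimal3 g h k" and g: "axis g P" and h: "axis h Q" and k: "axis k R"
    and a: "a \<in> near P Q" and b: "b \<in> near P R" and far: "l g \<le> b - a"
  shows False
proof -
  note lP = axis_line[OF g] and lQ = axis_line[OF h] and lR = axis_line[OF k] and i = minimal3_iso[OF m]
  note no = no_overlap[OF m g h k]
  have pos: "0 < l g" using axis_pos[OF g] .
  obtain z where z: "z \<in> near P Q" "z \<in> near P R" using near_intersect[OF m g h k a b far]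
    by blast
  have meetQ: "\<exists>x y. P x = Q y"
  proof (rule near_cases[OF lP lQ])
    fix m0 assume "near P Q = {m0}"
    then have "a = z" using a z by simp
    then show ?thesis using near_small(1)[OF g k no(2) b z(2)] far by simp
  qed blast
  have meetR: "\<exists>x y. P x = R y"
  proof (rule near_cases[OF lP lR])
    fix m0 assume "near P R = {m0}"
    then have "b = z" using b z by simp
    then show ?thesis using near_small(1)[OF g h no(1) z(1) a] far by simp
  qed blast
  obtain h' Q' where h': "h' = h \<or> h' = - h" "axis h' Q'" "range Q' = range Q" "aligned P Q'" "\<exists>x. P x = Q' x"
    using meetQ ex_aligned[OF lP h] by metis
  obtain k' R' where k': "k' = k \<or> k' = - k" "axis k' R'" "range R' = range R" "aligned P R'" "\<exists>x. P x = R' x"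
    using meetR ex_aligned[OF lP k] by metis
  have m': "minimal3 g h' k'" using m h'(1) k'(1) minimal3_uminus2 minimal3_uminus3 by blast
  note no' = no_overlap[OF m' g h'(2) k'(2)]
  have near_range: "near P T = near P T'" if "range T = range T'" for T T' :: "int \<Rightarrow> 'v"
  proof -
    have "near P T = {m. \<exists>t\<in>range T. \<forall>m'. \<forall>t'\<in>range T. d (P m) t \<le> d (P m') t'}" for T
      unfolding near_def by auto
    from this[of T] this[of T'] show ?thesis unfolding that by simp
  qed
  define J K where "J = near P Q'" and "K = near P R'"
  obtain x y where xy: "P x = Q' x" "P y = R' y" using h'(5) k'(5) by blast
  have J: "J = {m. P m = Q' m}" unfolding J_def by (rule near_aligned[OF h'(4), of x]) (rule xy)
  have K: "K = {m. P m = R' m}" unfolding K_def by (rule near_aligned[OF k'(4), of y]) (rule xy)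
  have aJ: "a \<in> J" "z \<in> J" "z \<in> K" "b \<in> K"
    using a b z near_range[OF h'(3)] near_range[OF k'(3)] unfolding J_def K_def by auto
  have Jsmall: "\<bar>x - y\<bar> < l g \<and> \<bar>x - y\<bar> < l h'" if "x \<in> J" "y \<in> J" for x y
    using near_small[OF g h'(2) no'(1), of x y] that J unfolding J_def by auto
  have Ksmall: "\<bar>x - y\<bar> < l g \<and> \<bar>x - y\<bar> < l k'" if "x \<in> K" "y \<in> K" for x y
    using near_small[OF g k'(2) no'(2), of x y] that K unfolding K_def by auto
  have finJ: "finite J" by (rule finite_subset[of _ "{z - l g..z + l g}"])
    (use Jsmall[OF _ aJ(2)] in fastforce)+
  have finK: "finite K" by (rule finite_subset[of _ "{z - l g..z + l g}"])
    (use Ksmall[OF _ aJ(3)] in fastforce)+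
  define j0 j1 p q where "j0 = Min J" and "j1 = Max J" and "p = Min K" and "q = Max K"
  have ne: "J \<noteq> {}" "K \<noteq> {}" using aJ by auto
  have inJ: "j0 \<in> J" "j1 \<in> J" "p \<in> K" "q \<in> K"
    unfolding j0_def j1_def p_def q_def
    using Min_in[OF finJ ne(1)] Max_in[OF finJ ne(1)] Min_in[OF finK ne(2)] Max_in[OF finK ne(2)] .
  have ord: "j0 \<le> a" "b \<le> q" "p \<le> z" "z \<le> j1"
    unfolding j0_def j1_def p_def q_def using finJ finK aJ by auto
  have ends: "j0 - 1 \<notin> J" "j1 + 1 \<notin> J" "p - 1 \<notin> K" "q + 1 \<notin> K"
    using Min_le[OF finJ, of "j0 - 1"] Max_ge[OF finJ, of "j1 + 1"] Min_le[OF finK, of "p - 1"] Max_ge[OF finK, of "q + 1"]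
    unfolding j0_def j1_def p_def q_def by auto
  have u: "j1 - j0 < l g" "j1 - j0 < l h'" "q - p < l g" "q - p < l k'"
    using Jsmall[OF inJ(2,1)] Ksmall[OF inJ(4,3)] by linarith+
  have wide: "l g \<le> q - j0" using far ord by linarith
  show False
  proof (cases "p < j1")
    case True
    show False
      by (rule no_wide_overlap[OF m' g h'(2) k'(2) h'(4) k'(4), of j0 j1 p q])
      (use inJ u wide True in \<open>auto simp: J K\<close>)
  next
    case False
    then have pz: "p = z" "j1 = z" using ord by linarith+
    have sh: "axis g (\<lambda>m. P (m + z))" "axis h' (\<lambda>m. Q' (m + z))" "axis k' (\<lambda>m. R' (m + z))"
      using axis_shift g h'(2) k'(2) by blast+
    have als: "aligned (\<lambda>m. P (m + z)) (\<lambda>m. Q' (m + z))" "aligned (\<lambda>m. P (m + z)) (\<lambda>m. R' (m + z))"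
      using h'(4) k'(4) unfolding aligned_def by (metis add_right_cancel)+
    have e: "- (z - j0) + z = j0" "- (z - j0) - 1 + z = j0 - 1" "q - z + z = q" "q - z + 1 + z = q + 1"
      "0 + z = z" "1 + z = z + 1" "- 1 + z = z - 1" by simp_all
    have in': "P j0 = Q' j0" "P z = Q' z" "P (j0 - 1) \<noteq> Q' (j0 - 1)" "P (z + 1) \<noteq> Q' (z + 1)"
      "P z = R' z" "P q = R' q" "P (z - 1) \<noteq> R' (z - 1)" "P (q + 1) \<noteq> R' (q + 1)"
      using inJ ends unfolding J K pz by auto
    have "z - j0 + (q - z) < l g"
      by (rule no_wide_tripod[OF m' sh als, where \<alpha> = "z - j0" and \<beta> = "q - z", unfolded e, OF in'])
         (use u wide pz no'(3) in auto)
    then show False using wide by simp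
  qed
qed

theorem near_diameter:
  assumes m: "minimal3 g h k" and g: "axis g P" and h: "axis h Q" and k: "axis k R"
    and a: "a \<in> near P Q \<union> near P R" and b: "b \<in> near P Q \<union> near P R"
  shows "\<bar>a - b\<bar> < l g"
proof -
  have m': "minimal3 g k h" using m minimal3_swap23 by blast
  note no = no_overlap[OF m g h k]
  note 1 = near_diameter_aux[OF m g h k] and 2 = near_diameter_aux[OF m' g k h]
  note 3 = near_small(1)[OF g h no(1)] and 4 = near_small(1)[OF g k no(2)]
  have "\<bar>x - y\<bar> < l g" if "x \<in> near P Q" "y \<in> near P R" for x y
  proof -
    have "\<not> l g \<le> y - x" "\<not> l g \<le> x - y" using 1[OF that] 2[OF that(2,1)]
      by blast+
    then show ?thesis by linarith
  qed
  from this[of a b] this[of b a] show ?thesis using a b 3[of a b] 4[of a b]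
    by (auto simp: abs_minus_commute)
qed

end

section \<open>The geometric realization\<close>

lemma edge_point_self [simp]: "edge_point u u t = (\<lambda>w. of_bool (w = u))"
  by (auto simp: edge_point_def algebra_simps)

lemma supp_edge_point_subset: "supp (edge_point u v t) \<subseteq> {u, v}"
  by (auto simp: supp_def edge_point_def)

text \<open>The extension of a vertex function to the realization, affine on edges. Extensions of 1-Lipschitz
  functions bound \<^const>\<open>gdist\<close> from below.\<close>

definition extend :: "('v \<Rightarrow> real) \<Rightarrow> ('v \<Rightarrow> real) \<Rightarrow> real" where
  "extend f x = (\<Sum>w\<in>supp x. x w * f w)"

lemma extend_superset: "finite S \<Longrightarrow> supp x \<subseteq> S \<Longrightarrow> extend f x = (\<Sum>w\<in>S. x w * f w)"
  unfolding extend_def by (rule sum.mono_neutral_left) (auto simp: supp_def)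

lemma extend_edge_point: "extend f (edge_point u v t) = (1 - t) * f u + t * f v"
proof (cases "u = v")
  case True
  then show ?thesis using extend_superset[OF _ supp_edge_point_subset[of u v t], of f]
    by (simp add: algebra_simps)
next
  case False
  then show ?thesis using extend_superset[OF _ supp_edge_point_subset[of u v t], of f]
    by (simp add: edge_point_def)
qed

context stree
begin

lemma realizationE:
  assumes "x \<in> realization adj"
  obtains u v t where "x = edge_point u v t" "u = v \<or> adj u v" "0 \<le> t" "t \<le> 1"
  using assms unfolding realization_def by blast

lemma realization_mass:
  assumes "x \<in> realization adj" shows "finite (supp x)" "supp x \<noteq> {}" "(\<Sum>w\<in>supp x. x w) = 1" "0 \<le> x w"
proof -
  obtain u v t where x: "x = edge_point u v t" "0 \<le> t" "t \<le> 1" using assms realizationE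
    by blast
  show "finite (supp x)" unfolding x(1) by (rule finite_subset[OF supp_edge_point_subset]) simp
  have "extend (\<lambda>_. 1) x = 1" unfolding x(1) extend_edge_point by simp
  then show s: "(\<Sum>w\<in>supp x. x w) = 1" by (simp add: extend_def)
  then show "supp x \<noteq> {}" by auto
  show "0 \<le> x w" using x by (simp add: edge_point_def)
qed

lemma realization_on_edge:
  assumes x: "x \<in> realization adj" and s: "supp x \<subseteq> {u, v}" and "u \<noteq> v"
  shows "x v = 1 - x u" "extend f x = x u * f u + (1 - x u) * f v"
proof -
  have "extend (\<lambda>_. 1) x = 1" using realization_mass(3)[OF x] by (simp add: extend_def)
  then show *: "x v = 1 - x u"
    using extend_superset[OF _ s, of "\<lambda>_. 1"] \<open>u \<noteq> v\<close> by simp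
  show "extend f x = x u * f u + (1 - x u) * f v"
    using extend_superset[OF _ s, of f] \<open>u \<noteq> v\<close> * by simp
qed

definition lipschitz :: "('v \<Rightarrow> real) \<Rightarrow> bool" where
  "lipschitz f \<longleftrightarrow> (\<forall>u v. \<bar>f u - f v\<bar> \<le> real_of_int (d u v))"

lemma extend_vertex_diff:
  assumes x: "x \<in> realization adj" and f: "lipschitz f" and u: "u \<in> supp x"
  shows "\<bar>extend f x - f u\<bar> \<le> 1 - x u"
proof -
  obtain a b t where ab: "x = edge_point a b t" "a = b \<or> adj a b" "0 \<le> t" "t \<le> 1"
    using x realizationE by blast
  have sub: "supp x \<subseteq> {a, b}" unfolding ab(1) by (rule supp_edge_point_subset)
  show ?thesis
  proof (cases "a = b")
    case True
    then have "u = a" using sub u by auto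
    then show ?thesis unfolding ab(1) using True extend_edge_point[of f a a t]
      by (simp add: algebra_simps)
  next
    case False
    have "\<exists>c. {a, b} = {u, c} \<and> u \<noteq> c" using sub u False by auto
    then obtain c where c: "{a, b} = {u, c}" "u \<noteq> c" by blast
    have "adj u c" using c ab(2) False adj_sym by (metis doubleton_eq_iff)
    then have "\<bar>f u - f c\<bar> \<le> 1" using f d_adj_iff unfolding lipschitz_def
      by (metis of_int_1)
    moreover have "extend f x - f u = (1 - x u) * (f c - f u)"
      using realization_on_edge(2)[OF x _ c(2), of f] sub c(1) by (simp add: algebra_simps)
    moreover have "0 \<le> 1 - x u"
      using realization_on_edge(1)[OF x _ c(2)] realization_mass(4)[OF x, of c] sub c(1) by simp
    ultimately show ?thesis by (simp add: abs_mult abs_minus_commute mult_left_le)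
  qed
qed

lemma gdist_edge:
  assumes x: "x \<in> realization adj" and y: "y \<in> realization adj"
    and uv: "u = v \<or> adj u v" "supp x \<union> supp y \<subseteq> {u, v}"
  shows "gdist adj x y = \<bar>x u - y u\<bar>"
    "\<bar>extend f x - extend f y\<bar> = \<bar>x u - y u\<bar> * \<bar>f u - f v\<bar>"
proof -
  have e: "gdist adj x y = (\<Sum>w\<in>supp x \<union> supp y. \<bar>x w - y w\<bar>) / 2"
    unfolding gdist_def using uv by (auto simp: if_distrib)
  also have "(\<Sum>w\<in>supp x \<union> supp y. \<bar>x w - y w\<bar>) = (\<Sum>w\<in>{u, v}. \<bar>x w - y w\<bar>)"
    by (rule sum.mono_neutral_left) (use uv in \<open>auto simp: supp_def\<close>)
  finally have g: "gdist adj x y = (\<Sum>w\<in>{u, v}. \<bar>x w - y w\<bar>) / 2" .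
  show "gdist adj x y = \<bar>x u - y u\<bar>"
    "\<bar>extend f x - extend f y\<bar> = \<bar>x u - y u\<bar> * \<bar>f u - f v\<bar>"
  proof -
    consider "u = v" | "u \<noteq> v" by blast
    then have "gdist adj x y = \<bar>x u - y u\<bar> \<and> \<bar>extend f x - extend f y\<bar> = \<bar>x u - y u\<bar> * \<bar>f u - f v\<bar>"
    proof cases
      case 1
      have *: "z u = 1 \<and> extend f z = f u" if "z \<in> realization adj" "supp z \<subseteq> {u, v}" for z
      proof -
        have "supp z = {u}" using that 1 realization_mass(2)[OF that(1)] by auto
        then show ?thesis using realization_mass(3)[OF that(1)] by (simp add: extend_def)
      qed
      show ?thesis using g 1 *[OF x] *[OF y] uv by simp
    next
      case 2
      have sx: "supp x \<subseteq> {u, v}" and sy: "supp y \<subseteq> {u, v}" using uv by auto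
      note X = realization_on_edge[OF x sx 2] and Y = realization_on_edge[OF y sy 2]
      have "extend f x - extend f y = (x u - y u) * (f u - f v)" using X(2) Y(2)
        by (simp add: algebra_simps)
      then show ?thesis using g 2 X(1) Y(1) by (simp add: abs_mult)
    qed
    then show "gdist adj x y = \<bar>x u - y u\<bar>"
      "\<bar>extend f x - extend f y\<bar> = \<bar>x u - y u\<bar> * \<bar>f u - f v\<bar>"
      by blast+
  qed
qed

lemma gdist_no_edge:
  assumes x: "x \<in> realization adj" and y: "y \<in> realization adj"
    and no: "\<not> (\<exists>u v. (u = v \<or> adj u v) \<and> supp x \<union> supp y \<subseteq> {u, v})"
  shows "u \<in> supp x \<Longrightarrow> v \<in> supp y \<Longrightarrow> gdist adj x y \<le> (1 - x u) + d u v + (1 - y v)"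
    and "\<exists>u\<in>supp x. \<exists>v\<in>supp y. gdist adj x y = (1 - x u) + d u v + (1 - y v)"
proof -
  let ?M = "{(1 - x u) + real (vdist adj u v) + (1 - y v) | u v. u \<in> supp x \<and> v \<in> supp y}"
  have M: "?M = (\<lambda>(u, v). (1 - x u) + real (vdist adj u v) + (1 - y v)) ` (supp x \<times> supp y)" by auto
  have fin: "finite ?M" and ne: "?M \<noteq> {}"
    unfolding M using realization_mass(1,2)[OF x] realization_mass(1,2)[OF y] by auto
  have e: "gdist adj x y = Min ?M" unfolding gdist_def by (rule if_not_P[OF no])
  show "gdist adj x y \<le> (1 - x u) + d u v + (1 - y v)" if "u \<in> supp x" "v \<in> supp y"
    unfolding e d_def by (rule Min_le[OF fin]) (use that in auto)
  show "\<exists>u\<in>supp x. \<exists>v\<in>supp y. gdist adj x y = (1 - x u) + d u v + (1 - y v)"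
    using Min_in[OF fin ne] unfolding e d_def by auto
qed

lemma extend_diff_le_gdist:
  assumes x: "x \<in> realization adj" and y: "y \<in> realization adj" and f: "lipschitz f"
  shows "\<bar>extend f x - extend f y\<bar> \<le> gdist adj x y"
proof (cases "\<exists>u v. (u = v \<or> adj u v) \<and> supp x \<union> supp y \<subseteq> {u, v}")
  case True
  then obtain u v where uv: "u = v \<or> adj u v" "supp x \<union> supp y \<subseteq> {u, v}"
    by blast
  have "d u v \<le> 1" using uv(1) d_adj_iff by auto
  then have "\<bar>f u - f v\<bar> \<le> 1" using f unfolding lipschitz_def
    by (smt (verit) of_int_le_1_iff)
  then show ?thesis unfolding gdist_edge[OF x y uv] by (simp add: mult_left_le)
next
  case False
  obtain u v where uv: "u \<in> supp x" "v \<in> supp y" "gdist adj x y = (1 - x u) + d u v + (1 - y v)"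
    using gdist_no_edge(2)[OF x y False] by blast
  have "\<bar>f u - f v\<bar> \<le> real_of_int (d u v)" using f unfolding lipschitz_def by blast
  then show ?thesis
    using uv(3) extend_vertex_diff[OF x f uv(1)] extend_vertex_diff[OF y f uv(2)] by linarith
qed

lemma gdist_nonneg:
  assumes "x \<in> realization adj" "y \<in> realization adj" shows "0 \<le> gdist adj x y"
proof -
  have "lipschitz (\<lambda>_. 0)" by (simp add: lipschitz_def)
  from extend_diff_le_gdist[OF assms this] show ?thesis by linarith
qed

lemma gdist_sym:
  assumes x: "x \<in> realization adj" and y: "y \<in> realization adj"
  shows "gdist adj x y = gdist adj y x"
proof -
  have "gdist adj y x \<le> gdist adj x y" if x: "x \<in> realization adj" and y: "y \<in> realization adj" for x y
  proof (cases "\<exists>u v. (u = v \<or> adj u v) \<and> supp x \<union> supp y \<subseteq> {u, v}")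
    case True
    then obtain u v where "u = v \<or> adj u v" "supp x \<union> supp y \<subseteq> {u, v}" by blast
    then show ?thesis using gdist_edge(1)[OF x y, of u v] gdist_edge(1)[OF y x, of u v]
      by (simp add: Un_commute abs_minus_commute)
  next
    case False
    obtain u v where uv: "u \<in> supp x" "v \<in> supp y" "gdist adj x y = (1 - x u) + d u v + (1 - y v)"
      using gdist_no_edge(2)[OF x y False] by blast
    have "gdist adj y x \<le> (1 - y v) + d v u + (1 - x u)"
      by (rule gdist_no_edge(1)[OF y x _ uv(2,1)])
      (use False in \<open>simp add: Un_commute\<close>)
    then show ?thesis using uv(3) d_sym[of u v] by linarith
  qed
  from this[OF x y] this[OF y x] show ?thesis by linarith
qed

section \<open>Lines in the realization\<close>

definition pt :: "(int \<Rightarrow> 'v) \<Rightarrow> real \<Rightarrow> 'v \<Rightarrow> real" where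
  "pt P \<theta> = edge_point (P \<lfloor>\<theta>\<rfloor>) (P (\<lfloor>\<theta>\<rfloor> + 1)) (frac \<theta>)"

definition points :: "(int \<Rightarrow> 'v) \<Rightarrow> ('v \<Rightarrow> real) set" where
  "points P = {edge_point (P k) (P (k + 1)) t | k t. 0 \<le> t \<and> t \<le> 1}"

lemma line_adj: "line P \<Longrightarrow> adj (P k) (P (k + 1))"
  by (simp add: d_adj_iff line_d)

lemma pt_edge_point:
  assumes "0 \<le> t" "t \<le> 1" shows "edge_point (P k) (P (k + 1)) t = pt P (real_of_int k + t)"
proof (cases "t = 1")
  case True
  then show ?thesis by (simp add: pt_def edge_point_def fun_eq_iff)
next
  case False
  then have "\<lfloor>real_of_int k + t\<rfloor> = k" using assms by (simp add: floor_eq_iff)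
  then show ?thesis by (simp add: pt_def frac_def)
qed

lemma points_eq: "points P = range (pt P)"
proof (intro equalityI subsetI)
  fix x assume "x \<in> points P"
  then show "x \<in> range (pt P)" unfolding points_def using pt_edge_point[of _ P] by auto
next
  fix x assume "x \<in> range (pt P)"
  then show "x \<in> points P" unfolding points_def pt_def using frac_ge_0 frac_lt_1 less_imp_le
    by blast
qed

lemma points_realization: "line P \<Longrightarrow> points P \<subseteq> realization adj"
  unfolding points_def realization_def using line_adj by blast

lemma pt_realization: "line P \<Longrightarrow> pt P \<theta> \<in> realization adj"
  using points_realization points_eq by blast

lemma extend_pt: "extend f (pt P \<theta>) = (1 - frac \<theta>) * f (P \<lfloor>\<theta>\<rfloor>) + frac \<theta> * f (P (\<lfloor>\<theta>\<rfloor> + 1))"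
  unfolding pt_def by (rule extend_edge_point)

lemma d_adj_diff: "adj u v \<Longrightarrow> \<bar>d u w - d v w\<bar> = 1"
proof -
  assume a: "adj u v"
  obtain m where m: "d u v = d u m + d m v" "d u w = d u m + d m w" "d v w = d v m + d m w"
    by (rule ex_median[of u v w])
  have "d u v = 1" using a d_adj_iff by blast
  then have "d u m = 0 \<and> d v m = 1 \<or> d u m = 1 \<and> d v m = 0"
    using m(1) d_nonneg[of u m] d_nonneg[of m v] d_sym[of v m] by linarith
  then show ?thesis using m by linarith
qed

lemma lipschitz_d: "lipschitz (\<lambda>u. real_of_int (d u w))"
  unfolding lipschitz_def
proof (intro allI)
  fix u v
  have "\<bar>d u w - d v w\<bar> \<le> d u v"
    using d_triangle[of u w v] d_triangle[of v w u] d_sym[of u v] by linarith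
  then show "\<bar>real_of_int (d u w) - real_of_int (d v w)\<bar> \<le> real_of_int (d u v)"
    by linarith
qed

lemma extend_d_pt:
  assumes P: "line P" and "N \<le> \<lfloor>\<theta>\<rfloor>"
  shows "extend (\<lambda>u. real_of_int (d u (P N))) (pt P \<theta>) = \<theta> - real_of_int N"
proof -
  have e: "real_of_int (d (P \<lfloor>\<theta>\<rfloor>) (P N)) = real_of_int \<lfloor>\<theta>\<rfloor> - N" "real_of_int (d (P (\<lfloor>\<theta>\<rfloor> + 1)) (P N)) = real_of_int \<lfloor>\<theta>\<rfloor> + 1 - N"
    using assms(2) by (simp_all add: line_d[OF P])
  show ?thesis unfolding extend_pt e by (simp add: frac_def algebra_simps)
qed

text \<open>The extension of the distance to the vertex at \<open>\<lfloor>\<theta>\<rfloor>\<close>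
  grows by exactly \<open>\<eta> - \<theta>\<close>, which bounds \<open>gdist\<close> from below.
  Without a common edge, the path through the vertices at \<open>\<lceil>\<theta>\<rceil>\<close>
  and \<open>\<lfloor>\<eta>\<rfloor>\<close> attains this value.\<close>

lemma gdist_pt_le:
  assumes P: "line P" and le: "\<theta> \<le> \<eta>" shows "gdist adj (pt P \<theta>) (pt P \<eta>) = \<eta> - \<theta>"
proof -
  note R = pt_realization[OF P]
  let ?N = "\<lfloor>\<theta>\<rfloor>" let ?f = "\<lambda>u. real_of_int (d u (P ?N))"
  have N: "?N \<le> \<lfloor>\<eta>\<rfloor>" using le by (rule floor_mono)
  have diff: "\<bar>extend ?f (pt P \<theta>) - extend ?f (pt P \<eta>)\<bar> = \<eta> - \<theta>"
    using extend_d_pt[OF P order_refl, of \<theta>] extend_d_pt[OF P N] le by simp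
  show ?thesis
  proof (cases "\<exists>u v. (u = v \<or> adj u v) \<and> supp (pt P \<theta>) \<union> supp (pt P \<eta>) \<subseteq> {u, v}")
    case True
    then obtain u v where uv: "u = v \<or> adj u v" "supp (pt P \<theta>) \<union> supp (pt P \<eta>) \<subseteq> {u, v}" by blast
    note g = gdist_edge[OF R R uv]
    show ?thesis
    proof (cases "u = v")
      case True
      then have "\<eta> - \<theta> = 0" using g(2)[of ?f] diff by simp
      moreover have "gdist adj (pt P \<theta>) (pt P \<eta>) = 0"
      proof -
        have "pt P \<theta> = pt P \<eta>" using calculation by simp
        then show ?thesis using g(1) by simp
      qed
      ultimately show ?thesis by simp
    next
      case False
      then have "\<bar>d u (P ?N) - d v (P ?N)\<bar> = 1" using uv(1) d_adj_diff by blast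
      then have "\<bar>?f u - ?f v\<bar> = 1" by linarith
      then show ?thesis using g(1) g(2)[of ?f] diff by simp
    qed
  next
    case False
    have cf: "\<lceil>\<theta>\<rceil> \<le> \<lfloor>\<eta>\<rfloor>"
    proof (rule ccontr)
      assume "\<not> \<lceil>\<theta>\<rceil> \<le> \<lfloor>\<eta>\<rfloor>"
      then have "\<lfloor>\<eta>\<rfloor> < \<lceil>\<theta>\<rceil>" by linarith
      then have "real_of_int \<lfloor>\<eta>\<rfloor> < \<theta>" by (simp only: less_ceiling_iff)
      then have "\<lfloor>\<eta>\<rfloor> \<le> \<lfloor>\<theta>\<rfloor>"
        by (simp only: le_floor_iff less_imp_le)
      then have "\<lfloor>\<theta>\<rfloor> = \<lfloor>\<eta>\<rfloor>" using N by linarith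
      then have "supp (pt P \<theta>) \<union> supp (pt P \<eta>) \<subseteq> {P \<lfloor>\<eta>\<rfloor>, P (\<lfloor>\<eta>\<rfloor> + 1)}"
        unfolding pt_def using supp_edge_point_subset by (metis Un_least)
      then show False using False line_adj[OF P] by blast
    qed
    have v: "pt P \<eta> (P \<lfloor>\<eta>\<rfloor>) = 1 - frac \<eta>"
      unfolding pt_def edge_point_def using line_eq_iff[OF P] by simp
    have u: "pt P \<theta> (P \<lceil>\<theta>\<rceil>) = 1 - (\<lceil>\<theta>\<rceil> - \<theta>)"
    proof (cases "\<theta> \<in> \<int>")
      case True
      then have "frac \<theta> = 0" "\<lceil>\<theta>\<rceil> = \<lfloor>\<theta>\<rfloor>" "real_of_int \<lceil>\<theta>\<rceil> = \<theta>" by (auto simp: frac_eq_0_iff elim: Ints_cases)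
      then show ?thesis unfolding pt_def edge_point_def using line_eq_iff[OF P] by simp
    next
      case False
      then have "\<lceil>\<theta>\<rceil> = \<lfloor>\<theta>\<rfloor> + 1"
        using ceiling_altdef[of \<theta>] by (metis Ints_of_int)
      then show ?thesis unfolding pt_def edge_point_def using line_eq_iff[OF P]
        by (simp add: frac_def)
    qed
    have "1 - frac \<eta> > 0" using frac_lt_1[of \<eta>] by simp
    moreover have "1 - (\<lceil>\<theta>\<rceil> - \<theta>) > 0" using ceiling_correct[of \<theta>]
      by linarith
    ultimately have s: "P \<lceil>\<theta>\<rceil> \<in> supp (pt P \<theta>)" "P \<lfloor>\<eta>\<rfloor> \<in> supp (pt P \<eta>)" using u v unfolding supp_def by auto
    have "gdist adj (pt P \<theta>) (pt P \<eta>) \<le> (1 - pt P \<theta> (P \<lceil>\<theta>\<rceil>)) + d (P \<lceil>\<theta>\<rceil>) (P \<lfloor>\<eta>\<rfloor>) + (1 - pt P \<eta> (P \<lfloor>\<eta>\<rfloor>))"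
      by (rule gdist_no_edge(1)[OF R R False s])
    also have "\<dots> = \<eta> - \<theta>" unfolding u v line_d[OF P] using cf
      by (simp add: frac_def)
    finally show ?thesis
      using extend_diff_le_gdist[OF R[of \<theta>] R[of \<eta>] lipschitz_d[of "P ?N"]] diff
      by linarith
  qed
qed

lemma gdist_pt: "line P \<Longrightarrow> gdist adj (pt P \<theta>) (pt P \<eta>) = \<bar>\<theta> - \<eta>\<bar>"
  using gdist_pt_le[of P \<theta> \<eta>] gdist_pt_le[of P \<eta> \<theta>] gdist_sym[OF pt_realization[of P \<theta>] pt_realization[of P \<eta>]]
  by (cases "\<theta> \<le> \<eta>") auto

lemma gdist_vertices: "gdist adj (edge_point u u s) (edge_point v v t) = d u v"
proof -
  let ?x = "edge_point u u s" and ?y = "edge_point v v t"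
  have R: "edge_point w w r \<in> realization adj" for w r
  proof -
    have "edge_point w w r = edge_point w w 0" by simp
    then show ?thesis unfolding realization_def by fastforce
  qed
  have s: "supp (edge_point w w r) = {w}" for w r by (simp add: supp_def)
  show ?thesis
  proof (cases "\<exists>a b. (a = b \<or> adj a b) \<and> supp ?x \<union> supp ?y \<subseteq> {a, b}")
    case True
    then have "u = v \<or> adj u v" unfolding s using adj_sym by auto
    moreover from this have "gdist adj ?x ?y = \<bar>?x u - ?y u\<bar>" 
      by (rule gdist_edge(1)[OF R R]) (simp add: s del: edge_point_self)
    ultimately show ?thesis using d_adj_iff adj_irrefl by auto
  next
    case False
    show ?thesis using gdist_no_edge(2)[OF R R False] unfolding s by simp
  qed
qed

lemma vertex_in_points: "edge_point (P m) (P m) t \<in> points P"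
proof -
  have "edge_point (P m) (P m) t = edge_point (P m) (P (m + 1)) 0"
    by (simp add: edge_point_def fun_eq_iff)
  then show ?thesis unfolding points_def by fastforce
qed

section \<open>Projections and the Ping Pong segment\<close>

definition line_dist :: "(int \<Rightarrow> 'v) \<Rightarrow> 'v \<Rightarrow> int" where
  "line_dist Q w = d w (Q (SOME n. proj Q w n))"

lemma line_dist:
  assumes Q: "line Q" shows "line_dist Q w \<le> d w (Q n)" "\<exists>n. line_dist Q w = d w (Q n)"
proof -
  have "proj Q w (SOME n. proj Q w n)" using ex_proj[OF Q] by (metis someI_ex)
  from projD[OF this, of n] show "line_dist Q w \<le> d w (Q n)" unfolding line_dist_def by linarith
  show "\<exists>n. line_dist Q w = d w (Q n)" unfolding line_dist_def by blast
qed

lemma lipschitz_line_dist: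
  assumes Q: "line Q" shows "lipschitz (\<lambda>u. real_of_int (line_dist Q u))"
proof -
  have *: "line_dist Q u \<le> line_dist Q v + d u v" for u v
  proof -
    obtain n where "line_dist Q v = d v (Q n)" using line_dist(2)[OF Q] by blast
    then show ?thesis using line_dist(1)[OF Q, of u n] d_triangle[of u "Q n" v] by linarith
  qed
  then have "\<bar>line_dist Q u - line_dist Q v\<bar> \<le> d u v" for u v
    using *[of u v] *[of v u] d_sym[of u v] by linarith
  then have "\<bar>real_of_int (line_dist Q u) - real_of_int (line_dist Q v)\<bar> \<le> real_of_int (d u v)" for u v
    using of_int_le_iff[of "\<bar>line_dist Q u - line_dist Q v\<bar>" "d u v"] by simp
  then show ?thesis unfolding lipschitz_def by blast
qed

text \<open>The distance to \<open>Q\<close>, extended from the vertices, is at least \<delta> at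
  every vertex of \<open>P\<close>, affine on edges, and at most \<delta> at a point of the
  projection. So each endpoint that has positive weight in this point attains \<delta>.\<close>

lemma axis_proj_near:
  assumes P: "line P" and Q: "line Q" and x: "x \<in> axis_proj adj (points P) (points Q)"
  obtains k t where "x = edge_point (P k) (P (k + 1)) t" "0 \<le> t" "t \<le> 1"
    "t < 1 \<Longrightarrow> k \<in> near P Q" "0 < t \<Longrightarrow> k + 1 \<in> near P Q"
proof -
  let ?f = "\<lambda>u. real_of_int (line_dist Q u)"
  have xP: "x \<in> points P" and eq: "gsetdist adj {x} (points Q) = gsetdist adj (points P) (points Q)"
    using x unfolding axis_proj_def by auto
  obtain k t where kt: "x = edge_point (P k) (P (k + 1)) t" "0 \<le> t" "t \<le> 1" using xP
    unfolding points_def by blast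
  obtain a where "a \<in> near P Q" using near_nonempty[OF P Q] by blast
  then obtain b where ab: "\<And>m n. d (P a) (Q b) \<le> d (P m) (Q n)" unfolding near_def by blast
  define \<delta> where "\<delta> = real_of_int (d (P a) (Q b))"
  have low: "\<delta> \<le> ?f (P m)" for m using line_dist(2)[OF Q, of "P m"] ab
    unfolding \<delta>_def by auto
  have near: "m \<in> near P Q" if "?f (P m) \<le> \<delta>" for m
  proof -
    obtain n where "line_dist Q (P m) = d (P m) (Q n)" using line_dist(2)[OF Q] by blast
    then have "d (P m) (Q n) \<le> d (P m') (Q n')" for m' n' using that ab[of m' n']
      unfolding \<delta>_def by simp
    then show ?thesis unfolding near_def by blast
  qed
  have RP: "y \<in> realization adj" if "y \<in> points P" for y using that points_realization[OF P]
    by blast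
  have RQ: "y \<in> realization adj" if "y \<in> points Q" for y using that points_realization[OF Q]
    by blast
  have "gsetdist adj (points P) (points Q) \<le> gdist adj (edge_point (P a) (P a) 0) (edge_point (Q b) (Q b) 0)"
    unfolding gsetdist_def
    by (rule cINF_lower2[of _ _ "(edge_point (P a) (P a) 0, edge_point (Q b) (Q b) 0)"])
       (use vertex_in_points gdist_nonneg[OF RP RQ] in \<open>auto intro!: bdd_belowI2[of _ 0]\<close>)
  then have up: "gsetdist adj {x} (points Q) \<le> \<delta>"
    unfolding eq \<delta>_def gdist_vertices .
  have Q0: "extend ?f y = 0" if y: "y \<in> points Q" for y
  proof -
    have "line_dist Q (Q n) = 0" for n
      using line_dist(1)[OF Q, of "Q n" n] line_dist(2)[OF Q, of "Q n"] d_nonneg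
      by (metis d_self order_antisym)
    then show ?thesis using y unfolding points_def by (auto simp: extend_edge_point)
  qed
  have "extend ?f x \<le> gdist adj x y" if y: "y \<in> points Q" for y
    using extend_diff_le_gdist[OF RP[OF xP] RQ[OF y] lipschitz_line_dist[OF Q]] Q0[OF y] by linarith
  then have "extend ?f x \<le> gsetdist adj {x} (points Q)"
    unfolding gsetdist_def using vertex_in_points by (intro cINF_greatest) auto
  from order_trans[OF this up] have le: "(1 - t) * ?f (P k) + t * ?f (P (k + 1)) \<le> \<delta>"
    unfolding kt(1) extend_edge_point .
  have "?f (P k) \<le> \<delta>" if "t < 1"
  proof (rule ccontr)
    assume "\<not> ?f (P k) \<le> \<delta>"
    then have "(1 - t) * \<delta> < (1 - t) * ?f (P k)" using that by simp
    moreover have "t * \<delta> \<le> t * ?f (P (k + 1))" by (rule mult_left_mono[OF low kt(2)])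
    ultimately show False using le by (simp add: algebra_simps)
  qed
  moreover have "?f (P (k + 1)) \<le> \<delta>" if "0 < t"
  proof (rule ccontr)
    assume "\<not> ?f (P (k + 1)) \<le> \<delta>"
    then have "t * \<delta> < t * ?f (P (k + 1))" using that by simp
    moreover have "(1 - t) * \<delta> \<le> (1 - t) * ?f (P k)" by (rule mult_left_mono[OF low])
      (use kt in simp)
    ultimately show False using le by (simp add: algebra_simps)
  qed
  ultimately show ?thesis using that kt near by blast
qed

lemma ping_pong:
  assumes ax: "\<And>i. i \<in> {1..n} \<Longrightarrow> axis (G i) (P i)"
    and diam: "\<And>i j j' a b. i \<in> {1..n} \<Longrightarrow> j \<in> {1..n} - {i} \<Longrightarrow> j' \<in> {1..n} - {i} \<Longrightarrow>
      a \<in> near (P i) (P j) \<Longrightarrow> b \<in> near (P i) (P j') \<Longrightarrow> \<bar>a - b\<bar> < l (G i)"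
  shows "ping_pong_hyps adj n (\<lambda>i. act (G i))"
  unfolding ping_pong_hyps_def
proof (intro conjI exI[of _ "\<lambda>i. points (P i)"] ballI)
  fix i assume i: "i \<in> {1..n}"
  note A = axis_pos[OF ax[OF i]] and L = axis_line[OF ax[OF i]]
  show "hyperbolic adj (act (G i))" unfolding hyperbolic_def using A by (simp add: l_def)
  show "is_axis adj (act (G i)) (points (P i))"
    unfolding is_axis_def points_def
    using line_eq_iff[OF L] line_adj[OF L] axis_act[OF ax[OF i]]
    by (intro exI[of _ "P i"]) (auto simp: inj_def l_def)
  define N where "N = (\<Union>j\<in>{1..n} - {i}. near (P i) (P j))"
  have dN: "\<bar>a - b\<bar> < l (G i)" if "a \<in> N" "b \<in> N" for a b using diam[OF i] that
    unfolding N_def by blast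
  obtain h where h: "\<And>a. a \<in> N \<Longrightarrow> h \<le> a \<and> a < h + l (G i)"
  proof (cases "N = {}")
    case False
    then obtain c where c: "c \<in> N" by blast
    have fin: "finite N" by (rule finite_subset[of _ "{c - l (G i)..c + l (G i)}"])
      (use dN[OF _ c] in fastforce)+
    have "Min N \<le> a \<and> a < Min N + l (G i)" if "a \<in> N" for a
      using Min_le[OF fin that] dN[OF that Min_in[OF fin False]] by linarith
    then show ?thesis by (rule that)
  qed auto
  \<comment> \<open>The projections occupy parameters between \<open>h\<close> and
    \<open>h + l (G i) - 1\<close>; starting half a unit earlier keeps both extremes inside the open
    segment.\<close>
  define s where "s = real_of_int h - 1 / 2"
  define c where "c r = pt (P i) (s + r)" for r
  have len: "real (transl_len adj (act (G i))) = real_of_int (l (G i))" by (simp add: l_def)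
  show "\<exists>S. is_open_segment adj (real (transl_len adj (act (G i)))) S \<and> S \<subseteq> points (P i) \<and>
      (\<Union>j\<in>{1..n} - {i}. axis_proj adj (points (P i)) (points (P j))) \<subseteq> S"
    unfolding len
  proof (intro exI[of _ "c ` {0<..<real_of_int (l (G i))}"] conjI)
    have sub: "c ` {0<..<real_of_int (l (G i))} \<subseteq> points (P i)" unfolding c_def points_eq
      by blast
    then show "c ` {0<..<real_of_int (l (G i))} \<subseteq> points (P i)" .
    show "is_open_segment adj (real_of_int (l (G i))) (c ` {0<..<real_of_int (l (G i))})"
      unfolding is_open_segment_def
    proof (intro exI[of _ c] conjI ballI)
      show "c ` {0<..<real_of_int (l (G i))} \<subseteq> realization adj"
        using sub points_realization[OF L] by blast
      show "gdist adj (c r) (c t) = \<bar>r - t\<bar>" for r t unfolding c_def gdist_pt[OF L]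
        by simp
    qed simp
    show "(\<Union>j\<in>{1..n} - {i}. axis_proj adj (points (P i)) (points (P j))) \<subseteq> c ` {0<..<real_of_int (l (G i))}"
    proof (rule UN_least)
      fix j assume j: "j \<in> {1..n} - {i}"
      show "axis_proj adj (points (P i)) (points (P j)) \<subseteq> c ` {0<..<real_of_int (l (G i))}"
      proof
        fix x assume x: "x \<in> axis_proj adj (points (P i)) (points (P j))"
        have Lj: "line (P j)" using axis_line ax j by blast
        obtain k t where kt: "x = edge_point (P i k) (P i (k + 1)) t" "0 \<le> t" "t \<le> 1"
          "t < 1 \<Longrightarrow> k \<in> near (P i) (P j)" "0 < t \<Longrightarrow> k + 1 \<in> near (P i) (P j)"
          using axis_proj_near[OF L Lj x] by metis
        have x': "x = c (k + t - s)" unfolding c_def kt(1) pt_edge_point[OF kt(2,3)] by simp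
        have hk: "t < 1 \<Longrightarrow> h \<le> k \<and> k < h + l (G i)" "0 < t \<Longrightarrow> h \<le> k + 1 \<and> k + 1 < h + l (G i)"
          using kt(4,5) h j unfolding N_def by blast+
        have bound: "real_of_int h \<le> k + t \<and> k + t \<le> real_of_int h + real_of_int (l (G i)) - 1"
        proof -
          consider "t = 0" | "t = 1" | "0 < t" "t < 1" using kt(2,3) by linarith
          then show ?thesis
          proof cases
            case 1
            then have "h \<le> k" "k \<le> h + l (G i) - 1" using hk(1) by simp_all
            then show ?thesis using 1 by linarith
          next
            case 2
            then have "h \<le> k + 1" "k + 1 \<le> h + l (G i) - 1" using hk(2) by simp_all
            then show ?thesis using 2 by linarith
          next
            case 3
            then have "h \<le> k" "k + 1 \<le> h + l (G i) - 1" using hk by simp_all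
            then show ?thesis using 3 by linarith
          qed
        qed
        then have "k + t - s \<in> {0<..<real_of_int (l (G i))}" unfolding s_def by simp
        then show "x \<in> c ` {0<..<real_of_int (l (G i))}" using x' by blast
      qed
    qed
  qed
qed

end

section \<open>Minimal tuples\<close>

context stree
begin

lemma act_comp: "act g \<circ> act h = act (g + h)"
  by (simp add: plus_bijection.rep_eq)

lemma inv_act: "inv (act g) = act (- g)"
  by (simp add: uminus_bijection.rep_eq)

definition move :: "nat \<Rightarrow> nat set \<Rightarrow> nat set \<Rightarrow> (nat \<Rightarrow> 'v bijection) \<Rightarrow> nat \<Rightarrow> 'v bijection" where
  "move j S1 S2 G i = (if i \<in> S1 then G j else 0) + G i - (if i \<in> S2 then G j else 0)"

lemma tuple_move_act: "tuple_move j S1 S2 (\<lambda>i. act (G i)) = (\<lambda>i. act (move j S1 S2 G i))"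
  by (rule ext) (auto simp: tuple_move_def move_def inv_act act_comp minus_bijection_def simp del: add_uminus_conv_diff)

lemma total_len_2: "int (total_len adj 2 (\<lambda>i. act (G i))) = l (G 1) + l (G 2) + F (G 1) (G 2)"
proof -
  have "{1..2} = {1, 2::nat}" "{1<..2} = {2::nat}" "{Suc 0<..2} = {2::nat}" by auto
  then show ?thesis
    by (simp add: total_len_def inv_act act_comp l_def F_def)
qed

lemma total_len_3: "int (total_len adj 3 (\<lambda>i. act (G i))) = total (G 1) (G 2) (G 3)"
proof -
  have "{1..3} = {1, 2, 3::nat}" "{1<..3} = {2, 3::nat}" "{Suc 0<..3} = {2, 3::nat}" "{2<..3} = {3::nat}" by auto
  then show ?thesis
    by (simp add: total_len_def inv_act act_comp l_def F_def total_def)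
qed

lemma moves_cases:
  assumes "h' \<in> moves g h"
  obtains a b where "h' = (if a then g else 0) + h - (if b then g else 0)"
proof -
  have "h' = (if False then g else 0) + h - (if False then g else 0) \<or>
    h' = (if True then g else 0) + h - (if False then g else 0) \<or>
    h' = (if False then g else 0) + h - (if True then g else 0) \<or>
    h' = (if True then g else 0) + h - (if True then g else 0)"
    using assms unfolding moves_def by auto
  then show ?thesis using that by metis
qed

lemma minimal3_minimal_tuple:
  assumes iso: "\<And>i. i \<in> {1..3} \<Longrightarrow> iso (G i)" and m: "minimal_tuple adj 3 (\<lambda>i. act (G i))"
  shows "minimal3 (G 1) (G 2) (G 3)"
proof -
  \<comment> \<open>The argument is the same for each acting index \<open>j\<close>;
    \<open>tot\<close> records that the total length does not depend on the order in which the
    entries are listed.\<close>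
  have at: "min_at (G j) (G i) (G k)"
    if ijk: "{j, i, k} = {1..3}" "j \<noteq> i" "j \<noteq> k" "i \<noteq> k"
      and tot: "\<And>Y. (\<And>i. i \<in> {1..3} \<Longrightarrow> iso (Y i)) \<Longrightarrow> total (Y 1) (Y 2) (Y 3) = total (Y j) (Y i) (Y k)" for j i k
    unfolding min_at_def
  proof (intro ballI)
    fix h' k' assume "h' \<in> moves (G j) (G i)" "k' \<in> moves (G j) (G k)"
    then obtain a b a' b' where ab: "h' = (if a then G j else 0) + G i - (if b then G j else 0)"
      "k' = (if a' then G j else 0) + G k - (if b' then G j else 0)" using moves_cases by metis
    define S1 S2 where "S1 = {x. x = i \<and> a \<or> x = k \<and> a'}" and "S2 = {x. x = i \<and> b \<or> x = k \<and> b'}"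
    have mv: "move j S1 S2 G i = h'" "move j S1 S2 G k = k'" "move j S1 S2 G j = G j"
      unfolding move_def S1_def S2_def ab using ijk(2,3,4) by auto
    have j: "j \<in> {1..3}" "S1 \<subseteq> {1..3} - {j}" "S2 \<subseteq> {1..3} - {j}"
      unfolding S1_def S2_def using ijk by blast+
    have "iso 0" by (simp add: iso_def)
    then have im: "iso (move j S1 S2 G x)" if "x \<in> {1..3}" for x
      using iso[OF that] iso[OF j(1)] unfolding move_def by auto
    have "total_len adj 3 (\<lambda>i. act (G i)) \<le> total_len adj 3 (\<lambda>i. act (move j S1 S2 G i))"
      using m j unfolding minimal_tuple_def tuple_move_act by blast
    then have "total (G 1) (G 2) (G 3) \<le> total (move j S1 S2 G 1) (move j S1 S2 G 2) (move j S1 S2 G 3)"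
      unfolding total_len_3[symmetric] by simp
    moreover have "total (G 1) (G 2) (G 3) = total (G j) (G i) (G k)" by (rule tot) (rule iso)
    moreover have "total (move j S1 S2 G 1) (move j S1 S2 G 2) (move j S1 S2 G 3)
        = total (move j S1 S2 G j) (move j S1 S2 G i) (move j S1 S2 G k)" by (rule tot) (rule im)
    ultimately show "total (G j) (G i) (G k) \<le> total (G j) h' k'" unfolding mv by linarith
  qed
  have i3: "iso (Y 1)" "iso (Y 2)" "iso (Y 3)" if "\<And>i. i \<in> {1..3} \<Longrightarrow> iso (Y i)" for Y :: "nat \<Rightarrow> 'v bijection"
    using that by auto
  have "min_at (G 1) (G 2) (G 3)" by (rule at) auto
  moreover have "min_at (G 2) (G 1) (G 3)"
  proof (rule at)
    fix Y :: "nat \<Rightarrow> 'v bijection" assume "\<And>i. i \<in> {1..3} \<Longrightarrow> iso (Y i)"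
    then have "iso (Y 1)" "iso (Y 2)" "iso (Y 3)" by auto
    then show "total (Y 1) (Y 2) (Y 3) = total (Y 2) (Y 1) (Y 3)"
      using F_commute[of "Y 1" "Y 2"] by (simp add: total_def)
  qed auto
  moreover have "min_at (G 3) (G 1) (G 2)"
  proof (rule at)
    fix Y :: "nat \<Rightarrow> 'v bijection" assume "\<And>i. i \<in> {1..3} \<Longrightarrow> iso (Y i)"
    then have "iso (Y 1)" "iso (Y 2)" "iso (Y 3)" by auto
    then show "total (Y 1) (Y 2) (Y 3) = total (Y 3) (Y 1) (Y 2)"
      using F_commute[of "Y 1" "Y 3"] F_commute[of "Y 2" "Y 3"] by (simp add: total_def)
  qed auto
  ultimately show ?thesis using i3[of G] iso unfolding minimal3_def by blast
qed

lemma minimal_pair_moves: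
  assumes iso: "iso (G 1)" "iso (G 2)" and m: "minimal_tuple adj 2 (\<lambda>i. act (G i))"
    and ij: "{i, j} = {1, 2}" "i \<noteq> j" and h': "h' \<in> moves (G j) (G i)"
  shows "l (G i) + F (G j) (G i) \<le> l h' + F (G j) h'"
proof -
  obtain a b where ab: "h' = (if a then G j else 0) + G i - (if b then G j else 0)"
    using moves_cases[OF h'] by metis
  define S1 S2 where "S1 = {x. x = i \<and> a}" and "S2 = {x. x = i \<and> b}"
  have mv: "move j S1 S2 G i = h'" "move j S1 S2 G j = G j"
    unfolding move_def S1_def S2_def ab using ij by auto
  have e: "{1..2} = {1, 2::nat}" by auto
  have j: "j \<in> {1..2}" "S1 \<subseteq> {1..2} - {j}" "S2 \<subseteq> {1..2} - {j}"
    unfolding S1_def S2_def e using ij by blast+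
  have "total_len adj 2 (\<lambda>i. act (G i)) \<le> total_len adj 2 (\<lambda>i. act (move j S1 S2 G i))"
    using m j unfolding minimal_tuple_def tuple_move_act by blast
  then have le: "l (G 1) + l (G 2) + F (G 1) (G 2)
      \<le> l (move j S1 S2 G 1) + l (move j S1 S2 G 2) + F (move j S1 S2 G 1) (move j S1 S2 G 2)"
    unfolding total_len_2[symmetric] by simp
  have ih: "iso h'" using iso_moves[OF _ _ h'] iso ij by (metis doubleton_eq_iff)
  have "i = 1 \<and> j = 2 \<or> i = 2 \<and> j = 1" using ij by (metis doubleton_eq_iff)
  then show ?thesis
  proof
    assume "i = 1 \<and> j = 2"
    then show ?thesis using le mv F_commute[of "G 1" "G 2"] F_commute[of h' "G 2"] iso ih by simp
  next
    assume "i = 2 \<and> j = 1"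
    then show ?thesis using le mv by simp
  qed
qed

text \<open>For a pair no third isometry interferes: dividing \<open>h\<close> by \<open>g'\<close>
  replaces \<open>l (h + g')\<close> by \<open>l (h - g' - g')\<close>, which is smaller by at least
  \<open>l g\<close>.\<close>

lemma pair_no_overlap_aux:
  assumes g: "axis g S" and h: "axis h P" and le: "l g \<le> l h"
    and min: "\<And>h'. h' \<in> moves g h \<Longrightarrow> l h + F g h \<le> l h' + F g h'"
  shows "\<not> overlap g h"
proof
  assume "overlap g h"
  then obtain g' S' s where g': "g' = g \<or> g' = - g" "axis g' S'" "aligned P S'" "S' s = P s" "S' (s + l g) = P (s + l g)"
    using overlap_aligned[OF g h _ le] by blast
  note i = axis_iso[OF g] axis_iso[OF h]
  have lg: "l g' = l g" using g'(1) i by auto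
  have 1: "l (h + g') = l h + l g'" by (rule l_plus_aligned[OF h g'(2,3) g'(4)[symmetric]])
  have 2: "l (h - g' - g') \<le> l h"
    by (rule l_minus_minus_le[OF h g'(2,4)]) (simp_all add: lg le g'(5))
  have F: "F g h = l (h + g) + l (h - g)" using F_commute[OF i] by (simp add: F_def)
  have "l (h + g') \<le> l (h - g' - g')" using g'(1)
  proof
    assume e: "g' = g"
    have "l h + F g h \<le> l (h - g) + F g (h - g)" by (rule min) (simp add: moves_def)
    then show ?thesis using F F_minus_self[OF i] unfolding e by linarith
  next
    assume e: "g' = - g"
    have "l h + F g h \<le> l (g + h) + F g (g + h)" by (rule min) (simp add: moves_def)
    moreover have "l (g - (g + h)) = l h"
    proof -
      have "l (g - (g + h)) = l ((g + h) - g)" using l_minus_commute[of g "g + h"] i by simp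
      then show ?thesis using l_conj[OF i] by simp
    qed
    moreover have "l (g + (g + h)) = l (h + g + g)"
      by (rule l_rotate[of "g + g" h]) (use i in \<open>auto simp only: word_simps iso_plus\<close>)
    moreover have "l (g + h) = l (h + g)" using l_commute i by blast
    ultimately have "l (h - g) \<le> l (h + g + g)" using F unfolding F_def by linarith
    then show ?thesis unfolding e by simp
  qed
  then show False using 1 2 axis_pos[OF g] lg by linarith
qed

lemma act_Bijection: "bij f \<Longrightarrow> act (Bijection f) = f"
  by (simp add: Bijection_inverse)

lemma ping_pong_hyps_if_minimal:
  assumes n: "n \<in> {2, 3}" and ti: "\<forall>i\<in>{1..n}. tree_isometry adj (X i)"
    and wi: "\<forall>g\<in>tuple_group n X. without_inversions adj g" and mt: "minimal_tuple adj n X"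
    and hyp: "\<forall>i\<in>{1..n}. \<not> elliptic adj (X i)"
  shows "ping_pong_hyps adj n X"
proof -
  \<comment> \<open>Outside \<open>{1..n}\<close> the functions \<open>X i\<close> are arbitrary and
    may fail to be bijective, hence the default \<open>0\<close>. Lengths and moves see only the
    indices in \<open>{1..n}\<close>, so minimality carries over to \<open>Y\<close>.\<close>
  define G where "G i = (if i \<in> {1..n} then Bijection (X i) else 0)" for i
  define Y where "Y i = act (G i)" for i
  have YX: "Y i = X i" if "i \<in> {1..n}" for i
  proof -
    have "bij (X i)" using ti that unfolding tree_isometry_def by blast
    then show ?thesis using that unfolding Y_def G_def by (simp add: act_Bijection)
  qed
  have iso: "iso (G i)" if "i \<in> {1..n}" for i
    using ti that YX[OF that] unfolding iso_def Y_def tree_isometry_def d_def by simp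
  have pos: "0 < l (G i)" if "i \<in> {1..n}" for i
    using hyp that YX[OF that] unfolding l_def Y_def elliptic_def by simp
  have "\<exists>P. axis (G i) P" if i: "i \<in> {1..n}" for i
  proof -
    have "X i \<in> tuple_group n X" unfolding tuple_group_def using i by (intro generate.incl) auto
    then have "without_inversions adj (act (G i))" using wi YX[OF i] unfolding Y_def by simp
    then have "G i $ G i $ u \<noteq> u" if "d u (G i $ u) = 1" for u
      using that d_adj_iff unfolding without_inversions_def by blast
    then show ?thesis using ex_axis[OF iso[OF i] pos[OF i]] by blast
  qed
  then obtain P where P: "\<And>i. i \<in> {1..n} \<Longrightarrow> axis (G i) (P i)" by metis
  have sums: "total_len adj n (\<lambda>i. act (H i)) = total_len adj n Z"
    if "\<And>i. i \<in> {1..n} \<Longrightarrow> act (H i) = Z i" for H Z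
    unfolding total_len_def using that by (intro arg_cong2[where f = "(+)"] sum.cong refl) auto
  have mY: "minimal_tuple adj n Y"
    unfolding minimal_tuple_def
  proof (intro ballI allI impI)
    fix j S1 S2 assume j: "j \<in> {1..n}" and S: "S1 \<subseteq> {1..n} - {j}" "S2 \<subseteq> {1..n} - {j}"
    have "total_len adj n Y = total_len adj n X" unfolding Y_def by (rule sums)
      (use YX Y_def in auto)
    also have "\<dots> \<le> total_len adj n (tuple_move j S1 S2 X)" using mt j S
      unfolding minimal_tuple_def by blast
    also have "\<dots> = total_len adj n (tuple_move j S1 S2 Y)"
      unfolding Y_def tuple_move_act
    proof (rule sums[symmetric])
      fix x assume x: "x \<in> {1..n}"
      have "act (move j S1 S2 G x) = tuple_move j S1 S2 Y x"
        using fun_cong[OF tuple_move_act[of j S1 S2 G], of x] unfolding Y_def by simp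
      also have "\<dots> = tuple_move j S1 S2 X x" unfolding tuple_move_def YX[OF x] YX[OF j] ..
      finally show "act (move j S1 S2 G x) = tuple_move j S1 S2 X x" .
    qed
    finally show "total_len adj n Y \<le> total_len adj n (tuple_move j S1 S2 Y)" .
  qed
  have near: "\<bar>a - b\<bar> < l (G i)"
    if ij: "i \<in> {1..n}" "j \<in> {1..n} - {i}" "j' \<in> {1..n} - {i}" "a \<in> near (P i) (P j)" "b \<in> near (P i) (P j')"
    for i j j' a b
  proof (cases "n = 2")
    case True
    then have e: "{1..n} = {1, 2}" by auto
    have i12: "iso (G 1)" "iso (G 2)" using iso unfolding e by auto
    have "minimal_tuple adj 2 (\<lambda>i. act (G i))" using mY True unfolding Y_def by simp
    note mv = minimal_pair_moves[OF i12 this]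
    \<comment> \<open>With two isometries both projections come from the same axis, so excluding a
      long overlap is enough.\<close>
    have jj: "j' = j" "{i, j} = {1, 2}" "i \<noteq> j" using ij unfolding e by auto
    have "\<not> overlap (G i) (G j)"
    proof (cases "l (G i) \<le> l (G j)")
      case True
      show ?thesis
        by (rule pair_no_overlap_aux[OF P P True]) (use ij mv[of j i] jj in auto)
    next
      case False
      then have "\<not> overlap (G j) (G i)"
        by (intro pair_no_overlap_aux[OF P P]) (use ij mv[of i j] jj in auto)
      then show ?thesis using overlap_sym by blast
    qed
    then show ?thesis using near_small(1)[OF P P] ij jj by blast
  next
    case False
    then have n3: "n = 3" using n by auto
    then have e: "{1..n} = {1, 2, 3}" by auto
    have i123: "iso (G i)" if "i \<in> {1..3}" for i using iso that n3 by simp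
    have "minimal_tuple adj 3 (\<lambda>i. act (G i))" using mY n3 unfolding Y_def by simp
    note m = minimal3_minimal_tuple[OF i123 this]
    have m2: "minimal3 (G 1) (G 2) (G 3)" "minimal3 (G 2) (G 1) (G 3)" "minimal3 (G 3) (G 1) (G 2)"
      using m minimal3_swap12 minimal3_swap23 by blast+
    have P': "axis (G 1) (P 1)" "axis (G 2) (P 2)" "axis (G 3) (P 3)" using P unfolding e by auto
    note D = near_diameter[OF m2(1) P'(1,2,3), of a b] near_diameter[OF m2(2) P'(2,1,3), of a b]
      near_diameter[OF m2(3) P'(3,1,2), of a b]
    show ?thesis using ij D unfolding e by auto
  qed
  have "ping_pong_hyps adj n Y" unfolding Y_def by (rule ping_pong[OF P near])
  then show ?thesis unfolding ping_pong_hyps_def using YX by simp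
qed

end

theorem theorem2p4:
  fixes adj :: "'v \<Rightarrow> 'v \<Rightarrow> bool" and n :: nat and X :: "nat \<Rightarrow> 'v \<Rightarrow> 'v"
  assumes "simplicial_tree adj"
    and "n \<in> {2, 3}"
    and "\<forall>i\<in>{1..n}. tree_isometry adj (X i)"
    and "\<forall>g\<in>tuple_group n X. without_inversions adj g"
    and "minimal_tuple adj n X"
  shows "(\<exists>i\<in>{1..n}. elliptic adj (X i)) \<or> ping_pong_hyps adj n X"
proof -
  interpret stree adj by standard (rule assms(1))
  show ?thesis using ping_pong_hyps_if_minimal[OF assms(2-5)] by blast
qed

end
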